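(* Let $m\ge 1$ be an integer, $2\le p\le\infty$ and $q=p/(p-1)$ (with $q=1$ if $p=\infty$). For every finite-dimensional complex Hilbert space $\mathcal H$ and all positive semidefinite $R,X_1,\dots,X_m\in\mathcal B(\mathcal H)$, $$\|RX_1\|_1+\cdots+\|RX_m\|_1\le C_{p,m}\,\|R\|_q\,\|X_1+\cdots+X_m\|_p .$$ Here, for $2\le p<\infty$, $$C_{p,m}=\frac{\sqrt{x_{p,m}(x_{p,m}+m-1)}}{(x_{p,m}^p+m-1)^{1/p}},$$ where $x_{p,m}$ is the unique solution in $(1,\infty)$ of $x^p=2x+m-1$, and $C_{\infty,m}=\sqrt m$. Moreover, for each such $p$ and $m$ the constant $C_{p,m}$ is optimal over all finite-dimensional $\mathcal H$: if $C$ is a real constant such that $\sum_{k=1}^m\|RX_k\|_1\le C\|R\|_q\|\sum_{k=1}^m X_k\|_p$ for every finite-dimensional $\mathcal H$ and all positive semidefinite $R,X_1,\dots,X_m\in\mathcal B(\mathcal H)$, then $C\ge C_{p,m}$.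
   Context: $\mathcal B(\mathcal H)$ is the space of linear operators on $\mathcal H$. For $A\in\mathcal B(\mathcal H)$, $|A|=(A^*A)^{1/2}$; for $1\le p<\infty$, $\|A\|_p=(\operatorname{Tr}|A|^p)^{1/p}$ is the Schatten $p$-norm, and $\|A\|_\infty$ is the operator norm. *)

theory Defs
  imports "Jordan_Normal_Form.Schur_Decomposition" "HOL-Library.Extended_Real"
begin

text \<open>
  A finite-dimensional complex Hilbert space is taken to be \<open>\<complex>\<^sup>n\<close> with its standard inner product
  (choose an orthonormal basis), so that operators are the elements of
  \<open>carrier_mat n n :: complex mat set\<close>. The dimension is thus a number and can be quantified
  over inside a formula.
\<close>

text \<open>\<open>v \<bullet>c w\<close> is linear in the first argument, so \<open>(A *\<^sub>v v) \<bullet>c v\<close> is the quadratic form of \<open>A\<close>.\<close>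

definition psd_mat :: "nat \<Rightarrow> complex mat \<Rightarrow> bool" where
  "psd_mat n A \<longleftrightarrow>
     A \<in> carrier_mat n n \<and> mat_adjoint A = A \<and>
     (\<forall>v \<in> carrier_vec n. 0 \<le> Re ((A *\<^sub>v v) \<bullet>c v))"

definition mat_trace :: "complex mat \<Rightarrow> complex" where
  "mat_trace A = (\<Sum>i<dim_row A. A $$ (i, i))"

definition spectral_decomp :: "nat \<Rightarrow> complex mat \<Rightarrow> complex mat \<Rightarrow> (nat \<Rightarrow> real) \<Rightarrow> bool" where
  "spectral_decomp n A U d \<longleftrightarrow>
     U \<in> carrier_mat n n \<and> mat_adjoint U * U = 1\<^sub>m n \<and> U * mat_adjoint U = 1\<^sub>m n \<and>
     A = U * mat_diag n (\<lambda>i. complex_of_real (d i)) * mat_adjoint U"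

text \<open>
  \<open>A\<^sup>r\<close> for positive semidefinite \<open>A\<close> and real \<open>r > 0\<close>, by functional calculus. The result does
  not depend on the chosen unitary diagonalisation (\<open>spectral_decomp_fun_unique\<close> below).
  Since \<open>0 powr r = 0\<close>, the kernel of \<open>A\<close> is mapped to \<open>0\<close>, as it should be for \<open>r > 0\<close>.
\<close>

definition mat_powr :: "complex mat \<Rightarrow> real \<Rightarrow> complex mat" where
  "mat_powr A r =
     (THE B. \<exists>U d. spectral_decomp (dim_row A) A U d \<and> (\<forall>i<dim_row A. 0 \<le> d i) \<and>
        B = U * mat_diag (dim_row A) (\<lambda>i. complex_of_real (d i powr r)) * mat_adjoint U)"

definition mat_abs :: "complex mat \<Rightarrow> complex mat" where
  "mat_abs A = mat_powr (mat_adjoint A * A) (1/2)"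

definition eucl_norm :: "complex vec \<Rightarrow> real" where
  "eucl_norm v = sqrt (Re (v \<bullet>c v))"

definition op_norm :: "complex mat \<Rightarrow> real" where
  "op_norm A = Sup {eucl_norm (A *\<^sub>v v) | v. v \<in> carrier_vec (dim_col A) \<and> eucl_norm v \<le> 1}"

definition schatten_norm :: "ereal \<Rightarrow> complex mat \<Rightarrow> real" where
  "schatten_norm p A =
     (if p = \<infinity> then op_norm A
      else Re (mat_trace (mat_powr (mat_abs A) (real_of_ereal p))) powr (1 / real_of_ereal p))"

definition x_root :: "real \<Rightarrow> nat \<Rightarrow> real" where
  "x_root p m = (THE x. 1 < x \<and> x powr p = 2 * x + real m - 1)"

definition C_const :: "ereal \<Rightarrow> nat \<Rightarrow> real" where
  "C_const p m =
     (if p = \<infinity> then sqrt (real m)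
      else let r = real_of_ereal p; x = x_root r m
           in sqrt (x * (x + real m - 1)) / (x powr r + real m - 1) powr (1 / r))"

lemma mat_adjoint_carrier: "A \<in> carrier_mat n m \<Longrightarrow> mat_adjoint A \<in> carrier_mat m n"
  by (auto simp: mat_adjoint_def)

lemma spectral_decomp_fun_unique:
  fixes f :: "real \<Rightarrow> real"
  assumes "spectral_decomp n A U d" and "spectral_decomp n A V e"
  shows "U * mat_diag n (\<lambda>i. complex_of_real (f (d i))) * mat_adjoint U
       = V * mat_diag n (\<lambda>i. complex_of_real (f (e i))) * mat_adjoint V"
proof -
  let ?U' = "mat_adjoint U" and ?V' = "mat_adjoint V"
  let ?D = "\<lambda>g. mat_diag n (\<lambda>i. complex_of_real (g i))"
  have U: "U \<in> carrier_mat n n" "?U' \<in> carrier_mat n n" "?U' * U = 1\<^sub>m n" "U * ?U' = 1\<^sub>m n"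
    and AU: "A = U * ?D d * ?U'"
    and V: "V \<in> carrier_mat n n" "?V' \<in> carrier_mat n n" "?V' * V = 1\<^sub>m n" "V * ?V' = 1\<^sub>m n"
    and AV: "A = V * ?D e * ?V'"
    using assms mat_adjoint_carrier unfolding spectral_decomp_def by blast+
  define W where "W = ?V' * U"
  have W: "W \<in> carrier_mat n n" using U V by (simp add: W_def)
  have D: "?D g \<in> carrier_mat n n" for g by simp
  have cancel: "P * (Q * Y) = Y"
    if "P \<in> carrier_mat n n" "Q \<in> carrier_mat n n" "P * Q = 1\<^sub>m n" "Y \<in> carrier_mat n n"
    for P Q Y :: "complex mat"
    using that assoc_mult_mat[of P n n Q n Y n] by simp
  note assoc = assoc_mult_mat[where ?n\<^sub>1=n and ?n\<^sub>2=n and ?n\<^sub>3=n and ?n\<^sub>4=n]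
  have sandwich: "?V' * (U * X * ?U') * U = W * X" "?V' * (V * X * ?V') * U = X * W"
    "V * (W * X) * ?U' = U * X * ?U'" "V * (X * W) * ?U' = V * X * ?V'"
    if X: "X \<in> carrier_mat n n" for X
    using U V X by (simp_all add: W_def assoc cancel)
  have WD: "W * ?D d = ?D e * W"
    using sandwich(1)[OF D, of d] sandwich(2)[OF D, of e] AU AV by simp
  have entry: "W $$ (i, j) * complex_of_real (d j) = complex_of_real (e i) * W $$ (i, j)"
    if "i < n" "j < n" for i j
    using arg_cong[OF WD, of "\<lambda>M. M $$ (i, j)"] that
    unfolding mat_diag_mult_left[OF W] mat_diag_mult_right[OF W] by simp
  have "W $$ (i, j) * complex_of_real (f (d j)) = complex_of_real (f (e i)) * W $$ (i, j)"
    if "i < n" "j < n" for i j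
    using entry[OF that] by (cases "W $$ (i, j) = 0") (simp_all add: mult.commute)
  then have "W * ?D (\<lambda>i. f (d i)) = ?D (\<lambda>i. f (e i)) * W"
    unfolding mat_diag_mult_left[OF W] mat_diag_mult_right[OF W] by (intro eq_matI) auto
  then show ?thesis
    using sandwich(3)[OF D, of "\<lambda>i. f (d i)"] sandwich(4)[OF D, of "\<lambda>i. f (e i)"] by simp
qed

end

theory Submission
  imports Defs "HOL-Complex_Analysis.Complex_Analysis"
begin

text \<open>
  Choose unitaries \<open>W\<^sub>k\<close> with \<open>\<parallel>R X\<^sub>k\<parallel>\<^sub>1 = Tr (W\<^sub>k R X\<^sub>k)\<close> and put \<open>A = \<Sum> X\<^sub>k W\<^sub>k\<close>, \<open>S = \<Sum> X\<^sub>k\<close>. On \<open>m\<close> copies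
  of the space let \<open>\<Delta> = diag (X\<^sub>1, \<dots>, X\<^sub>m)\<close>, let \<open>M\<close> be the block matrix \<open>(X\<^sub>j\<^bsup>1/2\<^esup> X\<^sub>k\<^bsup>1/2\<^esup>)\<close>, which has the
  nonzero spectrum of \<open>S\<close> and the diagonal blocks of \<open>\<Delta>\<close>, and let \<open>u\<close> be the isometry with blocks
  \<open>W\<^sub>k / \<surd>m\<close>, so that \<open>A* A = m u* \<Delta>\<^bsup>1/2\<^esup> M \<Delta>\<^bsup>1/2\<^esup> u\<close>. Let \<open>r = p / 2\<close>, \<open>\<Omega> = u u*\<close>,
  \<open>g(z) = x\<^bsup>(1 - r z) / 2\<^esup> \<Omega> + (1 - \<Omega>)\<close>, and let \<open>\<rho>\<close> be the multiple of \<open>R\<^sup>q\<close> with \<open>Tr \<rho> = Tr \<Delta>\<^sup>p / m\<close>. The three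
  lines theorem is applied to
  \<open>F(z) = Tr (M\<^bsup>r z\<^esup> \<Delta>\<^bsup>r z / 2\<^esup> g(z) (u \<rho>\<^bsup>1 - z\<^esup> u* + \<beta> \<Delta>\<^bsup>2 r (1 - z)\<^esup>) g(z) \<Delta>\<^bsup>r z / 2\<^esup>)\<close>.
  At \<open>z = 1 / r\<close> the weight \<open>g\<close> disappears and \<open>F\<close> equals \<open>Tr (A \<rho>\<^bsup>1 - 1 / r\<^esup> A*) / m + \<beta> Tr \<Delta>\<^sup>p\<close>; on the two
  boundary lines \<open>F\<close> is controlled by \<open>Tr \<rho>\<close>, \<open>Tr S\<^sup>p\<close> and \<open>Tr \<Delta>\<^sup>p\<close>. The arithmetic-geometric mean inequality
  and the Cauchy-Schwarz bound for \<open>Tr (R A)\<close> then remove \<open>Tr \<Delta>\<^sup>p\<close>. The weight and \<open>\<beta> = x / (x + m - 1)\<close> are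
  chosen such that \<open>F\<close> is log-linear in the extremal case, where \<open>R = v v*\<close> is a rank one projection and the
  \<open>X\<^sub>k\<close> have rank one with \<open>S = 1 + (x - 1) v v*\<close>; the equation \<open>x\<^sup>p = 2 x + m - 1\<close> maximizes the resulting ratio.
  For \<open>p = \<infinity>\<close> Bessel's inequality is enough, and the extremal case is \<open>x = 1\<close>.
\<close>

section \<open>The three lines theorem\<close>

text \<open>A truncation of the strip. The horizontal sides are where the Gaussian factor in
  \<open>three_lines\<close> gives the bound.\<close>

lemma maximum_modulus_rectangle:
  fixes g :: "complex \<Rightarrow> complex"
  assumes hol: "g holomorphic_on UNIV" and T: "0 < T"
    and bd: "\<And>z. z \<in> cbox (Complex 0 (-T)) (Complex 1 T) \<Longrightarrow> Re z = 0 \<or> Re z = 1 \<or> \<bar>Im z\<bar> = T \<Longrightarrow> norm (g z) \<le> 1"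
    and t: "0 \<le> t" "t \<le> 1"
  shows "norm (g (of_real t)) \<le> 1"
proof (rule maximum_modulus_frontier[where f = g and \<xi> = "of_real t" and S = "cbox (Complex 0 (-T)) (Complex 1 T)"])
  show "g holomorphic_on interior (cbox (Complex 0 (-T)) (Complex 1 T))"
    using hol holomorphic_on_subset by blast
  show "continuous_on (closure (cbox (Complex 0 (-T)) (Complex 1 T))) g"
    using hol holomorphic_on_imp_continuous_on continuous_on_subset by blast
  show "bounded (cbox (Complex 0 (-T)) (Complex 1 T))" by simp
  show "of_real t \<in> cbox (Complex 0 (-T)) (Complex 1 T)"
    using t T by (auto simp: in_cbox_complex_iff)
next
  fix z assume z: "z \<in> frontier (cbox (Complex 0 (-T)) (Complex 1 T))"
  then have zc: "z \<in> cbox (Complex 0 (-T)) (Complex 1 T)" and zb: "z \<notin> box (Complex 0 (-T)) (Complex 1 T)"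
    by (auto simp: frontier_def)
  then have "Re z = 0 \<or> Re z = 1 \<or> \<bar>Im z\<bar> = T"
    by (auto simp: in_cbox_complex_iff in_box_complex_iff)
  then show "norm (g z) \<le> 1" using bd zc by blast
qed

text \<open>Hadamard's argument: multiply by a zero-free exponential that normalizes both boundary
  bounds to 1, damp by a Gaussian to reduce to a rectangle, and remove the damping in the
  limit.\<close>

lemma three_lines:
  fixes f :: "complex \<Rightarrow> complex"
  assumes hol: "f holomorphic_on UNIV"
    and bdd: "\<And>z. 0 \<le> Re z \<Longrightarrow> Re z \<le> 1 \<Longrightarrow> norm (f z) \<le> K"
    and F: "0 < F0" "0 < F1"
    and b0: "\<And>z. Re z = 0 \<Longrightarrow> norm (f z) \<le> F0"
    and b1: "\<And>z. Re z = 1 \<Longrightarrow> norm (f z) \<le> F1"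
    and t: "0 \<le> t" "t \<le> 1"
  shows "norm (f (of_real t)) \<le> F0 powr (1 - t) * F1 powr t"
proof -
  \<comment> \<open>The modulus of \<open>h z\<close> is
    \<open>F0 powr (Re z - 1) * F1 powr (- Re z)\<close>, so \<open>f z * h z\<close> has modulus at
    most 1 on both edges.\<close>
  define h where "h z = exp ((z - 1) * of_real (ln F0) - z * of_real (ln F1))" for z :: complex
  have norm_h: "norm (h z) = exp ((Re z - 1) * ln F0 - Re z * ln F1)" for z
    by (simp add: h_def)
  define M where "M = K * (exp (\<bar>ln F0\<bar> + \<bar>ln F1\<bar>))"
  have K0: "0 \<le> K" using order_trans[OF norm_ge_zero bdd[of 0]] by simp
  have hM: "norm (f z * h z) \<le> M" if "0 \<le> Re z" "Re z \<le> 1" for z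
  proof -
    have "(Re z - 1) * ln F0 \<le> \<bar>ln F0\<bar>"
    proof -
      have "(Re z - 1) * ln F0 \<le> \<bar>Re z - 1\<bar> * \<bar>ln F0\<bar>" by (metis abs_ge_self abs_mult)
      also have "\<dots> \<le> 1 * \<bar>ln F0\<bar>" using that by (intro mult_right_mono) auto
      finally show ?thesis by simp
    qed
    moreover have "- (Re z * ln F1) \<le> \<bar>ln F1\<bar>"
    proof -
      have "- (Re z * ln F1) \<le> \<bar>Re z\<bar> * \<bar>ln F1\<bar>" by (metis abs_ge_minus_self abs_mult)
      also have "\<dots> \<le> 1 * \<bar>ln F1\<bar>" using that by (intro mult_right_mono) auto
      finally show ?thesis by simp
    qed
    ultimately have "norm (h z) \<le> exp (\<bar>ln F0\<bar> + \<bar>ln F1\<bar>)" unfolding norm_h by simp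
    then show ?thesis unfolding M_def norm_mult using bdd[OF that] K0 by (intro mult_mono) auto
  qed
  have M0: "0 \<le> M" using K0 by (simp add: M_def)
  have key: "norm (f (of_real t) * h (of_real t)) * exp (\<epsilon> * (t\<^sup>2 - 1)) \<le> 1" if e: "0 < \<epsilon>" for \<epsilon>
  proof -
    \<comment> \<open>The real part of \<open>z\<^sup>2 - 1\<close> is nonpositive on the strip and
      tends to minus infinity with growing \<open>Im z\<close>: the factor never exceeds 1 and
      decays along the strip.\<close>
    define g where "g z = f z * h z * exp (of_real \<epsilon> * (z\<^sup>2 - 1))" for z
    have normg: "norm (g z) = norm (f z * h z) * exp (\<epsilon> * ((Re z)\<^sup>2 - (Im z)\<^sup>2 - 1))" for z
      by (simp add: g_def norm_mult power2_eq_square)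
    have holg: "g holomorphic_on UNIV"
      unfolding g_def h_def using hol by (intro holomorphic_intros) auto
    \<comment> \<open>At this height the Gaussian already outweighs the crude bound
      \<open>M\<close>, which handles the horizontal sides.\<close>
    obtain T where T: "0 < T" "M * exp (- \<epsilon> * T\<^sup>2) \<le> 1"
    proof -
      have "((\<lambda>T. M * exp (- \<epsilon> * T\<^sup>2)) \<longlongrightarrow> M * 0) at_top"
      proof (intro tendsto_intros)
        have "filterlim (\<lambda>T::real. \<epsilon> * T\<^sup>2) at_top at_top"
          using e by (intro filterlim_tendsto_pos_mult_at_top[OF tendsto_const]) (auto intro!: filterlim_pow_at_top filterlim_ident)
        then have "filterlim (\<lambda>T::real. - (\<epsilon> * T\<^sup>2)) at_bot at_top"
          by (simp add: filterlim_uminus_at_bot)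
        then show "((\<lambda>T. exp (- \<epsilon> * T\<^sup>2)) \<longlongrightarrow> 0) at_top"
          using filterlim_compose[OF exp_at_bot] by simp
      qed
      then have "\<forall>\<^sub>F T in at_top. M * exp (- \<epsilon> * T\<^sup>2) < 1"
        by (simp add: order_tendstoD(2))
      then have "\<forall>\<^sub>F T in at_top. 0 < T \<and> M * exp (- \<epsilon> * T\<^sup>2) < 1"
        using eventually_gt_at_top[of "0::real"] by eventually_elim auto
      then obtain T where "0 < T" "M * exp (- \<epsilon> * T\<^sup>2) < 1"
        using eventually_happens' trivial_limit_at_top_linorder by blast
      then show ?thesis using that by auto
    qed
    have "norm (g (of_real t)) \<le> 1"
    proof (rule maximum_modulus_rectangle[OF holg T(1) _ t])
      fix z assume z: "z \<in> cbox (Complex 0 (-T)) (Complex 1 T)" and zz: "Re z = 0 \<or> Re z = 1 \<or> \<bar>Im z\<bar> = T"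
      have zr: "0 \<le> Re z" "Re z \<le> 1" using z by (auto simp: in_cbox_complex_iff)
      have re: "(Re z)\<^sup>2 \<le> 1" using zr by (simp add: power_le_one)
      have expo: "exp (\<epsilon> * ((Re z)\<^sup>2 - (Im z)\<^sup>2 - 1)) \<le> 1"
      proof -
        have "(Re z)\<^sup>2 - (Im z)\<^sup>2 - 1 \<le> 0" using re zero_le_power2[of "Im z"] by linarith
        then show ?thesis using e by (simp add: mult_nonneg_nonpos)
      qed
      consider "Re z = 0" | "Re z = 1" | "\<bar>Im z\<bar> = T" using zz by blast
      then show "norm (g z) \<le> 1"
      proof cases
        case 1
        have "norm (f z * h z) \<le> F0 * exp (- ln F0)"
          using b0[OF 1] F unfolding norm_mult norm_h 1 by (intro mult_mono) auto
        also have "\<dots> = 1" using F by (simp add: exp_minus)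
        finally show ?thesis unfolding normg using expo by (simp add: mult_le_one)
      next
        case 2
        have "norm (f z * h z) \<le> F1 * exp (- ln F1)"
          using b1[OF 2] F unfolding norm_mult norm_h 2 by (intro mult_mono) auto
        also have "\<dots> = 1" using F by (simp add: exp_minus)
        finally show ?thesis unfolding normg using expo by (simp add: mult_le_one)
      next
        case 3
        have T2: "(Im z)\<^sup>2 = T\<^sup>2" using 3 by (metis power2_abs)
        have "exp (\<epsilon> * ((Re z)\<^sup>2 - (Im z)\<^sup>2 - 1)) \<le> exp (- \<epsilon> * T\<^sup>2)"
        proof -
          have "\<epsilon> * ((Re z)\<^sup>2 - (Im z)\<^sup>2 - 1) \<le> \<epsilon> * (- T\<^sup>2)" using e re T2 by (intro mult_left_mono) auto
          then show ?thesis by simp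
        qed
        then have "norm (g z) \<le> M * exp (- \<epsilon> * T\<^sup>2)"
          unfolding normg using hM[OF zr] M0 by (intro mult_mono) auto
        then show ?thesis using T by linarith
      qed
    qed
    then show ?thesis unfolding normg by simp
  qed
  \<comment> \<open>Letting \<epsilon> tend to 0 from the right removes the Gaussian.\<close>
  have "((\<lambda>\<epsilon>. norm (f (of_real t) * h (of_real t)) * exp (\<epsilon> * (t\<^sup>2 - 1))) \<longlongrightarrow>
      norm (f (of_real t) * h (of_real t)) * exp (0 * (t\<^sup>2 - 1))) (at_right 0)"
    by (intro tendsto_intros)
  then have "norm (f (of_real t) * h (of_real t)) * exp (0 * (t\<^sup>2 - 1)) \<le> 1"
    by (rule tendsto_upperbound) (auto simp: eventually_at_right_less intro!: eventually_at_rightI[of 0 1] key)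
  then have le: "norm (f (of_real t)) * exp ((t - 1) * ln F0 - t * ln F1) \<le> 1"
    by (simp add: norm_mult norm_h)
  have "exp ((t - 1) * ln F0 - t * ln F1) * (F0 powr (1 - t) * F1 powr t) = 1"
    using F by (simp add: powr_def flip: exp_add) (simp add: algebra_simps)
  then have "norm (f (of_real t)) = norm (f (of_real t)) * exp ((t - 1) * ln F0 - t * ln F1) * (F0 powr (1 - t) * F1 powr t)"
    by (simp add: mult.assoc)
  also have "\<dots> \<le> 1 * (F0 powr (1 - t) * F1 powr t)" by (intro mult_right_mono le) auto
  finally show ?thesis by simp
qed

text \<open>The regularity that \<open>three_lines\<close> asks for. It is stable under sums and
  products, so it can be checked factor by factor.\<close>

definition strip_bounded_entire :: "(complex \<Rightarrow> complex) \<Rightarrow> bool" where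
  "strip_bounded_entire f \<longleftrightarrow> f holomorphic_on UNIV \<and> (\<exists>K. \<forall>z. 0 \<le> Re z \<longrightarrow> Re z \<le> 1 \<longrightarrow> norm (f z) \<le> K)"

lemma strip_bounded_entire_const: "strip_bounded_entire (\<lambda>z. c)"
  unfolding strip_bounded_entire_def by auto

lemma strip_bounded_entire_add:
  assumes "strip_bounded_entire f" "strip_bounded_entire g"
  shows "strip_bounded_entire (\<lambda>z. f z + g z)"
proof -
  from assms obtain K L where "\<forall>z. 0 \<le> Re z \<longrightarrow> Re z \<le> 1 \<longrightarrow> norm (f z) \<le> K"
    "\<forall>z. 0 \<le> Re z \<longrightarrow> Re z \<le> 1 \<longrightarrow> norm (g z) \<le> L" unfolding strip_bounded_entire_def by auto
  then have "\<forall>z. 0 \<le> Re z \<longrightarrow> Re z \<le> 1 \<longrightarrow> norm (f z + g z) \<le> K + L"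
    by (meson add_mono norm_triangle_le)
  then show ?thesis using assms unfolding strip_bounded_entire_def by (auto intro: holomorphic_intros)
qed

lemma strip_bounded_entire_mult:
  assumes "strip_bounded_entire f" "strip_bounded_entire g"
  shows "strip_bounded_entire (\<lambda>z. f z * g z)"
proof -
  from assms obtain K L where *: "\<forall>z. 0 \<le> Re z \<longrightarrow> Re z \<le> 1 \<longrightarrow> norm (f z) \<le> K"
    "\<forall>z. 0 \<le> Re z \<longrightarrow> Re z \<le> 1 \<longrightarrow> norm (g z) \<le> L" unfolding strip_bounded_entire_def by auto
  have "0 \<le> K" using order_trans[OF norm_ge_zero *(1)[rule_format, of 0]] by simp
  then have "\<forall>z. 0 \<le> Re z \<longrightarrow> Re z \<le> 1 \<longrightarrow> norm (f z * g z) \<le> K * L"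
    using * unfolding norm_mult by (auto intro!: mult_mono)
  then show ?thesis using assms unfolding strip_bounded_entire_def by (auto intro: holomorphic_intros)
qed

lemma strip_bounded_entire_sum:
  assumes "\<And>i. i \<in> I \<Longrightarrow> strip_bounded_entire (f i)"
  shows "strip_bounded_entire (\<lambda>z. \<Sum>i\<in>I. f i z)"
  using assms by (induction I rule: infinite_finite_induct) (auto intro: strip_bounded_entire_const strip_bounded_entire_add)

text \<open>The exponent has an explicit constant term so that one rule covers all powers; later
  definitions therefore write \<open>of_real 0\<close> where that term vanishes. For
  \<open>w = 0\<close> the function is constantly 0.\<close>

lemma strip_bounded_entire_powr:
  assumes "0 \<le> w"
  shows "strip_bounded_entire (\<lambda>z. of_real w powr (of_real a * z + of_real b))"
proof (cases "w = 0")
  case True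
  then show ?thesis by (simp add: strip_bounded_entire_const)
next
  case False
  with assms have w: "0 < w" by simp
  have "norm (of_real w powr (of_real a * z + of_real b) :: complex) \<le> exp ((\<bar>a\<bar> + \<bar>b\<bar>) * \<bar>ln w\<bar>)"
    if "0 \<le> Re z" "Re z \<le> 1" for z :: complex
  proof -
    have "\<bar>a * Re z + b\<bar> \<le> \<bar>a\<bar> * \<bar>Re z\<bar> + \<bar>b\<bar>" by (metis abs_mult abs_triangle_ineq)
    also have "\<dots> \<le> \<bar>a\<bar> * 1 + \<bar>b\<bar>" using that by (intro add_mono mult_left_mono) auto
    finally have "\<bar>a * Re z + b\<bar> * \<bar>ln w\<bar> \<le> (\<bar>a\<bar> + \<bar>b\<bar>) * \<bar>ln w\<bar>" by (intro mult_right_mono) auto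
    then have "(a * Re z + b) * ln w \<le> (\<bar>a\<bar> + \<bar>b\<bar>) * \<bar>ln w\<bar>" by (metis abs_ge_self abs_mult order_trans)
    then show ?thesis using w by (simp add: norm_powr_real)
  qed
  moreover have "(\<lambda>z. of_real w powr (of_real a * z + of_real b)) holomorphic_on UNIV"
    using w by (intro holomorphic_intros) auto
  ultimately show ?thesis unfolding strip_bounded_entire_def by blast
qed

section \<open>Weighted interpolation\<close>

definition cip :: "'b set \<Rightarrow> ('b \<Rightarrow> complex) \<Rightarrow> ('b \<Rightarrow> complex) \<Rightarrow> complex" where
  "cip B f g = (\<Sum>b\<in>B. cnj (f b) * g b)"

definition orthonormal_on :: "'b set \<Rightarrow> 'l set \<Rightarrow> ('l \<Rightarrow> 'b \<Rightarrow> complex) \<Rightarrow> bool" where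
  "orthonormal_on B L u \<longleftrightarrow> (\<forall>l\<in>L. \<forall>k\<in>L. cip B (u l) (u k) = (if l = k then 1 else 0))"

lemma cip_cnj: "cnj (cip B f g) = cip B g f"
  by (simp add: cip_def mult.commute)

lemma cip_self: "cip B f f = of_real (\<Sum>b\<in>B. (norm (f b))\<^sup>2)"
  by (simp add: cip_def complex_norm_square mult.commute del: of_real_power)

lemma cip_add: "cip B f (\<lambda>b. g b + h b) = cip B f g + cip B f h"
  by (simp add: cip_def distrib_left sum.distrib)

lemma cip_scale: "cip B f (\<lambda>b. c * g b) = c * cip B f g"
  by (simp add: cip_def sum_distrib_left mult_ac)

lemma cip_sum: "cip B f (\<lambda>b. \<Sum>l\<in>L. g l b) = (\<Sum>l\<in>L. cip B f (g l))"
proof -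
  have "cip B f (\<lambda>b. \<Sum>l\<in>L. g l b) = (\<Sum>b\<in>B. \<Sum>l\<in>L. cnj (f b) * g l b)"
    by (simp add: cip_def sum_distrib_left)
  also have "\<dots> = (\<Sum>l\<in>L. cip B f (g l))" unfolding cip_def by (rule sum.swap)
  finally show ?thesis .
qed

text \<open>Pythagoras: the component of \<open>c\<close> in the span of the \<open>u l\<close> is
  scaled by \<open>\<alpha> + \<kappa>\<close>, the orthogonal component by
  \<open>\<alpha>\<close>.\<close>

lemma norm_affine_projection:
  assumes "finite L" and on: "orthonormal_on B L u"
  shows "(\<Sum>b\<in>B. (norm (\<alpha> * c b + \<kappa> * (\<Sum>l\<in>L. u l b * cip B (u l) c)))\<^sup>2)
    = (norm \<alpha>)\<^sup>2 * (\<Sum>b\<in>B. (norm (c b))\<^sup>2)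
      + ((norm (\<alpha> + \<kappa>))\<^sup>2 - (norm \<alpha>)\<^sup>2) * (\<Sum>l\<in>L. (norm (cip B (u l) c))\<^sup>2)"
proof -
  define p where "p b = (\<Sum>l\<in>L. cip B (u l) c * u l b)" for b
  define S where "S = (\<Sum>l\<in>L. (norm (cip B (u l) c))\<^sup>2)"
  have up: "cip B (u k) p = cip B (u k) c" if "k \<in> L" for k
  proof -
    have "cip B (u k) p = (\<Sum>l\<in>L. cip B (u l) c * cip B (u k) (u l))"
      unfolding p_def cip_sum by (simp add: cip_scale)
    also have "\<dots> = (\<Sum>l\<in>L. if l = k then cip B (u l) c else 0)"
      using on that unfolding orthonormal_on_def by (intro sum.cong) auto
    finally show ?thesis using assms(1) that by simp
  qed
  have cp: "cip B g p = (\<Sum>l\<in>L. cip B (u l) c * cip B g (u l))" for g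
    unfolding p_def cip_sum by (simp add: cip_scale)
  have cp1: "cip B c p = of_real S"
    unfolding cp S_def by (simp add: complex_norm_square cip_cnj del: of_real_power)
  have pc1: "cip B p c = of_real S" using cp1 cip_cnj[of B c p] by simp
  have pp1: "cip B p p = of_real S"
  proof -
    have "cip B p p = (\<Sum>l\<in>L. cip B (u l) c * cnj (cip B (u l) p))"
      by (subst cp) (simp add: cip_cnj)
    also have "\<dots> = (\<Sum>l\<in>L. cip B (u l) c * cnj (cip B (u l) c))"
      by (intro sum.cong) (auto simp: up)
    finally show ?thesis by (simp add: S_def complex_norm_square del: of_real_power)
  qed
  have "of_real (\<Sum>b\<in>B. (norm (\<alpha> * c b + \<kappa> * p b))\<^sup>2)
      = cip B (\<lambda>b. \<alpha> * c b + \<kappa> * p b) (\<lambda>b. \<alpha> * c b + \<kappa> * p b)"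
    by (simp add: cip_self)
  also have "\<dots> = \<alpha> * cip B (\<lambda>b. \<alpha> * c b + \<kappa> * p b) c + \<kappa> * cip B (\<lambda>b. \<alpha> * c b + \<kappa> * p b) p"
    by (simp add: cip_add cip_scale)
  also have "\<dots> = \<alpha> * cnj (cip B c (\<lambda>b. \<alpha> * c b + \<kappa> * p b)) + \<kappa> * cnj (cip B p (\<lambda>b. \<alpha> * c b + \<kappa> * p b))"
    by (simp add: cip_cnj)
  also have "\<dots> = \<alpha> * cnj \<alpha> * of_real (\<Sum>b\<in>B. (norm (c b))\<^sup>2)
      + (\<alpha> * cnj \<kappa> + \<kappa> * cnj \<alpha> + \<kappa> * cnj \<kappa>) * of_real S"
    by (simp add: cip_add cip_scale cp1 pc1 pp1 cip_self[of B c]) (simp add: algebra_simps)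
  also have "\<dots> = of_real ((norm \<alpha>)\<^sup>2 * (\<Sum>b\<in>B. (norm (c b))\<^sup>2) + ((norm (\<alpha> + \<kappa>))\<^sup>2 - (norm \<alpha>)\<^sup>2) * S)"
    unfolding of_real_add of_real_mult of_real_diff complex_norm_square by (simp add: algebra_simps)
  finally have "(\<Sum>b\<in>B. (norm (\<alpha> * c b + \<kappa> * p b))\<^sup>2)
      = (norm \<alpha>)\<^sup>2 * (\<Sum>b\<in>B. (norm (c b))\<^sup>2) + ((norm (\<alpha> + \<kappa>))\<^sup>2 - (norm \<alpha>)\<^sup>2) * S"
    using of_real_eq_iff by blast
  then show ?thesis by (simp add: p_def S_def mult.commute)
qed

text \<open>The difference between \<open>c\<close> and its projection, the case
  \<open>\<alpha> = 1\<close>, \<open>\<kappa> = -1\<close>, has nonnegative squared length.\<close>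

lemma bessel:
  assumes "finite L" and "orthonormal_on B L u"
  shows "(\<Sum>l\<in>L. (norm (cip B (u l) c))\<^sup>2) \<le> (\<Sum>b\<in>B. (norm (c b))\<^sup>2)"
proof -
  have "0 \<le> (\<Sum>b\<in>B. (norm (1 * c b + (-1) * (\<Sum>l\<in>L. u l b * cip B (u l) c)))\<^sup>2)"
    by (intro sum_nonneg) auto
  then show ?thesis unfolding norm_affine_projection[OF assms] by simp
qed

lemma cip_cauchy_schwarz:
  "(norm (cip B f g))\<^sup>2 \<le> (\<Sum>b\<in>B. (norm (f b))\<^sup>2) * (\<Sum>b\<in>B. (norm (g b))\<^sup>2)"
proof -
  have "norm (cip B f g) \<le> (\<Sum>b\<in>B. norm (f b) * norm (g b))"
    unfolding cip_def by (rule order_trans[OF norm_sum]) (simp add: norm_mult)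
  then have "(norm (cip B f g))\<^sup>2 \<le> (\<Sum>b\<in>B. norm (f b) * norm (g b))\<^sup>2"
    by (rule power_mono) simp
  also have "\<dots> \<le> (\<Sum>b\<in>B. (norm (f b))\<^sup>2) * (\<Sum>b\<in>B. (norm (g b))\<^sup>2)"
    by (rule Cauchy_Schwarz_ineq_sum)
  finally show ?thesis .
qed

lemma cnj_of_real_powr:
  assumes "0 \<le> w"
  shows "cnj (of_real w powr z) = of_real w powr cnj z"
  using assms by (cases "w = 0") (auto simp: powr_def exp_cnj Ln_of_real)

text \<open>
  All operators are written in eigenbases: \<open>M = \<Sum>\<^sub>j s\<^sub>j \<theta>\<^sub>j \<theta>\<^sub>j*\<close>, \<open>\<Delta> = diag (w\<^sub>b)\<close>, \<open>\<rho> = diag (\<rho>\<^sub>l)\<close>, and the \<open>u\<^sub>l\<close> are the columns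
  of the isometry. Zero eigenvalues are harmless since \<open>0 powr z = 0\<close> for all \<open>z\<close>, also for \<open>z = 0\<close>. \<open>W b z\<close> is the
  diagonal entry of \<open>\<Delta>\<^bsup>r z / 2\<^esup>\<close>, \<open>V z b\<close> is the column \<open>g(z) e\<^sub>b\<close>, and \<open>\<Omega> b\<close> a diagonal entry of \<open>\<Omega>\<close>. \<open>P'\<close> and \<open>Y'\<close> are
  spelled out, rather than defined as \<open>cnj (P (cnj z))\<close> and \<open>cnj (Y (cnj z))\<close>, to make the analyticity of \<open>F\<close> evident.
\<close>

locale weighted_interpolation =
  fixes J :: "'j set" and B :: "'b set" and L :: "'l set"
    and \<theta> :: "'j \<Rightarrow> 'b \<Rightarrow> complex" and u :: "'l \<Rightarrow> 'b \<Rightarrow> complex"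
    and s :: "'j \<Rightarrow> real" and w :: "'b \<Rightarrow> real" and \<rho> :: "'l \<Rightarrow> real"
    and r x \<beta> :: real
  assumes fin: "finite J" "finite B" "finite L"
    and on_\<theta>: "orthonormal_on B J \<theta>" and on_u: "orthonormal_on B L u"
    and s0: "\<And>j. j \<in> J \<Longrightarrow> 0 \<le> s j" and w0: "\<And>b. b \<in> B \<Longrightarrow> 0 \<le> w b" and \<rho>0: "\<And>l. l \<in> L \<Longrightarrow> 0 \<le> \<rho> l"
    and r1: "1 \<le> r" and x0: "0 < x" and \<beta>0: "0 \<le> \<beta>"
begin

definition "\<gamma> z = of_real x powr (of_real (- r / 2) * z + of_real (1 / 2))" for z :: complex
definition "W b z = of_real (w b) powr (of_real (r / 2) * z + of_real 0)" for z :: complex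
definition "V z b b' = (if b = b' then 1 else 0) + (\<gamma> z + - 1) * (\<Sum>l\<in>L. u l b' * cnj (u l b))"
definition "P j l z = (\<Sum>b\<in>B. \<gamma> z * cnj (\<theta> j b) * W b z * u l b)"
definition "P' j l z = (\<Sum>b\<in>B. \<gamma> z * \<theta> j b * W b z * cnj (u l b))"
definition "Y j b z = (\<Sum>b'\<in>B. cnj (\<theta> j b') * W b' z * V z b b')"
definition "Y' j b z = (\<Sum>b'\<in>B. \<theta> j b' * W b' z * ((if b = b' then 1 else 0) + (\<gamma> z + - 1) * (\<Sum>l\<in>L. cnj (u l b') * u l b)))"
text \<open>The trace from the overview, expanded in eigenbases. In \<open>P\<close> the weight
  reduces to the scalar \<open>\<gamma> z\<close>, because \<open>g(z)\<close> acts on the range of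
  the projection \<open>u u*\<close> as that scalar; the primed factors come from the other side of
  the trace.\<close>

definition "F z = (\<Sum>j\<in>J. of_real (s j) powr (of_real r * z + of_real 0) *
   ((\<Sum>l\<in>L. of_real (\<rho> l) powr (of_real (-1) * z + of_real 1) * (P j l z * P' j l z))
   + of_real \<beta> * (\<Sum>b\<in>B. of_real (w b) powr (of_real (- 2 * r) * z + of_real (2 * r)) * (Y j b z * Y' j b z))))"
text \<open>A nonnegative majorant: scalar powers are replaced by their moduli and the products
  \<open>P * P'\<close>, \<open>Y * Y'\<close> by squares.\<close>

definition "\<Phi> z = (\<Sum>j\<in>J. s j powr (r * Re z) *
   ((\<Sum>l\<in>L. \<rho> l powr (1 - Re z) * (norm (P j l z))\<^sup>2)
   + \<beta> * (\<Sum>b\<in>B. w b powr (2 * r * (1 - Re z)) * (norm (Y j b z))\<^sup>2)))"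
definition "\<Omega> b = (\<Sum>l\<in>L. (norm (u l b))\<^sup>2)"

section \<open>Conjugation symmetry and the majorant\<close>

lemma cnj_\<gamma>: "cnj (\<gamma> z) = \<gamma> (cnj z)"
  unfolding \<gamma>_def using x0 by (subst cnj_of_real_powr) auto

lemma cnj_W: "b \<in> B \<Longrightarrow> cnj (W b z) = W b (cnj z)"
  unfolding W_def using w0 by (subst cnj_of_real_powr) auto

lemma P'_eq: "P' j l z = cnj (P j l (cnj z))"
  unfolding P'_def P_def cnj_sum by (intro sum.cong) (auto simp: cnj_\<gamma> cnj_W)

lemma Y'_eq: "Y' j b z = cnj (Y j b (cnj z))"
  unfolding Y'_def Y_def V_def cnj_sum by (intro sum.cong) (auto simp: cnj_\<gamma> cnj_W)

lemma strip_bounded_entire_F: "strip_bounded_entire F"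
  unfolding F_def P_def P'_def Y_def Y'_def V_def W_def \<gamma>_def
  using x0 s0 w0 \<rho>0
  by (intro strip_bounded_entire_sum strip_bounded_entire_add strip_bounded_entire_mult strip_bounded_entire_const strip_bounded_entire_powr) auto

text \<open>\<open>P'\<close> and \<open>Y'\<close> are the conjugates of \<open>P\<close> and
  \<open>Y\<close> at \<open>cnj z\<close>, so the arithmetic-geometric mean inequality splits each
  product into squares at \<open>z\<close> and \<open>cnj z\<close>. Both points lie on the same
  vertical line, hence it suffices to bound \<open>\<Phi>\<close> on the two edges.\<close>

lemma norm_F_le: "norm (F z) \<le> (\<Phi> z + \<Phi> (cnj z)) / 2"
proof -
  have am: "norm (a * cnj b) \<le> ((norm a)\<^sup>2 + (norm b)\<^sup>2) / 2" for a b :: complex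
    using sum_squares_bound[of "norm a" "norm b"] by (simp add: norm_mult)
  have "norm (F z) \<le> (\<Sum>j\<in>J. s j powr (r * Re z) *
   ((\<Sum>l\<in>L. \<rho> l powr (1 - Re z) * (((norm (P j l z))\<^sup>2 + (norm (P j l (cnj z)))\<^sup>2) / 2))
   + \<beta> * (\<Sum>b\<in>B. w b powr (2 * r * (1 - Re z)) * (((norm (Y j b z))\<^sup>2 + (norm (Y j b (cnj z)))\<^sup>2) / 2))))"
    unfolding F_def
  proof (rule sum_norm_le)
    fix j assume j: "j \<in> J"
    have n1: "norm (of_real (s j) powr (of_real r * z + of_real 0) :: complex) = s j powr (r * Re z)"
      using s0[OF j] by (simp add: norm_powr_real_powr)
    have n2: "norm (\<Sum>l\<in>L. of_real (\<rho> l) powr (of_real (-1) * z + of_real 1) * (P j l z * P' j l z))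
      \<le> (\<Sum>l\<in>L. \<rho> l powr (1 - Re z) * (((norm (P j l z))\<^sup>2 + (norm (P j l (cnj z)))\<^sup>2) / 2))"
    proof (rule sum_norm_le)
      fix l assume l: "l \<in> L"
      have "norm (of_real (\<rho> l) powr (of_real (-1) * z + of_real 1) :: complex) = \<rho> l powr (1 - Re z)"
        using \<rho>0[OF l] by (simp add: norm_powr_real_powr)
      then show "norm (of_real (\<rho> l) powr (of_real (-1) * z + of_real 1) * (P j l z * P' j l z))
        \<le> \<rho> l powr (1 - Re z) * (((norm (P j l z))\<^sup>2 + (norm (P j l (cnj z)))\<^sup>2) / 2)"
        unfolding norm_mult[of "_ powr _"] P'_eq using am by (metis mult_left_mono powr_ge_zero)
    qed
    have n3: "norm (\<Sum>b\<in>B. of_real (w b) powr (of_real (- 2 * r) * z + of_real (2 * r)) * (Y j b z * Y' j b z))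
      \<le> (\<Sum>b\<in>B. w b powr (2 * r * (1 - Re z)) * (((norm (Y j b z))\<^sup>2 + (norm (Y j b (cnj z)))\<^sup>2) / 2))"
    proof (rule sum_norm_le)
      fix b assume b: "b \<in> B"
      have "norm (of_real (w b) powr (of_real (- 2 * r) * z + of_real (2 * r)) :: complex) = w b powr (2 * r * (1 - Re z))"
        using w0[OF b] by (simp add: norm_powr_real_powr algebra_simps)
      then show "norm (of_real (w b) powr (of_real (- 2 * r) * z + of_real (2 * r)) * (Y j b z * Y' j b z))
        \<le> w b powr (2 * r * (1 - Re z)) * (((norm (Y j b z))\<^sup>2 + (norm (Y j b (cnj z)))\<^sup>2) / 2)"
        unfolding norm_mult[of "_ powr _"] Y'_eq using am by (metis mult_left_mono powr_ge_zero)
    qed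
    show "norm (of_real (s j) powr (of_real r * z + of_real 0) *
   ((\<Sum>l\<in>L. of_real (\<rho> l) powr (of_real (-1) * z + of_real 1) * (P j l z * P' j l z))
   + of_real \<beta> * (\<Sum>b\<in>B. of_real (w b) powr (of_real (- 2 * r) * z + of_real (2 * r)) * (Y j b z * Y' j b z))))
   \<le> s j powr (r * Re z) *
   ((\<Sum>l\<in>L. \<rho> l powr (1 - Re z) * (((norm (P j l z))\<^sup>2 + (norm (P j l (cnj z)))\<^sup>2) / 2))
   + \<beta> * (\<Sum>b\<in>B. w b powr (2 * r * (1 - Re z)) * (((norm (Y j b z))\<^sup>2 + (norm (Y j b (cnj z)))\<^sup>2) / 2)))"
      unfolding norm_mult[of "_ powr _"] n1
      by (intro mult_left_mono order_trans[OF norm_triangle_ineq] add_mono n2)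
         (auto simp: norm_mult \<beta>0 intro!: mult_left_mono n3[simplified])
  qed
  also have "\<dots> = (\<Phi> z + \<Phi> (cnj z)) / 2"
    unfolding \<Phi>_def complex_cnj(1) sum.distrib[symmetric] sum_divide_distrib
    by (intro sum.cong) (auto simp: sum_divide_distrib sum.distrib sum_distrib_left algebra_simps add_divide_distrib)
  finally show ?thesis .
qed

lemma norm_\<gamma>: "norm (\<gamma> z) = x powr ((1 - r * Re z) / 2)"
  unfolding \<gamma>_def using x0 by (simp add: norm_powr_real_powr algebra_simps diff_divide_distrib)

lemma norm_\<gamma>_sq: "(norm (\<gamma> z))\<^sup>2 = x powr (1 - r * Re z)"
  unfolding norm_\<gamma> using x0 by (simp add: power2_eq_square flip: powr_add)

lemma norm_W: "b \<in> B \<Longrightarrow> norm (W b z) = w b powr (r * Re z / 2)"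
  unfolding W_def using w0 by (simp add: norm_powr_real_powr)

lemma norm_W_sq: "b \<in> B \<Longrightarrow> (norm (W b z))\<^sup>2 = w b powr (r * Re z)"
  unfolding norm_W using w0 by (simp add: power2_eq_square flip: powr_add)

lemma sum_norm_u: "l \<in> L \<Longrightarrow> (\<Sum>b\<in>B. (norm (u l b))\<^sup>2) = 1"
  using on_u cip_self[of B "u l"] unfolding orthonormal_on_def
  by (metis (mono_tags, lifting) of_real_eq_1_iff)

lemma sum_norm_\<theta>: "j \<in> J \<Longrightarrow> (\<Sum>b\<in>B. (norm (\<theta> j b))\<^sup>2) = 1"
  using on_\<theta> cip_self[of B "\<theta> j"] unfolding orthonormal_on_def
  by (metis (mono_tags, lifting) of_real_eq_1_iff)

text \<open>Pythagoras for a basis vector, whose projection onto the span of the \<open>u l\<close>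
  has squared length \<open>\<Omega> b\<close>. This gives the column norms of affine functions of
  \<open>u u*\<close>.\<close>

lemma norm_affine_projection_delta:
  assumes "b \<in> B"
  shows "(\<Sum>b'\<in>B. (norm (\<alpha> * (if b = b' then 1 else 0) + \<kappa> * (\<Sum>l\<in>L. u l b' * cnj (u l b))))\<^sup>2)
    = (norm \<alpha>)\<^sup>2 + ((norm (\<alpha> + \<kappa>))\<^sup>2 - (norm \<alpha>)\<^sup>2) * \<Omega> b"
proof -
  have c: "cip B (u l) (\<lambda>b'. if b = b' then 1 else 0) = cnj (u l b)" for l
    using assms fin(2) by (simp add: cip_def if_distrib[of "\<lambda>x. _ * x"] cong: if_cong)
  have d: "(\<Sum>b'\<in>B. (norm (if b = b' then 1 else 0 :: complex))\<^sup>2) = 1"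
    using assms fin(2) by (simp add: if_distrib[of norm] if_distrib[of "\<lambda>x. x\<^sup>2"] cong: if_cong)
  show ?thesis
    using norm_affine_projection[OF fin(3) on_u, of \<alpha> "\<lambda>b'. if b = b' then 1 else 0" \<kappa>]
    unfolding c d by (simp add: \<Omega>_def)
qed

lemma V_alt: "V z b b' = 1 * (if b = b' then 1 else 0) + (\<gamma> z - 1) * (\<Sum>l\<in>L. u l b' * cnj (u l b))"
  by (simp add: V_def)

section \<open>The edge \<open>Re z = 0\<close>\<close>

lemma norm_W_le1: "b \<in> B \<Longrightarrow> Re z = 0 \<Longrightarrow> norm (W b z) \<le> 1"
  by (simp add: norm_W powr_def)

text \<open>Imaginary powers are contractions. After Bessel over the \<open>\<theta> j\<close>, only
  the squared lengths of \<open>\<gamma> z * u l\<close> and of the column \<open>V z b\<close>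
  remain, and here \<open>(norm (\<gamma> z))\<^sup>2 = x\<close>.\<close>

lemma \<Phi>_edge0:
  assumes z: "Re z = 0"
  shows "\<Phi> z \<le> x * (\<Sum>l\<in>L. \<rho> l) + \<beta> * (\<Sum>b\<in>B. w b powr (2 * r) * (1 + (x - 1) * \<Omega> b))"
proof -
  have Pb: "(\<Sum>j\<in>J. (norm (P j l z))\<^sup>2) \<le> x" if l: "l \<in> L" for l
  proof -
    have "P j l z = cip B (\<theta> j) (\<lambda>b. \<gamma> z * (W b z * u l b))" for j
      unfolding P_def cip_def by (intro sum.cong) (auto simp: mult_ac)
    then have "(\<Sum>j\<in>J. (norm (P j l z))\<^sup>2) \<le> (\<Sum>b\<in>B. (norm (\<gamma> z * (W b z * u l b)))\<^sup>2)"
      using bessel[OF fin(1) on_\<theta>] by simp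
    also have "\<dots> \<le> (\<Sum>b\<in>B. x * (norm (u l b))\<^sup>2)"
    proof (rule sum_mono)
      fix b assume b: "b \<in> B"
      have "(norm (W b z))\<^sup>2 \<le> 1" using norm_W_le1[OF b z] by (simp add: power_le_one)
      then have "(norm (W b z))\<^sup>2 * (norm (u l b))\<^sup>2 \<le> 1 * (norm (u l b))\<^sup>2" by (intro mult_right_mono) auto
      then show "(norm (\<gamma> z * (W b z * u l b)))\<^sup>2 \<le> x * (norm (u l b))\<^sup>2"
        using x0 z by (simp add: norm_mult power_mult_distrib norm_\<gamma>_sq)
    qed
    also have "\<dots> = x" using sum_norm_u[OF l] by (simp flip: sum_distrib_left)
    finally show ?thesis .
  qed
  have Yb: "(\<Sum>j\<in>J. (norm (Y j b z))\<^sup>2) \<le> 1 + (x - 1) * \<Omega> b" if b: "b \<in> B" for b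
  proof -
    have "Y j b z = cip B (\<theta> j) (\<lambda>b'. W b' z * V z b b')" for j
      unfolding Y_def cip_def by (intro sum.cong) (auto simp: mult_ac)
    then have "(\<Sum>j\<in>J. (norm (Y j b z))\<^sup>2) \<le> (\<Sum>b'\<in>B. (norm (W b' z * V z b b'))\<^sup>2)"
      using bessel[OF fin(1) on_\<theta>] by simp
    also have "\<dots> \<le> (\<Sum>b'\<in>B. (norm (V z b b'))\<^sup>2)"
    proof (rule sum_mono)
      fix b' assume b': "b' \<in> B"
      have "norm (W b' z) * norm (V z b b') \<le> 1 * norm (V z b b')"
        using norm_W_le1[OF b' z] by (intro mult_right_mono) auto
      then show "(norm (W b' z * V z b b'))\<^sup>2 \<le> (norm (V z b b'))\<^sup>2"
        by (intro power_mono) (auto simp: norm_mult)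
    qed
    also have "\<dots> = 1 + (x - 1) * \<Omega> b"
      unfolding V_alt norm_affine_projection_delta[OF b] using x0 z norm_\<gamma>_sq[of z] by simp
    finally show ?thesis .
  qed
  have "\<Phi> z \<le> (\<Sum>j\<in>J. (\<Sum>l\<in>L. \<rho> l * (norm (P j l z))\<^sup>2)
     + \<beta> * (\<Sum>b\<in>B. w b powr (2 * r) * (norm (Y j b z))\<^sup>2))"
    unfolding \<Phi>_def
  proof (rule sum_mono)
    fix j assume j: "j \<in> J"
    let ?A = "(\<Sum>l\<in>L. \<rho> l * (norm (P j l z))\<^sup>2) + \<beta> * (\<Sum>b\<in>B. w b powr (2 * r) * (norm (Y j b z))\<^sup>2)"
    have "0 \<le> ?A" using \<rho>0 \<beta>0 by (intro add_nonneg_nonneg mult_nonneg_nonneg sum_nonneg) auto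
    \<comment> \<open>The power is 1, or 0 when \<open>s j = 0\<close>; an inequality covers both
      cases.\<close>
    moreover have "s j powr (r * Re z) \<le> 1" using z by (simp add: powr_def)
    ultimately have "s j powr (r * Re z) * ?A \<le> 1 * ?A" by (intro mult_right_mono)
    moreover have "(\<Sum>l\<in>L. \<rho> l powr (1 - Re z) * (norm (P j l z))\<^sup>2) = (\<Sum>l\<in>L. \<rho> l * (norm (P j l z))\<^sup>2)"
      using z \<rho>0 by (intro sum.cong) auto
    ultimately show "s j powr (r * Re z) *
         ((\<Sum>l\<in>L. \<rho> l powr (1 - Re z) * (norm (P j l z))\<^sup>2) +
          \<beta> * (\<Sum>b\<in>B. w b powr (2 * r * (1 - Re z)) * (norm (Y j b z))\<^sup>2)) \<le> ?A"
      using z by simp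
  qed
  also have "\<dots> = (\<Sum>l\<in>L. \<rho> l * (\<Sum>j\<in>J. (norm (P j l z))\<^sup>2))
     + \<beta> * (\<Sum>b\<in>B. w b powr (2 * r) * (\<Sum>j\<in>J. (norm (Y j b z))\<^sup>2))"
    unfolding sum.distrib sum_distrib_left
    by (subst (2) sum.swap, subst sum.swap) simp
  also have "\<dots> \<le> (\<Sum>l\<in>L. \<rho> l * x) + \<beta> * (\<Sum>b\<in>B. w b powr (2 * r) * (1 + (x - 1) * \<Omega> b))"
    using \<rho>0 \<beta>0 Pb Yb by (intro add_mono mult_left_mono sum_mono) auto
  also have "(\<Sum>l\<in>L. \<rho> l * x) = x * (\<Sum>l\<in>L. \<rho> l)" by (simp add: sum_distrib_left mult.commute)
  finally show ?thesis .
qed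

section \<open>The edge \<open>Re z = 1\<close>\<close>

definition "e1 = x powr (1 - r) * (1 + \<beta>)"
text \<open>The entry in row \<open>b'\<close> and column \<open>b\<close> of the operator with
  eigenvalue \<open>e1\<close> on the range of \<open>u u*\<close> and \<beta> on its complement;
  this is \<open>g (u u* + \<beta>) g*\<close> on this edge, where
  \<open>(norm (\<gamma> z))\<^sup>2 = x powr (1 - r)\<close>.\<close>

definition "E b b' = of_real \<beta> * (if b = b' then 1 else 0) + of_real (e1 - \<beta>) * (\<Sum>l\<in>L. u l b' * cnj (u l b))"

lemma cnj_E: "cnj (E b b') = E b' b"
  by (auto simp: E_def cnj_sum mult.commute)

definition "H j z = (\<Sum>l\<in>L. (norm (P j l z))\<^sup>2) + \<beta> * (\<Sum>b\<in>B. (norm (Y j b z))\<^sup>2)"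

text \<open>
  On the line \<open>Re z = 1\<close> both summands of \<open>F\<close> combine into the diagonal entries of one positive operator, because
  \<open>g (\<Omega> + \<beta>) g*\<close> is again an affine function of \<open>\<Omega>\<close>; the imaginary powers then cancel in its Hilbert-Schmidt norm.
\<close>

lemma H_eq:
  assumes z: "Re z = 1" and j: "j \<in> J"
  shows "of_real (H j z) = cip B (\<theta> j) (\<lambda>b. W b z * (\<Sum>b'\<in>B. E b' b * (cnj (W b' z) * \<theta> j b')))"
proof -
  define c where "c b = cnj (W b z) * \<theta> j b" for b
  \<comment> \<open>Both sides of the claim are combinations of two numbers: \<open>S\<close>, the
    squared length of the projection of \<open>c\<close> onto the span of the \<open>u l\<close>,
    and \<open>N\<close>, that of \<open>c\<close> itself.\<close>
  define S where "S = (\<Sum>l\<in>L. (norm (cip B (u l) c))\<^sup>2)"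
  define N where "N = (\<Sum>b\<in>B. (norm (c b))\<^sup>2)"
  have g: "(norm (\<gamma> z))\<^sup>2 = x powr (1 - r)" using norm_\<gamma>_sq[of z] z by simp
  have P: "P j l z = \<gamma> z * cip B c (u l)" for l
    unfolding P_def cip_def c_def sum_distrib_left by (intro sum.cong) (auto simp: mult_ac)
  have Psum: "(\<Sum>l\<in>L. (norm (P j l z))\<^sup>2) = x powr (1 - r) * S"
  proof -
    have "norm (cip B c (u l)) = norm (cip B (u l) c)" for l by (metis cip_cnj complex_mod_cnj)
    then show ?thesis unfolding P S_def norm_mult power_mult_distrib g by (simp add: sum_distrib_left)
  qed
  have Y: "cnj (Y j b z) = 1 * c b + (cnj (\<gamma> z) - 1) * (\<Sum>l\<in>L. u l b * cip B (u l) c)" if b: "b \<in> B" for b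
  proof -
    have "cnj (Y j b z) = (\<Sum>b'\<in>B. c b' * cnj (V z b b'))"
      unfolding Y_def c_def cnj_sum by (intro sum.cong) (auto simp: mult_ac)
    also have "\<dots> = (\<Sum>b'\<in>B. c b' * (if b = b' then 1 else 0))
        + (cnj (\<gamma> z) - 1) * (\<Sum>b'\<in>B. \<Sum>l\<in>L. u l b * (cnj (u l b') * c b'))"
      unfolding V_alt sum_distrib_left sum.distrib[symmetric]
      by (intro sum.cong) (auto simp: algebra_simps sum_distrib_left)
    also have "(\<Sum>b'\<in>B. c b' * (if b = b' then 1 else 0)) = c b"
      using b fin(2) by (simp add: if_distrib[of "\<lambda>x. _ * x"] cong: if_cong)
    also have "(\<Sum>b'\<in>B. \<Sum>l\<in>L. u l b * (cnj (u l b') * c b')) = (\<Sum>l\<in>L. u l b * cip B (u l) c)"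
      unfolding cip_def sum_distrib_left by (rule sum.swap)
    finally show ?thesis by simp
  qed
  have Ysum: "(\<Sum>b\<in>B. (norm (Y j b z))\<^sup>2) = N + (x powr (1 - r) - 1) * S"
  proof -
    have "(\<Sum>b\<in>B. (norm (Y j b z))\<^sup>2) = (\<Sum>b\<in>B. (norm (cnj (Y j b z)))\<^sup>2)" by simp
    also have "\<dots> = (\<Sum>b\<in>B. (norm (1 * c b + (cnj (\<gamma> z) - 1) * (\<Sum>l\<in>L. u l b * cip B (u l) c)))\<^sup>2)"
      by (intro sum.cong) (auto simp: Y)
    also have "\<dots> = N + (x powr (1 - r) - 1) * S"
      unfolding norm_affine_projection[OF fin(3) on_u] using g by (simp add: N_def S_def)
    finally show ?thesis .
  qed
  have H: "H j z = \<beta> * N + (e1 - \<beta>) * S"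
    unfolding H_def Psum Ysum e1_def by (simp add: algebra_simps)
  have "cip B (\<theta> j) (\<lambda>b. W b z * (\<Sum>b'\<in>B. E b' b * (cnj (W b' z) * \<theta> j b')))
      = cip B c (\<lambda>b. \<Sum>b'\<in>B. E b' b * c b')"
    unfolding cip_def c_def by (intro sum.cong) (auto simp: mult_ac)
  also have "\<dots> = cip B c (\<lambda>b. of_real \<beta> * c b + of_real (e1 - \<beta>) * (\<Sum>l\<in>L. cip B (u l) c * u l b))"
    unfolding cip_def[of B c]
  proof (intro sum.cong arg_cong2[where f = "(*)"] refl)
    fix b assume b: "b \<in> B"
    have "(\<Sum>b'\<in>B. E b' b * c b') = of_real \<beta> * (\<Sum>b'\<in>B. c b' * (if b' = b then 1 else 0))
        + of_real (e1 - \<beta>) * (\<Sum>b'\<in>B. \<Sum>l\<in>L. cnj (u l b') * c b' * u l b)"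
      unfolding E_def sum_distrib_left sum.distrib[symmetric]
      by (intro sum.cong) (auto simp: algebra_simps sum_distrib_left sum_distrib_right)
    also have "(\<Sum>b'\<in>B. c b' * (if b' = b then 1 else 0)) = c b"
      using b fin(2) by (simp add: if_distrib[of "\<lambda>x. _ * x"] cong: if_cong)
    also have "(\<Sum>b'\<in>B. \<Sum>l\<in>L. cnj (u l b') * c b' * u l b) = (\<Sum>l\<in>L. cip B (u l) c * u l b)"
      unfolding cip_def sum_distrib_right by (rule sum.swap)
    finally show "(\<Sum>b'\<in>B. E b' b * c b') = of_real \<beta> * c b + of_real (e1 - \<beta>) * (\<Sum>l\<in>L. cip B (u l) c * u l b)" .
  qed
  also have "\<dots> = of_real \<beta> * of_real N + of_real (e1 - \<beta>) * (\<Sum>l\<in>L. cip B (u l) c * cip B c (u l))"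
    by (simp only: cip_add cip_scale cip_sum cip_self N_def)
  also have "(\<Sum>l\<in>L. cip B (u l) c * cip B c (u l)) = of_real S"
    unfolding S_def of_real_sum by (intro sum.cong) (auto simp: complex_norm_square cip_cnj simp del: of_real_power)
  finally show ?thesis unfolding H by simp
qed

text \<open>Squared diagonal entries with respect to an orthonormal system sum to at most the
  squared Hilbert-Schmidt norm. In that norm the weights \<open>w b powr r\<close> and
  \<open>w b' powr r\<close> enter symmetrically; the arithmetic-geometric mean inequality moves
  both onto one index and leaves the squared row norms of \<open>E\<close>.\<close>

lemma sum_H_sq_le:
  assumes z: "Re z = 1"
  shows "(\<Sum>j\<in>J. (H j z)\<^sup>2) \<le> (\<Sum>b\<in>B. w b powr (2 * r) * (\<beta>\<^sup>2 + (e1\<^sup>2 - \<beta>\<^sup>2) * \<Omega> b))"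
proof -
  define K where "K b b' = W b' z * E b b'" for b b'
  have Hj: "(H j z)\<^sup>2 \<le> (\<Sum>b\<in>B. w b powr r * (norm (cip B (\<theta> j) (K b)))\<^sup>2)" if j: "j \<in> J" for j
  proof -
    have "(H j z)\<^sup>2 = (norm (of_real (H j z) :: complex))\<^sup>2" by simp
    also have "\<dots> \<le> (\<Sum>b\<in>B. (norm (\<theta> j b))\<^sup>2) * (\<Sum>b\<in>B. (norm (W b z * (\<Sum>b'\<in>B. E b' b * (cnj (W b' z) * \<theta> j b'))))\<^sup>2)"
      unfolding H_eq[OF z j] by (rule cip_cauchy_schwarz)
    also have "\<dots> = (\<Sum>b\<in>B. w b powr r * (norm (cip B (\<theta> j) (K b)))\<^sup>2)"
      unfolding sum_norm_\<theta>[OF j] mult_1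
    proof (rule sum.cong[OF refl])
      fix b assume b: "b \<in> B"
      have "(\<Sum>b'\<in>B. E b' b * (cnj (W b' z) * \<theta> j b')) = cip B (K b) (\<theta> j)"
        unfolding cip_def K_def by (intro sum.cong) (auto simp: cnj_E mult_ac)
      moreover have "norm (cip B (K b) (\<theta> j)) = norm (cip B (\<theta> j) (K b))" by (metis cip_cnj complex_mod_cnj)
      ultimately show "(norm (W b z * (\<Sum>b'\<in>B. E b' b * (cnj (W b' z) * \<theta> j b'))))\<^sup>2 = w b powr r * (norm (cip B (\<theta> j) (K b)))\<^sup>2"
        using norm_W_sq[OF b, of z] z by (simp add: norm_mult power_mult_distrib)
    qed
    finally show ?thesis .
  qed
  have "(\<Sum>j\<in>J. (H j z)\<^sup>2) \<le> (\<Sum>j\<in>J. \<Sum>b\<in>B. w b powr r * (norm (cip B (\<theta> j) (K b)))\<^sup>2)"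
    by (rule sum_mono) (rule Hj)
  also have "\<dots> = (\<Sum>b\<in>B. w b powr r * (\<Sum>j\<in>J. (norm (cip B (\<theta> j) (K b)))\<^sup>2))"
    unfolding sum_distrib_left by (rule sum.swap)
  also have "\<dots> \<le> (\<Sum>b\<in>B. w b powr r * (\<Sum>b'\<in>B. (norm (K b b'))\<^sup>2))"
    by (intro sum_mono mult_left_mono bessel[OF fin(1) on_\<theta>]) auto
  also have "\<dots> = (\<Sum>b\<in>B. \<Sum>b'\<in>B. w b powr r * w b' powr r * (norm (E b b'))\<^sup>2)"
    unfolding sum_distrib_left K_def using z
    by (intro sum.cong refl) (simp add: norm_mult power_mult_distrib norm_W_sq mult.assoc)
  also have "\<dots> \<le> (\<Sum>b\<in>B. \<Sum>b'\<in>B. (w b powr (2 * r) * (norm (E b b'))\<^sup>2 + w b' powr (2 * r) * (norm (E b' b))\<^sup>2) / 2)"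
  proof (intro sum_mono)
    fix b b' assume "b \<in> B" "b' \<in> B"
    have sq: "a powr (2 * r) = (a powr r)\<^sup>2" for a
      by (simp add: power2_eq_square flip: powr_add)
    have n: "norm (E b' b) = norm (E b b')" by (metis cnj_E complex_mod_cnj)
    have "w b powr r * w b' powr r \<le> ((w b powr r)\<^sup>2 + (w b' powr r)\<^sup>2) / 2"
      using sum_squares_bound[of "w b powr r" "w b' powr r"] by simp
    then have "w b powr r * w b' powr r * (norm (E b b'))\<^sup>2 \<le> ((w b powr r)\<^sup>2 + (w b' powr r)\<^sup>2) / 2 * (norm (E b b'))\<^sup>2"
      by (intro mult_right_mono) auto
    then show "w b powr r * w b' powr r * (norm (E b b'))\<^sup>2
        \<le> (w b powr (2 * r) * (norm (E b b'))\<^sup>2 + w b' powr (2 * r) * (norm (E b' b))\<^sup>2) / 2"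
      unfolding n sq by (simp add: algebra_simps)
  qed
  also have "\<dots> = (\<Sum>b\<in>B. w b powr (2 * r) * (\<Sum>b'\<in>B. (norm (E b b'))\<^sup>2))"
  proof -
    have "(\<Sum>b\<in>B. \<Sum>b'\<in>B. w b' powr (2 * r) * (norm (E b' b))\<^sup>2) = (\<Sum>b\<in>B. \<Sum>b'\<in>B. w b powr (2 * r) * (norm (E b b'))\<^sup>2)"
      by (rule sum.swap)
    then show ?thesis
      unfolding sum_distrib_left add_divide_distrib sum.distrib sum_divide_distrib[symmetric] by simp
  qed
  also have "\<dots> = (\<Sum>b\<in>B. w b powr (2 * r) * (\<beta>\<^sup>2 + (e1\<^sup>2 - \<beta>\<^sup>2) * \<Omega> b))"
  proof (intro sum.cong refl)
    fix b assume b: "b \<in> B"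
    show "w b powr (2 * r) * (\<Sum>b'\<in>B. (norm (E b b'))\<^sup>2) = w b powr (2 * r) * (\<beta>\<^sup>2 + (e1\<^sup>2 - \<beta>\<^sup>2) * \<Omega> b)"
      unfolding E_def norm_affine_projection_delta[OF b] by (simp flip: of_real_add)
  qed
  finally show ?thesis .
qed

text \<open>The powers of \<rho> and \<open>w\<close> in the majorant have exponent 0 here and are
  at most 1, which leaves \<open>H\<close>. Cauchy-Schwarz over \<open>j\<close> then separates the
  eigenvalues \<open>s j\<close> from it.\<close>

lemma \<Phi>_edge1:
  assumes z: "Re z = 1"
  shows "\<Phi> z \<le> sqrt (\<Sum>j\<in>J. s j powr (2 * r)) * sqrt (\<Sum>b\<in>B. w b powr (2 * r) * (\<beta>\<^sup>2 + (e1\<^sup>2 - \<beta>\<^sup>2) * \<Omega> b))"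
proof -
  have "\<Phi> z \<le> (\<Sum>j\<in>J. s j powr r * H j z)"
    unfolding \<Phi>_def H_def using z \<beta>0
    by (intro sum_mono mult_mono add_mono mult_left_mono add_nonneg_nonneg mult_nonneg_nonneg sum_nonneg)
       (auto intro: mult_left_le_one_le simp: powr_def)
  also have "\<dots> \<le> sqrt ((\<Sum>j\<in>J. (s j powr r)\<^sup>2) * (\<Sum>j\<in>J. (H j z)\<^sup>2))"
    using Cauchy_Schwarz_ineq_sum by (rule real_le_rsqrt)
  also have "\<dots> = sqrt (\<Sum>j\<in>J. s j powr (2 * r)) * sqrt (\<Sum>j\<in>J. (H j z)\<^sup>2)"
    unfolding real_sqrt_mult by (simp add: power2_eq_square flip: powr_add)
  also have "\<dots> \<le> sqrt (\<Sum>j\<in>J. s j powr (2 * r)) * sqrt (\<Sum>b\<in>B. w b powr (2 * r) * (\<beta>\<^sup>2 + (e1\<^sup>2 - \<beta>\<^sup>2) * \<Omega> b))"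
    using sum_H_sq_le[OF z] by (intro mult_left_mono) (auto intro: sum_nonneg)
  finally show ?thesis .
qed

text \<open>At \<open>1 / r\<close> the exponent of \<open>\<gamma>\<close> vanishes, so
  \<open>g\<close> is the identity, while the powers of \<open>s\<close> and \<open>w\<close> become
  first powers and square roots. The point is real, so the conjugation symmetry makes each product a
  square.\<close>

lemma F_at: "F (of_real (1 / r)) = of_real (\<Sum>j\<in>J. s j *
    ((\<Sum>l\<in>L. \<rho> l powr (1 - 1 / r) * (norm (\<Sum>b\<in>B. cnj (\<theta> j b) * of_real (sqrt (w b)) * u l b))\<^sup>2)
     + \<beta> * (\<Sum>b\<in>B. w b powr (2 * r - 1) * (norm (\<theta> j b))\<^sup>2)))"
proof -
  let ?z = "of_real (1 / r) :: complex"
  have rr: "r * (1 / r) = 1" using r1 by simp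
  have g1: "\<gamma> ?z = 1" unfolding \<gamma>_def using r1 x0 by simp
  have W1: "W b ?z = of_real (sqrt (w b))" if b: "b \<in> B" for b
  proof -
    have "W b ?z = of_real (w b) powr (of_real (1 / 2))" unfolding W_def using r1 by simp
    also have "\<dots> = of_real (w b powr (1 / 2))" using w0[OF b] by (rule powr_of_real)
    finally show ?thesis using w0[OF b] by (simp add: powr_half_sqrt)
  qed
  have P1: "P j l ?z = (\<Sum>b\<in>B. cnj (\<theta> j b) * of_real (sqrt (w b)) * u l b)" for j l
    unfolding P_def g1 by (intro sum.cong refl) (simp only: W1 mult_1)
  have Y1: "Y j b ?z = cnj (\<theta> j b) * of_real (sqrt (w b))" if b: "b \<in> B" for j b
  proof -
    have "Y j b ?z = (\<Sum>b'\<in>B. (cnj (\<theta> j b') * W b' ?z) * (if b = b' then 1 else 0))"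
      unfolding Y_def V_def g1 by simp
    also have "\<dots> = cnj (\<theta> j b) * W b ?z"
      using b fin(2) by (simp add: if_distrib[of "\<lambda>x. _ * x"] cong: if_cong)
    finally show ?thesis using W1[OF b] by simp
  qed
  have cz: "cnj ?z = ?z" by simp
  have sp: "of_real (s j) powr (of_real r * ?z + of_real 0) = (of_real (s j) :: complex)" if "j \<in> J" for j
    using s0[OF that] r1 by simp
  have rp: "of_real (\<rho> l) powr (of_real (-1) * ?z + of_real 1) = (of_real (\<rho> l powr (1 - 1 / r)) :: complex)" if "l \<in> L" for l
    using powr_of_real[OF \<rho>0[OF that], of "1 - 1 / r"] by simp
  have wp: "of_real (w b) powr (of_real (- 2 * r) * ?z + of_real (2 * r)) * (Y j b ?z * Y' j b ?z)
      = (of_real (w b powr (2 * r - 1) * (norm (\<theta> j b))\<^sup>2) :: complex)" if b: "b \<in> B" for j b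
  proof -
    have "of_real (- 2 * r) * ?z + of_real (2 * r) = (of_real (2 * r - 2) :: complex)"
      using r1 by simp
    then have 1: "of_real (w b) powr (of_real (- 2 * r) * ?z + of_real (2 * r)) = (of_real (w b powr (2 * r - 2)) :: complex)"
      using powr_of_real[OF w0[OF b], of "2 * r - 2"] by simp
    have "Y j b ?z * Y' j b ?z = of_real ((norm (Y j b ?z))\<^sup>2)"
      unfolding Y'_eq cz by (simp add: complex_norm_square del: of_real_power)
    also have "(norm (Y j b ?z))\<^sup>2 = (norm (\<theta> j b))\<^sup>2 * w b"
      unfolding Y1[OF b] norm_mult power_mult_distrib using w0[OF b] by simp
    finally have 2: "Y j b ?z * Y' j b ?z = of_real ((norm (\<theta> j b))\<^sup>2 * w b)" .
    have 3: "w b powr (2 * r - 2) * w b = w b powr (2 * r - 1)"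
    proof (cases "w b = 0")
      case False
      then have "0 < w b" using w0[OF b] by simp
      then have "w b powr (2 * r - 2) * w b powr 1 = w b powr (2 * r - 1)" by (subst powr_add[symmetric]) simp
      then show ?thesis using \<open>0 < w b\<close> by simp
    qed simp
    have "w b powr (2 * r - 2) * ((norm (\<theta> j b))\<^sup>2 * w b) = w b powr (2 * r - 1) * (norm (\<theta> j b))\<^sup>2"
      by (metis 3 mult.assoc mult.commute)
    then show ?thesis unfolding 1 2 by (metis of_real_mult)
  qed
  have Pp: "P j l ?z * P' j l ?z = of_real ((norm (P j l ?z))\<^sup>2)" for j l
    unfolding P'_eq cz by (simp add: complex_norm_square del: of_real_power)
  have A: "(\<Sum>l\<in>L. of_real (\<rho> l) powr (of_real (-1) * ?z + of_real 1) * (P j l ?z * P' j l ?z))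
      = of_real (\<Sum>l\<in>L. \<rho> l powr (1 - 1 / r) * (norm (\<Sum>b\<in>B. cnj (\<theta> j b) * of_real (sqrt (w b)) * u l b))\<^sup>2)" for j
    unfolding of_real_sum of_real_mult by (intro sum.cong refl, simp only: rp Pp, simp only: P1)
  have A': "(\<Sum>b\<in>B. of_real (w b) powr (of_real (- 2 * r) * ?z + of_real (2 * r)) * (Y j b ?z * Y' j b ?z))
      = of_real (\<Sum>b\<in>B. w b powr (2 * r - 1) * (norm (\<theta> j b))\<^sup>2)" for j
    unfolding of_real_sum by (intro sum.cong refl) (simp only: wp)
  show ?thesis
    unfolding F_def A A' of_real_sum[of _ J] of_real_mult[of "s _"] of_real_add of_real_mult[of \<beta>]
    by (intro sum.cong refl) (simp only: sp)
qed

text \<open>The three lines theorem at \<open>t = 1 / r\<close>. \<open>F0\<close> and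
  \<open>F1\<close> are positive majorants of the edge bounds, since \<open>three_lines\<close>
  takes their logarithms.\<close>

theorem interpolation:
  assumes F0: "0 < F0" "x * (\<Sum>l\<in>L. \<rho> l) + \<beta> * (\<Sum>b\<in>B. w b powr (2 * r) * (1 + (x - 1) * \<Omega> b)) \<le> F0"
    and F1: "0 < F1" "sqrt (\<Sum>j\<in>J. s j powr (2 * r)) * sqrt (\<Sum>b\<in>B. w b powr (2 * r) * (\<beta>\<^sup>2 + (e1\<^sup>2 - \<beta>\<^sup>2) * \<Omega> b)) \<le> F1"
  shows "(\<Sum>j\<in>J. s j *
    ((\<Sum>l\<in>L. \<rho> l powr (1 - 1 / r) * (norm (\<Sum>b\<in>B. cnj (\<theta> j b) * of_real (sqrt (w b)) * u l b))\<^sup>2)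
     + \<beta> * (\<Sum>b\<in>B. w b powr (2 * r - 1) * (norm (\<theta> j b))\<^sup>2))) \<le> F0 powr (1 - 1 / r) * F1 powr (1 / r)"
proof -
  obtain K where K: "\<And>z. 0 \<le> Re z \<Longrightarrow> Re z \<le> 1 \<Longrightarrow> norm (F z) \<le> K"
    using strip_bounded_entire_F unfolding strip_bounded_entire_def by blast
  have "norm (F (of_real (1 / r))) \<le> F0 powr (1 - 1 / r) * F1 powr (1 / r)"
  proof (rule three_lines[OF _ K F0(1) F1(1)])
    show "F holomorphic_on UNIV" using strip_bounded_entire_F unfolding strip_bounded_entire_def by blast
    show "norm (F z) \<le> F0" if "Re z = 0" for z
      using norm_F_le[of z] \<Phi>_edge0[of z] \<Phi>_edge0[of "cnj z"] that F0(2) by simp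
    show "norm (F z) \<le> F1" if "Re z = 1" for z
      using norm_F_le[of z] \<Phi>_edge1[of z] \<Phi>_edge1[of "cnj z"] that F1(2) by simp
  qed (use r1 in auto)
  moreover have "a \<le> norm (of_real a :: complex)" for a by simp
  ultimately show ?thesis unfolding F_at using order_trans by blast
qed

end

section \<open>The sharp bound in coordinates\<close>

text \<open>With \<open>y = x + m - 1\<close> the left side is what interpolation and the
  arithmetic-geometric mean inequality produce; the right side is the sharp constant, as the root
  equation gives \<open>x powr p + m - 1 = 2 * y\<close>. Both are monomials in \<open>2\<close>,
  \<open>x\<close>, \<open>y\<close>, hence compared by logarithms.\<close>

lemma x_root_constant:
  fixes x y p :: real
  assumes p: "0 < p" and x: "0 < x" and y: "0 < y"
  shows "1 / 2 * sqrt (y / x) * ((2 * x) powr (1 - 2 / p) * (2 * x\<^sup>2 / y) powr (1 / p)) = sqrt (x * y) / (2 * y) powr (1 / p)"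
proof -
  have "ln (1 / 2 * sqrt (y / x) * ((2 * x) powr (1 - 2 / p) * (2 * x\<^sup>2 / y) powr (1 / p))) = ln (sqrt (x * y) / (2 * y) powr (1 / p))"
    using p x y by (simp add: ln_mult ln_div ln_powr ln_sqrt ln_realpow field_simps)
  then show ?thesis using p x y by (subst (asm) ln_inj_iff) auto
qed

text \<open>The inequality stripped of matrices: \<open>a\<close>, \<open>s\<close>,
  \<open>w\<close> stand for the eigenvalues of \<open>R\<close>, of the sum and of the
  \<open>X k\<close>. The hypothesis \<open>diag\<close> says that the block matrix of the overview
  has diagonal \<open>w\<close>; \<open>overlap\<close> says that the diagonal of
  \<open>u u*\<close> has mean \<open>1 / m\<close> for the weights
  \<open>w b powr p\<close>.\<close>

lemma weighted_schatten_bound: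
  fixes \<theta> :: "'j \<Rightarrow> 'b \<Rightarrow> complex" and u :: "'l \<Rightarrow> 'b \<Rightarrow> complex"
    and s :: "'j \<Rightarrow> real" and w :: "'b \<Rightarrow> real" and a :: "'l \<Rightarrow> real" and m p x :: real
  assumes fin: "finite J" "finite B" "finite L"
    and on: "orthonormal_on B J \<theta>" "orthonormal_on B L u"
    and s0: "\<And>j. j \<in> J \<Longrightarrow> 0 \<le> s j" and w0: "\<And>b. b \<in> B \<Longrightarrow> 0 \<le> w b" and a0: "\<And>l. l \<in> L \<Longrightarrow> 0 \<le> a l"
    and p: "2 \<le> p" and m: "1 \<le> m" and x: "1 < x" "x powr p = 2 * x + m - 1"
    and diag: "\<And>b. b \<in> B \<Longrightarrow> (\<Sum>j\<in>J. s j * (norm (\<theta> j b))\<^sup>2) = w b"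
    and overlap: "(\<Sum>b\<in>B. w b powr p * (\<Sum>l\<in>L. (norm (u l b))\<^sup>2)) = (\<Sum>b\<in>B. w b powr p) / m"
  shows "(\<Sum>l\<in>L. a l * (sqrt m * sqrt (\<Sum>j\<in>J. s j * (norm (\<Sum>b\<in>B. cnj (\<theta> j b) * of_real (sqrt (w b)) * u l b))\<^sup>2)))
    \<le> sqrt (x * (x + m - 1)) / (x powr p + m - 1) powr (1 / p)
       * (\<Sum>l\<in>L. a l powr (p / (p - 1))) powr (1 - 1 / p) * (\<Sum>j\<in>J. s j powr p) powr (1 / p)"
proof -
  define N where "N l = (\<Sum>j\<in>J. s j * (norm (\<Sum>b\<in>B. cnj (\<theta> j b) * of_real (sqrt (w b)) * u l b))\<^sup>2)" for l
  define q where "q = p / (p - 1)"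
  define y where "y = x + m - 1"
  define t where "t = (\<Sum>l\<in>L. a l powr q)"
  define d where "d = (\<Sum>b\<in>B. w b powr p)"
  define S where "S = (\<Sum>j\<in>J. s j powr p)"
  define C where "C = sqrt (x * y) / (2 * y) powr (1 / p)"
  have N0: "0 \<le> N l" for l unfolding N_def using s0 by (intro sum_nonneg) auto
  have y0: "0 < y" using x m by (simp add: y_def)
  have C0: "0 \<le> C" using x y0 by (simp add: C_def)
  have xp: "x powr p = x + y" using x by (simp add: y_def)
  have Ceq: "sqrt (x * (x + m - 1)) / (x powr p + m - 1) powr (1 / p) = C"
    unfolding C_def xp by (simp add: y_def algebra_simps)
  have t0: "0 \<le> t" and d0: "0 \<le> d" and S0: "0 \<le> S" unfolding t_def d_def S_def by (auto intro: sum_nonneg)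
  have "(\<Sum>l\<in>L. a l * (sqrt m * sqrt (N l))) \<le> C * t powr (1 - 1 / p) * S powr (1 / p)"
  \<comment> \<open>If \<open>t\<close> or \<open>d\<close> vanishes, \<rho> cannot be normalized to
    a positive sum, but then every summand on the left is 0.\<close>
  proof (cases "t = 0 \<or> d = 0")
    case True
    have "a l * (sqrt m * sqrt (N l)) = 0" if l: "l \<in> L" for l
    proof (cases "t = 0")
      case True
      then have "a l powr q = 0" using l fin(3) unfolding t_def by (subst (asm) sum_nonneg_eq_0_iff) auto
      then show ?thesis by simp
    next
      case False
      with True have "d = 0" by simp
      then have "w b = 0" if "b \<in> B" for b using that fin(2) unfolding d_def by (subst (asm) sum_nonneg_eq_0_iff) auto
      then have "N l = 0" unfolding N_def by simp
      then show ?thesis by simp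
    qed
    then have "(\<Sum>l\<in>L. a l * (sqrt m * sqrt (N l))) = 0" by (intro sum.neutral) blast
    then show ?thesis using C0 by simp
  next
    case False
    with t0 d0 have tp: "0 < t" and dp: "0 < d" by auto
    have Sp: "0 < S"
    proof (rule ccontr)
      assume "\<not> 0 < S"
      with S0 have "S = 0" by simp
      then have "s j = 0" if "j \<in> J" for j using that fin(1) unfolding S_def by (subst (asm) sum_nonneg_eq_0_iff) auto
      then have "w b = 0" if "b \<in> B" for b using diag[OF that] by simp
      then have "d = 0" unfolding d_def by simp
      then show False using dp by simp
    qed
    define r where "r = p / 2"
    \<comment> \<open>\<open>e\<close> is the common value of the sum of \<rho> and the
      \<open>\<Omega>\<close>-weighted sum of \<open>w b powr p\<close>. With this \<beta>, the two
      terms in the bound for the edge \<open>Re z = 0\<close> both equal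
      \<open>x * e\<close>.\<close>
    define \<beta> where "\<beta> = x / y"
    define e where "e = d / m"
    define \<rho> where "\<rho> l = e / t * a l powr q" for l
    have ep: "0 < e" using dp m by (simp add: e_def)
    have r1: "1 \<le> r" using p by (simp add: r_def)
    have r2: "2 * r = p" by (simp add: r_def)
    have \<rho>0: "0 \<le> \<rho> l" for l using ep tp by (simp add: \<rho>_def)
    have \<beta>pos: "0 < \<beta>" using x y0 by (simp add: \<beta>_def)
    interpret weighted_interpolation J B L \<theta> u s w \<rho> r x \<beta>
      using fin on s0 w0 \<rho>0 r1 x(1) \<beta>pos by unfold_locales auto
    have \<rho>sum: "(\<Sum>l\<in>L. \<rho> l) = e" 
    proof -
      have "(\<Sum>l\<in>L. \<rho> l) = e / t * (\<Sum>l\<in>L. a l powr q)" unfolding \<rho>_def sum_distrib_left ..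
      then show ?thesis using tp by (simp add: t_def[symmetric])
    qed
    have \<Omega>e: "(\<Sum>b\<in>B. w b powr p * \<Omega> b) = e" using overlap by (simp add: \<Omega>_def d_def e_def)
    have lin: "(\<Sum>b\<in>B. w b powr (2 * r) * (k + c * \<Omega> b)) = k * d + c * e" for k c
    proof -
      have "(\<Sum>b\<in>B. w b powr (2 * r) * (k + c * \<Omega> b)) = k * (\<Sum>b\<in>B. w b powr p) + c * (\<Sum>b\<in>B. w b powr p * \<Omega> b)"
        unfolding r2 sum_distrib_left sum.distrib[symmetric] by (intro sum.cong) (auto simp: algebra_simps)
      then show ?thesis using \<Omega>e by (simp add: d_def)
    qed
    have dm: "d = m * e" using m by (simp add: e_def)
    have F0: "x * (\<Sum>l\<in>L. \<rho> l) + \<beta> * (\<Sum>b\<in>B. w b powr (2 * r) * (1 + (x - 1) * \<Omega> b)) = 2 * x * e"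
    proof -
      have "x * e + \<beta> * (1 * d + (x - 1) * e) = x * e + \<beta> * y * e"
        unfolding dm y_def by (simp add: algebra_simps)
      also have "\<beta> * y = x" using y0 by (simp add: \<beta>_def)
      finally show ?thesis unfolding \<rho>sum lin by simp
    qed
    \<comment> \<open>The root equation enters as \<open>x powr p = x + y\<close>. With
      \<open>1 + \<beta> = (x + y) / y\<close> it turns \<open>e1\<close> into
      \<open>x * x powr r / y\<close>, and the remaining factor \<open>m - 1 + x + y\<close> is
      \<open>2 * y\<close>.\<close>
    have F1: "(\<Sum>b\<in>B. w b powr (2 * r) * (\<beta>\<^sup>2 + (e1\<^sup>2 - \<beta>\<^sup>2) * \<Omega> b)) = 2 * x\<^sup>2 / y * e"
    proof -
      have xr: "(x powr r)\<^sup>2 = x + y" using xp x by (simp add: power2_eq_square r_def flip: powr_add)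
      have "1 + \<beta> = (x + y) / y" using y0 by (simp add: \<beta>_def field_simps)
      moreover have "x powr (1 - r) = x * x powr (- r)" using x by (simp add: powr_diff powr_minus field_simps)
      ultimately have "e1 = x * x powr (- r) * ((x + y) / y)" using e1_def by simp
      also have "\<dots> = x * x powr r / y"
        unfolding xr[symmetric] using x by (simp add: power2_eq_square powr_minus field_simps)
      finally have e1: "e1\<^sup>2 = x\<^sup>2 / y\<^sup>2 * (x + y)" by (simp add: power_mult_distrib power_divide xr)
      have \<beta>2: "\<beta>\<^sup>2 = x\<^sup>2 / y\<^sup>2" by (simp add: \<beta>_def power_divide)
      have "k * (m * e) + (k * (x + y) - k) * e = k * (m - 1 + x + y) * e" for k :: real
        by (simp add: algebra_simps)
      then have "\<beta>\<^sup>2 * d + (e1\<^sup>2 - \<beta>\<^sup>2) * e = x\<^sup>2 / y\<^sup>2 * (m - 1 + x + y) * e"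
        unfolding dm e1 \<beta>2 by blast
      also have "m - 1 + x + y = 2 * y" by (simp add: y_def)
      finally show ?thesis unfolding lin using y0 by (simp add: power2_eq_square)
    qed
    define A where "A = (\<Sum>l\<in>L. \<rho> l powr (1 - 1 / r) * N l)"
    have A0: "0 \<le> A" unfolding A_def using N0 by (auto intro!: sum_nonneg)
    define G where "G = (2 * x * e) powr (1 - 2 / p) * (S * (2 * x\<^sup>2 / y * e)) powr (1 / p)"
    \<comment> \<open>The left side is the value of \<open>F\<close> at \<open>1 / r\<close>; the
      hypothesis \<open>diag\<close> collapses its second sum to \<open>\<beta> * d\<close>.\<close>
    have main: "A + \<beta> * d \<le> G"
    proof -
      have "A + \<beta> * d = (\<Sum>j\<in>J. s j *
          ((\<Sum>l\<in>L. \<rho> l powr (1 - 1 / r) * (norm (\<Sum>b\<in>B. cnj (\<theta> j b) * of_real (sqrt (w b)) * u l b))\<^sup>2)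
            + \<beta> * (\<Sum>b\<in>B. w b powr (2 * r - 1) * (norm (\<theta> j b))\<^sup>2)))"
      proof -
        have 1: "(\<Sum>j\<in>J. s j * (\<Sum>l\<in>L. \<rho> l powr (1 - 1 / r) * (norm (\<Sum>b\<in>B. cnj (\<theta> j b) * of_real (sqrt (w b)) * u l b))\<^sup>2)) = A"
          unfolding A_def N_def sum_distrib_left by (subst sum.swap) (simp add: mult_ac)
        have "(\<Sum>j\<in>J. s j * (\<beta> * (\<Sum>b\<in>B. w b powr (2 * r - 1) * (norm (\<theta> j b))\<^sup>2)))
           = \<beta> * (\<Sum>b\<in>B. w b powr (2 * r - 1) * (\<Sum>j\<in>J. s j * (norm (\<theta> j b))\<^sup>2))"
          unfolding sum_distrib_left by (subst sum.swap) (simp add: mult_ac)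
        also have "\<dots> = \<beta> * (\<Sum>b\<in>B. w b powr p)"
        proof (intro arg_cong2[where f = "(*)"] sum.cong refl)
          fix b assume b: "b \<in> B"
          show "w b powr (2 * r - 1) * (\<Sum>j\<in>J. s j * (norm (\<theta> j b))\<^sup>2) = w b powr p"
            unfolding diag[OF b] r2 using w0[OF b] by (cases "w b = 0") (auto simp: powr_diff)
        qed
        finally show ?thesis using 1 by (simp add: distrib_left sum.distrib d_def)
      qed
      also have "\<dots> \<le> (2 * x * e) powr (1 - 1 / r) * (sqrt S * sqrt (2 * x\<^sup>2 / y * e)) powr (1 / r)"
        using interpolation[of "2 * x * e" "sqrt S * sqrt (2 * x\<^sup>2 / y * e)"] F0 F1 x y0 ep Sp
        by (simp add: S_def r2)
      also have "(sqrt S * sqrt (2 * x\<^sup>2 / y * e)) powr (1 / r) = (S * (2 * x\<^sup>2 / y * e)) powr (1 / p)"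
      proof -
        have "sqrt S * sqrt (2 * x\<^sup>2 / y * e) = (S * (2 * x\<^sup>2 / y * e)) powr (1 / 2)"
          using Sp x y0 ep by (subst powr_half_sqrt) (simp_all only: real_sqrt_mult, auto)
        then show ?thesis by (simp add: powr_powr r_def)
      qed
      finally show ?thesis by (simp add: G_def r_def)
    qed
    \<comment> \<open>This turns \<open>\<rho> l powr (1 - 1 / r)\<close> into a multiple of
      \<open>a l powr (2 - q)\<close>, exactly the weight left over when \<open>a l\<close> is split
      into \<open>a l powr (q / 2)\<close> and \<open>a l powr ((2 - q) / 2)\<close> for
      Cauchy-Schwarz.\<close>
    have q: "q * (1 - 1 / r) = 2 - q"
      using p by (simp add: q_def r_def field_simps)
    have "(e / t * a l powr q) powr (1 - 1 / r) = (e / t) powr (1 - 1 / r) * a l powr (2 - q)" for l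
      unfolding powr_mult powr_powr q ..
    then have AA: "A = (e / t) powr (1 - 1 / r) * (\<Sum>l\<in>L. a l powr (2 - q) * N l)"
      unfolding A_def \<rho>_def sum_distrib_left by (simp only: mult.assoc)
    have cs: "(\<Sum>l\<in>L. a l * sqrt (N l)) \<le> sqrt (t * (\<Sum>l\<in>L. a l powr (2 - q) * N l))"
    proof (rule real_le_rsqrt)
      have half: "(z powr (c / 2))\<^sup>2 = z powr c" for z c :: real
        by (simp add: power2_eq_square flip: powr_add)
      have "(\<Sum>l\<in>L. a l * sqrt (N l))\<^sup>2 = (\<Sum>l\<in>L. a l powr (q / 2) * (a l powr ((2 - q) / 2) * sqrt (N l)))\<^sup>2"
      proof (intro arg_cong[where f = "\<lambda>z. z\<^sup>2"] sum.cong refl)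
        fix l assume l: "l \<in> L"
        have "a l powr (q / 2) * a l powr ((2 - q) / 2) = a l"
          using a0[OF l] by (simp add: diff_divide_distrib flip: powr_add)
        then show "a l * sqrt (N l) = a l powr (q / 2) * (a l powr ((2 - q) / 2) * sqrt (N l))"
          by (metis mult.assoc)
      qed
      also have "\<dots> \<le> (\<Sum>l\<in>L. (a l powr (q / 2))\<^sup>2) * (\<Sum>l\<in>L. (a l powr ((2 - q) / 2) * sqrt (N l))\<^sup>2)"
        by (rule Cauchy_Schwarz_ineq_sum)
      also have "\<dots> = t * (\<Sum>l\<in>L. a l powr (2 - q) * N l)"
        unfolding power_mult_distrib half t_def using N0 by simp
      finally show "(\<Sum>l\<in>L. a l * sqrt (N l))\<^sup>2 \<le> t * (\<Sum>l\<in>L. a l powr (2 - q) * N l)" .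
    qed
    \<comment> \<open>Passing from the sum to the product turns the unwanted quantity
      \<open>d\<close> into a factor, which later cancels against the powers of
      \<open>e\<close>.\<close>
    have "2 * sqrt (A * (\<beta> * d)) \<le> A + \<beta> * d"
      using arith_geo_mean_sqrt[OF A0, of "\<beta> * d"] \<beta>pos dp by simp
    then have sA: "2 * sqrt A * sqrt (\<beta> * d) \<le> G" using main by (simp add: real_sqrt_mult)
    define T where "T = (\<Sum>l\<in>L. a l powr (2 - q) * N l)"
    have T0: "0 \<le> T" unfolding T_def using N0 by (auto intro!: sum_nonneg)
    have "(\<Sum>l\<in>L. a l * (sqrt m * sqrt (N l))) = sqrt m * (\<Sum>l\<in>L. a l * sqrt (N l))"
      by (simp add: sum_distrib_left mult_ac)
    also have "\<dots> \<le> sqrt m * sqrt (t * T)" using cs m by (intro mult_left_mono) (auto simp: T_def)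
    also have "\<dots> = sqrt m * sqrt t * sqrt ((t / e) powr (1 - 1 / r)) * sqrt A"
    proof -
      have "T = (t / e) powr (1 - 1 / r) * A"
        unfolding AA T_def[symmetric] using tp ep by (simp add: powr_divide)
      then show ?thesis by (simp add: real_sqrt_mult)
    qed
    also have "\<dots> \<le> sqrt m * sqrt t * sqrt ((t / e) powr (1 - 1 / r)) * (G / (2 * sqrt (\<beta> * d)))"
    proof (intro mult_left_mono)
      show "sqrt A \<le> G / (2 * sqrt (\<beta> * d))" using sA \<beta>pos dp by (simp add: field_simps)
    qed (use m tp in auto)
    \<comment> \<open>All powers of \<open>e\<close> cancel, and so does the \<open>m\<close>
      outside \<open>y\<close>. Both sides are positive monomials, so the identity is linear in
      logarithms.\<close>
    also have "\<dots> = C * t powr (1 - 1 / p) * S powr (1 / p)"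
    proof -
      have bd: "\<beta> * d = x / y * m * e" by (simp add: \<beta>_def dm)
      have "ln (sqrt m * sqrt t * sqrt ((t / e) powr (1 - 1 / r)) * (G / (2 * sqrt (\<beta> * d))))
          = ln (1 / 2 * sqrt (y / x) * ((2 * x) powr (1 - 2 / p) * (2 * x\<^sup>2 / y) powr (1 / p)) * t powr (1 - 1 / p) * S powr (1 / p))"
        unfolding bd G_def r_def using p x(1) y0 m tp ep Sp
        by (simp add: ln_mult ln_div ln_powr ln_sqrt ln_realpow field_simps)
      then have "sqrt m * sqrt t * sqrt ((t / e) powr (1 - 1 / r)) * (G / (2 * sqrt (\<beta> * d)))
          = 1 / 2 * sqrt (y / x) * ((2 * x) powr (1 - 2 / p) * (2 * x\<^sup>2 / y) powr (1 / p)) * t powr (1 - 1 / p) * S powr (1 / p)"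
        unfolding bd G_def using p x(1) y0 m tp ep Sp by (subst (asm) ln_inj_iff) auto
      moreover have "1 / 2 * sqrt (y / x) * ((2 * x) powr (1 - 2 / p) * (2 * x\<^sup>2 / y) powr (1 / p)) = C"
        unfolding C_def using p x(1) y0 by (intro x_root_constant) auto
      ultimately show ?thesis by (simp only:)
    qed
    finally show ?thesis .
  qed
  then show ?thesis unfolding Ceq N_def t_def S_def q_def .
qed

hide_const (open) Finite_Cartesian_Product.vec Finite_Cartesian_Product.mat
  Finite_Cartesian_Product.row Finite_Cartesian_Product.column
no_notation Finite_Cartesian_Product.vec_nth (infixl "$" 90)

section \<open>Unitary completion and the spectral theorem\<close>

lemma adjoint_dim [simp]:
  "dim_row (mat_adjoint A) = dim_col A" "dim_col (mat_adjoint A) = dim_row A"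
  by (auto simp: mat_adjoint_def)

lemma adjoint_index [simp]:
  fixes A :: "complex mat"
  assumes "i < dim_col A" "j < dim_row A"
  shows "mat_adjoint A $$ (i, j) = cnj (A $$ (j, i))"
  using assms by (simp add: mat_adjoint_def mat_of_rows_index)

lemma adjoint_adjoint [simp]: "mat_adjoint (mat_adjoint A) = (A :: complex mat)"
  by (rule eq_matI) auto

lemma index_mult_sum:
  assumes "A \<in> carrier_mat nr n" "B \<in> carrier_mat n nc" "i < nr" "j < nc"
  shows "(A * B) $$ (i, j) = (\<Sum>k<n. A $$ (i, k) * B $$ (k, j))"
  using assms by (auto simp: scalar_prod_def atLeast0LessThan)

lemma adjoint_mult:
  fixes A B :: "complex mat"
  assumes A: "A \<in> carrier_mat nr n" and B: "B \<in> carrier_mat n nc"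
  shows "mat_adjoint (A * B) = mat_adjoint B * mat_adjoint A"
proof (rule eq_matI)
  fix i j assume ij: "i < dim_row (mat_adjoint B * mat_adjoint A)" "j < dim_col (mat_adjoint B * mat_adjoint A)"
  then have i: "i < nc" and j: "j < nr" using A B by auto
  have "mat_adjoint (A * B) $$ (i, j) = cnj ((A * B) $$ (j, i))" using A B i j by simp
  also have "\<dots> = (\<Sum>k<n. cnj (A $$ (j, k)) * cnj (B $$ (k, i)))"
    using index_mult_sum[OF A B j i] by simp
  also have "\<dots> = (\<Sum>k<n. mat_adjoint B $$ (i, k) * mat_adjoint A $$ (k, j))"
    using A B i j by (intro sum.cong) auto
  also have "\<dots> = (mat_adjoint B * mat_adjoint A) $$ (i, j)"
    using index_mult_sum[OF mat_adjoint_carrier[OF B] mat_adjoint_carrier[OF A] i j] by simp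
  finally show "mat_adjoint (A * B) $$ (i, j) = (mat_adjoint B * mat_adjoint A) $$ (i, j)" .
qed (use A B in auto)

lemma mat_trace_comm:
  assumes A: "A \<in> carrier_mat n k" and B: "B \<in> carrier_mat k n"
  shows "mat_trace (A * B) = mat_trace (B * A)"
proof -
  have "mat_trace (A * B) = (\<Sum>i<n. \<Sum>j<k. A $$ (i, j) * B $$ (j, i))"
    using A B unfolding mat_trace_def by (intro sum.cong) (auto simp: index_mult_sum[OF A B] simp del: index_mult_mat(1))
  also have "\<dots> = (\<Sum>j<k. \<Sum>i<n. B $$ (j, i) * A $$ (i, j))"
    by (subst sum.swap) (simp add: mult.commute)
  also have "\<dots> = mat_trace (B * A)"
    using A B unfolding mat_trace_def by (intro sum.cong) (auto simp: index_mult_sum[OF B A] simp del: index_mult_mat(1))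
  finally show ?thesis .
qed

section \<open>Unitary matrices and completion of orthonormal systems\<close>

definition unitary_mat :: "nat \<Rightarrow> complex mat \<Rightarrow> bool" where
  "unitary_mat n U \<longleftrightarrow> U \<in> carrier_mat n n \<and> mat_adjoint U * U = 1\<^sub>m n \<and> U * mat_adjoint U = 1\<^sub>m n"

lemma unitary_adjoint: "unitary_mat n U \<Longrightarrow> unitary_mat n (mat_adjoint U)"
  by (auto simp: unitary_mat_def mat_adjoint_carrier)

lemma unitary_mult:
  assumes U: "unitary_mat n U" and V: "unitary_mat n V"
  shows "unitary_mat n (U * V)"
proof -
  note c = U[unfolded unitary_mat_def] V[unfolded unitary_mat_def]
  have cU: "U \<in> carrier_mat n n" "mat_adjoint U \<in> carrier_mat n n"
    and cV: "V \<in> carrier_mat n n" "mat_adjoint V \<in> carrier_mat n n"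
    using c mat_adjoint_carrier by auto
  have a: "mat_adjoint (U * V) = mat_adjoint V * mat_adjoint U" by (rule adjoint_mult[OF cU(1) cV(1)])
  have "mat_adjoint V * mat_adjoint U * (U * V) = mat_adjoint V * (mat_adjoint U * U * V)"
    using cU cV by (simp add: assoc_mult_mat[of _ n n _ n _ n])
  then have 1: "mat_adjoint V * mat_adjoint U * (U * V) = 1\<^sub>m n" using c cV by simp
  have "U * V * (mat_adjoint V * mat_adjoint U) = U * (V * mat_adjoint V * mat_adjoint U)"
    using cU cV by (simp add: assoc_mult_mat[of _ n n _ n _ n])
  then have 2: "U * V * (mat_adjoint V * mat_adjoint U) = 1\<^sub>m n" using c cU by simp
  show ?thesis unfolding unitary_mat_def a using 1 2 cU cV by simp
qed

lemma unitary_cols: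
  assumes "unitary_mat n U" "i < n" "j < n"
  shows "(\<Sum>a<n. cnj (U $$ (a, i)) * U $$ (a, j)) = (if i = j then 1 else 0)"
proof -
  have c: "U \<in> carrier_mat n n" and e: "mat_adjoint U * U = 1\<^sub>m n" using assms by (auto simp: unitary_mat_def)
  have "(mat_adjoint U * U) $$ (i, j) = (\<Sum>a<n. mat_adjoint U $$ (i, a) * U $$ (a, j))"
    using index_mult_sum[OF mat_adjoint_carrier[OF c] c assms(2,3)] .
  then show ?thesis using c assms(2,3) by (simp add: e)
qed

lemma unitary_rows:
  assumes "unitary_mat n U" "i < n" "j < n"
  shows "(\<Sum>a<n. U $$ (i, a) * cnj (U $$ (j, a))) = (if i = j then 1 else 0)"
proof -
  have c: "U \<in> carrier_mat n n" and e: "U * mat_adjoint U = 1\<^sub>m n" using assms by (auto simp: unitary_mat_def)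
  have "(U * mat_adjoint U) $$ (i, j) = (\<Sum>a<n. U $$ (i, a) * mat_adjoint U $$ (a, j))"
    using index_mult_sum[OF c mat_adjoint_carrier[OF c] assms(2,3)] .
  then show ?thesis using c assms(2,3) by (simp add: e)
qed

lemma unitary_col_norm:
  assumes "unitary_mat n U" "i < n"
  shows "(\<Sum>a<n. (norm (U $$ (a, i)))\<^sup>2) = 1"
proof -
  have "of_real (\<Sum>a<n. (norm (U $$ (a, i)))\<^sup>2) = (1 :: complex)"
    using unitary_cols[OF assms(1,2,2)] by (simp add: complex_norm_square mult.commute del: of_real_power)
  then show ?thesis using of_real_eq_1_iff by blast
qed

lemma unitary_row_norm:
  assumes "unitary_mat n U" "i < n"
  shows "(\<Sum>a<n. (norm (U $$ (i, a)))\<^sup>2) = 1"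
proof -
  have "of_real (\<Sum>a<n. (norm (U $$ (i, a)))\<^sup>2) = (1 :: complex)"
    using unitary_rows[OF assms(1,2,2)] by (simp add: complex_norm_square del: of_real_power)
  then show ?thesis using of_real_eq_1_iff by blast
qed

text \<open>The orthogonality conditions form a square linear system whose row \<open>k\<close> is
  zero, so the system is singular; a kernel vector is then normalized.\<close>

lemma exists_unit_orthogonal:
  fixes f :: "nat \<Rightarrow> nat \<Rightarrow> complex"
  assumes k: "k < n" "k \<notin> I"
  shows "\<exists>v. cip {..<n} v v = 1 \<and> (\<forall>i\<in>I. i < n \<longrightarrow> cip {..<n} (f i) v = 0)"
proof -
  define M where "M = Matrix.mat n n (\<lambda>(i, a). if i \<in> I then cnj (f i a) else 0)"
  have M: "M \<in> carrier_mat n n" by (simp add: M_def)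
  have "transpose_mat M *\<^sub>v unit_vec n k = 0\<^sub>v n"
    using k by (intro eq_vecI) (auto simp: M_def scalar_prod_def intro!: sum.neutral)
  moreover have "unit_vec n k \<noteq> (0\<^sub>v n :: complex Matrix.vec)"
    using k by (metis index_unit_vec(1) index_zero_vec(1) zero_neq_one)
  ultimately have "Determinant.det (transpose_mat M) = 0"
    using det_0_iff_vec_prod_zero[of "transpose_mat M" n] M unit_vec_carrier[of n k] by (metis transpose_carrier_mat)
  then have "Determinant.det M = 0" using Determinant.det_transpose[OF M] by simp
  then obtain v where v: "v \<in> carrier_vec n" "v \<noteq> 0\<^sub>v n" "M *\<^sub>v v = 0\<^sub>v n"
    using det_0_iff_vec_prod_zero[OF M] by blast
  define N where "N = (\<Sum>a<n. (norm (v $ a))\<^sup>2)"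
  have "N \<noteq> 0"
  proof
    assume "N = 0"
    then have "\<forall>a<n. v $ a = 0" unfolding N_def by (subst (asm) sum_nonneg_eq_0_iff) auto
    then have "v = 0\<^sub>v n" using v(1) by (intro eq_vecI) auto
    then show False using v(2) by simp
  qed
  moreover have "0 \<le> N" unfolding N_def by (rule sum_nonneg) auto
  ultimately have N: "0 < N" by simp
  define g where "g a = of_real (1 / sqrt N) * v $ a" for a
  have "cip {..<n} g g = of_real (\<Sum>a<n. (norm (g a))\<^sup>2)" by (rule cip_self)
  also have "(\<Sum>a<n. (norm (g a))\<^sup>2) = (\<Sum>a<n. 1 / N * (norm (v $ a))\<^sup>2)"
    unfolding g_def using N by (simp add: norm_mult norm_divide power_mult_distrib power_divide)
  also have "\<dots> = 1 / N * N" by (simp only: sum_distrib_left[symmetric] N_def)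
  finally have "cip {..<n} g g = 1" using N by simp
  moreover have "cip {..<n} (f i) g = 0" if i: "i \<in> I" "i < n" for i
  proof -
    have "(M *\<^sub>v v) $ i = (\<Sum>a<n. cnj (f i a) * v $ a)"
      using i v(1) by (auto simp: M_def scalar_prod_def atLeast0LessThan intro!: sum.cong)
    then have "cip {..<n} (f i) (\<lambda>a. v $ a) = 0" using v(3) i by (simp add: cip_def)
    then show ?thesis unfolding g_def cip_scale by simp
  qed
  ultimately show ?thesis by blast
qed

text \<open>Missing indices are filled one at a time while given vectors keep their positions, so
  that prescribed columns of a unitary can be chosen freely.\<close>

lemma orthonormal_completion:
  fixes f :: "nat \<Rightarrow> nat \<Rightarrow> complex"
  assumes "I \<subseteq> {..<n}" "orthonormal_on {..<n} I f"
  shows "\<exists>g. orthonormal_on {..<n} {..<n} g \<and> (\<forall>i\<in>I. g i = f i)"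
  using assms
proof (induction "card ({..<n} - I)" arbitrary: I f)
  case 0
  then have "{..<n} - I = {}" using card_0_eq[of "{..<n} - I"] by simp
  then have "I = {..<n}" using 0 by blast
  then show ?case using 0 by blast
next
  case (Suc N)
  have "{..<n} - I \<noteq> {}"
  proof
    assume "{..<n} - I = {}"
    then have "card ({..<n} - I) = 0" by (simp only: card.empty)
    with Suc.hyps(2) show False by (metis nat.distinct(1))
  qed
  then obtain k where k: "k < n" "k \<notin> I" by blast
  obtain v where v: "cip {..<n} v v = 1" "\<forall>i\<in>I. i < n \<longrightarrow> cip {..<n} (f i) v = 0"
    using exists_unit_orthogonal[OF k] by blast
  have v': "cip {..<n} v (f i) = 0" if "i \<in> I" for i
    using v(2) that Suc.prems(1) cip_cnj[of "{..<n}" "f i" v] by auto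
  define f' where "f' = f(k := v)"
  have "orthonormal_on {..<n} (insert k I) f'"
    using Suc.prems k v v' unfolding orthonormal_on_def f'_def by auto
  moreover have "N = card ({..<n} - insert k I)"
  proof -
    have "{..<n} - insert k I = ({..<n} - I) - {k}" by auto
    then show ?thesis using Suc.hyps(2) k by simp
  qed
  moreover have "insert k I \<subseteq> {..<n}" using Suc.prems k by auto
  ultimately obtain g where g: "orthonormal_on {..<n} {..<n} g" "\<forall>i\<in>insert k I. g i = f' i"
    using Suc.hyps(1)[of "insert k I" f'] by blast
  have "\<forall>i\<in>I. g i = f i" using g(2) k unfolding f'_def by auto
  then show ?case using g(1) by blast
qed

lemma unitary_completion:
  assumes "I \<subseteq> {..<n}" "orthonormal_on {..<n} I f"
  shows "\<exists>U. unitary_mat n U \<and> (\<forall>i\<in>I. \<forall>a<n. U $$ (a, i) = f i a)"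
proof -
  obtain g where g: "orthonormal_on {..<n} {..<n} g" "\<forall>i\<in>I. g i = f i"
    using orthonormal_completion[OF assms] by blast
  define U where "U = Matrix.mat n n (\<lambda>(a, i). g i a)"
  have U: "U \<in> carrier_mat n n" by (simp add: U_def)
  have 1: "mat_adjoint U * U = 1\<^sub>m n"
  proof (rule eq_matI)
    fix i j assume ij: "i < dim_row (1\<^sub>m n :: complex mat)" "j < dim_col (1\<^sub>m n :: complex mat)"
    then have "(mat_adjoint U * U) $$ (i, j) = (\<Sum>a<n. mat_adjoint U $$ (i, a) * U $$ (a, j))"
      using index_mult_sum[OF mat_adjoint_carrier[OF U] U] by simp
    also have "\<dots> = cip {..<n} (g i) (g j)" unfolding cip_def using ij U by (intro sum.cong) (auto simp: U_def)
    finally show "(mat_adjoint U * U) $$ (i, j) = 1\<^sub>m n $$ (i, j)"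
      using g(1) ij by (auto simp: orthonormal_on_def)
  qed (use U in auto)
  have "U * mat_adjoint U = 1\<^sub>m n"
    using mat_mult_left_right_inverse[OF mat_adjoint_carrier[OF U] U 1] .
  then have "unitary_mat n U" using U 1 by (simp add: unitary_mat_def)
  moreover have "\<forall>i\<in>I. \<forall>a<n. U $$ (a, i) = f i a" using g(2) assms(1) by (auto simp: U_def)
  ultimately show ?thesis by blast
qed

section \<open>Diagonalization of Hermitian matrices\<close>

lemma exists_eigenvalue:
  fixes A :: "complex mat"
  assumes A: "A \<in> carrier_mat n n" and n: "0 < n"
  shows "\<exists>e c. c \<in> carrier_vec n \<and> c \<noteq> 0\<^sub>v n \<and> A *\<^sub>v c = e \<cdot>\<^sub>v c"
proof -
  have "\<not> constant (poly (char_poly A))"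
    using degree_monic_char_poly[OF A] n by (simp add: constant_degree)
  from Fundamental_Theorem_Algebra.fundamental_theorem_of_algebra[OF this] obtain e where "poly (char_poly A) e = 0" ..
  then have "eigenvalue A e" using eigenvalue_root_char_poly[OF A] by simp
  then show ?thesis using A unfolding eigenvalue_def eigenvector_def by auto
qed

lemma mult_mat_vec_sum:
  assumes "A \<in> carrier_mat nr n" "v \<in> carrier_vec n" "i < nr"
  shows "(A *\<^sub>v v) $ i = (\<Sum>k<n. A $$ (i, k) * v $ k)"
  using assms by (auto simp: scalar_prod_def atLeast0LessThan)

text \<open>In a unitary basis starting with the known eigenvectors a Hermitian matrix is block
  diagonal. An eigenvector of the remaining block, transported back, is orthogonal to the known
  ones.\<close>

lemma hermitian_extend_eigenvectors:
  assumes A: "A \<in> carrier_mat n n" and herm: "mat_adjoint A = A" and k: "k < n"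
    and on: "orthonormal_on {..<n} {..<k} g"
    and ev: "\<And>i a. i < k \<Longrightarrow> a < n \<Longrightarrow> (\<Sum>b<n. A $$ (a, b) * g i b) = \<mu> i * g i a"
  shows "\<exists>v e. cip {..<n} v v = 1 \<and> (\<forall>i<k. cip {..<n} (g i) v = 0) \<and> (\<forall>a<n. (\<Sum>b<n. A $$ (a, b) * v b) = e * v a)"
proof -
  obtain U where U: "unitary_mat n U" and Ug: "\<And>i a. i < k \<Longrightarrow> a < n \<Longrightarrow> U $$ (a, i) = g i a"
    using unitary_completion[of "{..<k}" n g] on k by auto
  have cU: "U \<in> carrier_mat n n" "mat_adjoint U \<in> carrier_mat n n"
    using U mat_adjoint_carrier unfolding unitary_mat_def by auto
  define T where "T = mat_adjoint U * A * U"
  have cT: "T \<in> carrier_mat n n" using cU A by (simp add: T_def)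
  have UT: "A * U = U * T"
  proof -
    have "U * T = (U * mat_adjoint U) * (A * U)" unfolding T_def
      using cU A by (simp add: assoc_mult_mat[of _ n n _ n _ n])
    then show ?thesis using U A cU by (simp add: unitary_mat_def)
  qed
  have hT: "mat_adjoint T = T" unfolding T_def
    using cU A herm by (simp add: adjoint_mult[of _ n n _ n] assoc_mult_mat[of _ n n _ n _ n])
  have T0: "T $$ (i, j) = 0" if "i < n" "j < k" "i \<noteq> j" for i j
  proof -
    have "T $$ (i, j) = (mat_adjoint U * (A * U)) $$ (i, j)" unfolding T_def
      using cU A by (simp add: assoc_mult_mat[of _ n n _ n _ n])
    also have "\<dots> = (\<Sum>a<n. mat_adjoint U $$ (i, a) * (A * U) $$ (a, j))"
      using that k cU A by (subst index_mult_sum[of _ n n _ n]) auto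
    also have "\<dots> = (\<Sum>a<n. \<mu> j * (cnj (U $$ (a, i)) * U $$ (a, j)))"
    proof (intro sum.cong refl)
      fix a assume a: "a \<in> {..<n}"
      have "(A * U) $$ (a, j) = (\<Sum>b<n. A $$ (a, b) * U $$ (b, j))"
        using a that k cU A by (subst index_mult_sum[of _ n n _ n]) auto
      also have "\<dots> = (\<Sum>b<n. A $$ (a, b) * g j b)" using that by (intro sum.cong) (auto simp: Ug)
      also have "\<dots> = \<mu> j * U $$ (a, j)" using ev[of j a] that a by (simp add: Ug)
      finally show "mat_adjoint U $$ (i, a) * (A * U) $$ (a, j) = \<mu> j * (cnj (U $$ (a, i)) * U $$ (a, j))"
        using that a cU by simp
    qed
    also have "\<dots> = 0" using unitary_cols[OF U, of i j] that k by (simp flip: sum_distrib_left)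
    finally show ?thesis .
  qed
  \<comment> \<open>The first \<open>k\<close> columns of \<open>T\<close> vanish off the diagonal
    because they come from eigenvectors; Hermitian symmetry gives the same for the first
    \<open>k\<close> rows.\<close>
  have T0': "T $$ (i, j) = 0" if "i < k" "j < n" "i \<noteq> j" for i j
  proof -
    have "mat_adjoint T $$ (i, j) = cnj (T $$ (j, i))" using cT that k by simp
    then show ?thesis using T0[of j i] that k by (simp add: hT)
  qed
  define D where "D = Matrix.mat (n - k) (n - k) (\<lambda>(i, j). T $$ (i + k, j + k))"
  have cD: "D \<in> carrier_mat (n - k) (n - k)" by (simp add: D_def)
  obtain e c where c: "c \<in> carrier_vec (n - k)" "c \<noteq> 0\<^sub>v (n - k)" "D *\<^sub>v c = e \<cdot>\<^sub>v c"
    using exists_eigenvalue[OF cD] k by auto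
  \<comment> \<open>The eigenvector of the block \<open>D\<close>, padded with \<open>k\<close>
    leading zeros.\<close>
  define c' where "c' i = (if i < k then 0 else c $ (i - k))" for i
  have shift: "(\<Sum>j<n. h j * c' j) = (\<Sum>j<n - k. h (j + k) * c $ j)" for h :: "nat \<Rightarrow> complex"
  proof -
    have "(\<Sum>j<n. h j * c' j) = (\<Sum>j\<in>{k..<n}. h j * c' j)"
      by (intro sum.mono_neutral_right) (auto simp: c'_def)
    also have "\<dots> = (\<Sum>j<n - k. h (j + k) * c $ j)"
      by (rule sum.reindex_bij_witness[of _ "\<lambda>j. j + k" "\<lambda>j. j - k"]) (auto simp: c'_def)
    finally show ?thesis .
  qed
  have Tc: "(\<Sum>j<n. T $$ (i, j) * c' j) = e * c' i" if i: "i < n" for i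
  proof (cases "i < k")
    case True
    have "(\<Sum>j<n. T $$ (i, j) * c' j) = 0"
    proof (intro sum.neutral ballI)
      fix j assume "j \<in> {..<n}"
      then show "T $$ (i, j) * c' j = 0" using T0'[OF True, of j] True by (cases "j < k") (auto simp: c'_def)
    qed
    then show ?thesis using True by (simp add: c'_def)
  next
    case False
    then have ik: "i - k < n - k" using i by simp
    have "(\<Sum>j<n. T $$ (i, j) * c' j) = (\<Sum>j<n - k. T $$ (i, j + k) * c $ j)" by (rule shift)
    also have "\<dots> = (D *\<^sub>v c) $ (i - k)"
      unfolding mult_mat_vec_sum[OF cD c(1) ik] using False ik by (intro sum.cong) (auto simp: D_def)
    also have "\<dots> = e * c' i" unfolding c(3) using c(1) ik False by (simp add: c'_def)
    finally show ?thesis .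
  qed
  define v where "v a = (\<Sum>j<n. U $$ (a, j) * c' j)" for a
  have Av: "(\<Sum>b<n. A $$ (a, b) * v b) = e * v a" if a: "a < n" for a
  proof -
    have "(\<Sum>b<n. A $$ (a, b) * v b) = (\<Sum>j<n. \<Sum>b<n. A $$ (a, b) * U $$ (b, j) * c' j)"
      unfolding v_def sum_distrib_left by (subst sum.swap) (simp add: mult.assoc)
    also have "\<dots> = (\<Sum>j<n. (A * U) $$ (a, j) * c' j)"
      unfolding sum_distrib_right[symmetric] using a by (intro sum.cong refl) (subst index_mult_sum[OF A cU(1)], auto)
    also have "\<dots> = (\<Sum>j<n. \<Sum>i<n. U $$ (a, i) * (T $$ (i, j) * c' j))"
      unfolding UT using a
      by (intro sum.cong refl) (subst index_mult_sum[OF cU(1) cT], auto simp: sum_distrib_right mult.assoc)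
    also have "\<dots> = (\<Sum>i<n. U $$ (a, i) * (\<Sum>j<n. T $$ (i, j) * c' j))"
      unfolding sum_distrib_left by (rule sum.swap)
    also have "\<dots> = (\<Sum>i<n. U $$ (a, i) * (e * c' i))" by (intro sum.cong) (auto simp: Tc)
    finally show ?thesis unfolding v_def sum_distrib_left by (simp add: mult_ac)
  qed
  have cipU: "cip {..<n} (\<lambda>a. U $$ (a, i)) v = c' i" if "i < n" for i
  proof -
    have "cip {..<n} (\<lambda>a. U $$ (a, i)) v = (\<Sum>j<n. (\<Sum>a<n. cnj (U $$ (a, i)) * U $$ (a, j)) * c' j)"
      unfolding cip_def v_def sum_distrib_left sum_distrib_right by (subst sum.swap) (simp add: mult.assoc)
    also have "\<dots> = (\<Sum>j<n. if j = i then c' j else 0)"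
      using that by (intro sum.cong) (auto simp: unitary_cols[OF U])
    finally show ?thesis using that by simp
  qed
  have orth: "cip {..<n} (g i) v = 0" if "i < k" for i
  proof -
    have "cip {..<n} (g i) v = cip {..<n} (\<lambda>a. U $$ (a, i)) v"
      unfolding cip_def using that by (intro sum.cong) (auto simp: Ug)
    then show ?thesis using cipU[of i] that k by (simp add: c'_def)
  qed
  define N where "N = (\<Sum>a<n. (norm (v a))\<^sup>2)"
  \<comment> \<open>The coefficients of \<open>v\<close> against the columns of \<open>U\<close> are
    those of \<open>c'\<close>, so \<open>v = 0\<close> would force \<open>c = 0\<close>.\<close>
  have "N \<noteq> 0"
  proof
    assume "N = 0"
    then have "\<forall>a<n. v a = 0" unfolding N_def by (subst (asm) sum_nonneg_eq_0_iff) auto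
    then have "cip {..<n} (\<lambda>a. U $$ (a, i)) v = 0" for i unfolding cip_def by simp
    then have "c' i = 0" if "i < n" for i using cipU[OF that] by simp
    then have "c $ i = 0" if "i < n - k" for i using that spec[of "\<lambda>i. i < n \<longrightarrow> c' i = 0" "i + k"] by (auto simp: c'_def)
    then have "c = 0\<^sub>v (n - k)" using c(1) by (intro eq_vecI) auto
    then show False using c(2) by simp
  qed
  moreover have "0 \<le> N" unfolding N_def by (rule sum_nonneg) auto
  ultimately have N: "0 < N" by simp
  define h where "h a = of_real (1 / sqrt N) * v a" for a
  have "cip {..<n} h h = of_real (\<Sum>a<n. (norm (h a))\<^sup>2)" by (rule cip_self)
  also have "(\<Sum>a<n. (norm (h a))\<^sup>2) = (\<Sum>a<n. 1 / N * (norm (v a))\<^sup>2)"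
    unfolding h_def using N by (simp add: norm_mult norm_divide power_mult_distrib power_divide)
  also have "\<dots> = 1 / N * N" by (simp only: sum_distrib_left[symmetric] N_def)
  finally have "cip {..<n} h h = 1" using N by simp
  moreover have "\<forall>i<k. cip {..<n} (g i) h = 0" unfolding h_def cip_scale using orth by simp
  moreover have "\<forall>a<n. (\<Sum>b<n. A $$ (a, b) * h b) = e * h a"
  proof (intro allI impI)
    fix a assume "a < n"
    have "(\<Sum>b<n. A $$ (a, b) * h b) = of_real (1 / sqrt N) * (\<Sum>b<n. A $$ (a, b) * v b)"
      unfolding h_def sum_distrib_left by (simp add: mult_ac)
    then show "(\<Sum>b<n. A $$ (a, b) * h b) = e * h a" using Av[OF \<open>a < n\<close>] by (simp add: h_def)
  qed
  ultimately show ?thesis by blast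
qed

lemma hermitian_eigenbasis:
  assumes A: "A \<in> carrier_mat n n" and herm: "mat_adjoint A = A" and "k \<le> n"
  shows "\<exists>g \<mu>. orthonormal_on {..<n} {..<k} g \<and> (\<forall>i<k. \<forall>a<n. (\<Sum>b<n. A $$ (a, b) * g i b) = \<mu> i * g i a)"
  using \<open>k \<le> n\<close>
proof (induction k)
  case 0
  then show ?case by (simp add: orthonormal_on_def)
next
  case (Suc k)
  then obtain g \<mu> where g: "orthonormal_on {..<n} {..<k} g"
    "\<forall>i<k. \<forall>a<n. (\<Sum>b<n. A $$ (a, b) * g i b) = \<mu> i * g i a" by auto
  have "k < n" using Suc.prems by simp
  have "\<exists>v e. cip {..<n} v v = 1 \<and> (\<forall>i<k. cip {..<n} (g i) v = 0) \<and> (\<forall>a<n. (\<Sum>b<n. A $$ (a, b) * v b) = e * v a)"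
    by (rule hermitian_extend_eigenvectors[OF A herm \<open>k < n\<close> g(1), of \<mu>]) (use g(2) in blast)
  then obtain v e where v: "cip {..<n} v v = 1" "\<forall>i<k. cip {..<n} (g i) v = 0"
    "\<forall>a<n. (\<Sum>b<n. A $$ (a, b) * v b) = e * v a" by blast
  have v': "cip {..<n} v (g i) = 0" if "i < k" for i
    using v(2) that cip_cnj[of "{..<n}" "g i" v] by auto
  have "orthonormal_on {..<n} {..<Suc k} (g(k := v))"
    using g(1) v v' unfolding orthonormal_on_def by (auto simp: less_Suc_eq)
  moreover have "\<forall>i<Suc k. \<forall>a<n. (\<Sum>b<n. A $$ (a, b) * (g(k := v)) i b) = (\<mu>(k := e)) i * (g(k := v)) i a"
    using g(2) v(3) by (auto simp: less_Suc_eq)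
  ultimately show ?case by blast
qed

lemma spectral_decomp_unitary: "spectral_decomp n A U d \<Longrightarrow> unitary_mat n U"
  by (simp add: spectral_decomp_def unitary_mat_def)

theorem spectral_theorem:
  assumes A: "A \<in> carrier_mat n n" and herm: "mat_adjoint A = A"
  shows "\<exists>U d. spectral_decomp n A U d"
proof -
  obtain g \<mu> where g: "orthonormal_on {..<n} {..<n} g"
    and ev: "\<forall>i<n. \<forall>a<n. (\<Sum>b<n. A $$ (a, b) * g i b) = \<mu> i * g i a"
    using hermitian_eigenbasis[OF A herm order_refl] by blast
  obtain U where U: "unitary_mat n U" and Ug: "\<And>i a. i < n \<Longrightarrow> a < n \<Longrightarrow> U $$ (a, i) = g i a"
    using unitary_completion[of "{..<n}" n g] g by auto
  have cU: "U \<in> carrier_mat n n" "mat_adjoint U \<in> carrier_mat n n"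
    and UU: "mat_adjoint U * U = 1\<^sub>m n" "U * mat_adjoint U = 1\<^sub>m n"
    using U mat_adjoint_carrier unfolding unitary_mat_def by auto
  have AU: "A * U = U * mat_diag n \<mu>"
  proof (rule eq_matI)
    fix a i assume "a < dim_row (U * mat_diag n \<mu>)" "i < dim_col (U * mat_diag n \<mu>)"
    then have ai: "a < n" "i < n" using cU by (auto simp: mat_diag_def)
    have "(A * U) $$ (a, i) = (\<Sum>b<n. A $$ (a, b) * U $$ (b, i))" by (rule index_mult_sum[OF A cU(1) ai])
    also have "\<dots> = (\<Sum>b<n. A $$ (a, b) * g i b)" using ai by (intro sum.cong) (auto simp: Ug)
    also have "\<dots> = \<mu> i * U $$ (a, i)" using ev ai by (simp add: Ug)
    finally show "(A * U) $$ (a, i) = (U * mat_diag n \<mu>) $$ (a, i)"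
      unfolding mat_diag_mult_right[OF cU(1)] using ai by simp
  qed (use A cU in \<open>auto simp: mat_diag_def\<close>)
  have D: "mat_adjoint U * A * U = mat_diag n \<mu>"
  proof -
    have "mat_adjoint U * A * U = mat_adjoint U * (A * U)" using cU A by (simp add: assoc_mult_mat[of _ n n _ n _ n])
    also have "\<dots> = mat_adjoint U * U * mat_diag n \<mu>" unfolding AU using cU by (simp add: assoc_mult_mat[of _ n n _ n _ n])
    finally show ?thesis using UU by (simp add: left_mult_one_mat[OF mat_diag_dim])
  qed
  \<comment> \<open>The diagonal matrix \<open>U* A U\<close> is Hermitian like \<open>A\<close>, so
    its diagonal entries are real.\<close>
  have real: "\<mu> i = of_real (Re (\<mu> i))" if i: "i < n" for i
  proof -
    have "mat_adjoint (mat_diag n \<mu>) = mat_diag n \<mu>" unfolding D[symmetric]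
      using cU A herm by (simp add: adjoint_mult[of _ n n _ n] assoc_mult_mat[of _ n n _ n _ n])
    then have "mat_adjoint (mat_diag n \<mu>) $$ (i, i) = mat_diag n \<mu> $$ (i, i)" by simp
    then have "cnj (\<mu> i) = \<mu> i" using i by (simp add: mat_diag_def)
    then show ?thesis by (simp add: complex_eq_iff)
  qed
  have Dr: "mat_diag n \<mu> = mat_diag n (\<lambda>i. of_real (Re (\<mu> i)))"
    using real by (intro eq_matI) (auto simp: mat_diag_def)
  have "A = A * (U * mat_adjoint U)" using UU A by simp
  also have "\<dots> = A * U * mat_adjoint U" using A cU by (simp add: assoc_mult_mat[of _ n n _ n _ n])
  finally have eq: "A = U * mat_diag n (\<lambda>i. of_real (Re (\<mu> i))) * mat_adjoint U" unfolding AU Dr .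
  have "spectral_decomp n A U (\<lambda>i. Re (\<mu> i))"
    unfolding spectral_decomp_def by (intro conjI cU(1) UU eq)
  then show ?thesis by (intro exI)
qed

lemma spectral_decomp_conjugate:
  assumes "spectral_decomp n A U d"
  shows "mat_adjoint U * A * U = mat_diag n (\<lambda>i. complex_of_real (d i))"
proof -
  have U: "U \<in> carrier_mat n n" "mat_adjoint U \<in> carrier_mat n n" "mat_adjoint U * U = 1\<^sub>m n"
    and A: "A = U * mat_diag n (\<lambda>i. complex_of_real (d i)) * mat_adjoint U"
    using assms mat_adjoint_carrier unfolding spectral_decomp_def by auto
  let ?D = "mat_diag n (\<lambda>i. complex_of_real (d i))"
  have "mat_adjoint U * A * U = (mat_adjoint U * U) * ?D * (mat_adjoint U * U)"
    unfolding A using U(1,2) mat_diag_dim[of n]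
    by (simp add: assoc_mult_mat[of _ n n _ n _ n] mult_carrier_mat[of _ n n _ n])
  then show ?thesis using U by (simp add: left_mult_one_mat[OF mat_diag_dim] right_mult_one_mat[OF mat_diag_dim])
qed

lemma conjugate_index:
  assumes P: "P \<in> carrier_mat nr n" and X: "X \<in> carrier_mat n k" and Q: "Q \<in> carrier_mat k nc"
    and ij: "i < nr" "j < nc"
  shows "(P * X * Q) $$ (i, j) = (\<Sum>a<n. \<Sum>b<k. P $$ (i, a) * X $$ (a, b) * Q $$ (b, j))"
proof -
  have "(P * X * Q) $$ (i, j) = (\<Sum>b<k. (\<Sum>a<n. P $$ (i, a) * X $$ (a, b)) * Q $$ (b, j))"
    using index_mult_sum[OF mult_carrier_mat[OF P X] Q ij] index_mult_sum[OF P X ij(1)] by simp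
  also have "\<dots> = (\<Sum>a<n. \<Sum>b<k. P $$ (i, a) * X $$ (a, b) * Q $$ (b, j))"
    unfolding sum_distrib_right by (rule sum.swap)
  finally show ?thesis .
qed

text \<open>\<open>d i\<close> is the value of the quadratic form at column \<open>i\<close> of
  \<open>U\<close>.\<close>

lemma psd_eigenvalue_nonneg:
  assumes psd: "psd_mat n A" and sd: "spectral_decomp n A U d" and i: "i < n"
  shows "0 \<le> d i"
proof -
  have U: "U \<in> carrier_mat n n" and A: "A \<in> carrier_mat n n"
    using psd sd unfolding psd_mat_def spectral_decomp_def by auto
  have v: "col U i \<in> carrier_vec n" using U i by auto
  have "(A *\<^sub>v col U i) \<bullet>c col U i = (\<Sum>a<n. \<Sum>b<n. mat_adjoint U $$ (i, a) * A $$ (a, b) * U $$ (b, i))"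
    using A U i
    by (simp add: scalar_prod_def atLeast0LessThan sum_distrib_right sum_distrib_left mult_ac)
  also have "\<dots> = (mat_adjoint U * A * U) $$ (i, i)"
    by (rule conjugate_index[OF mat_adjoint_carrier[OF U] A U i i, symmetric])
  also have "\<dots> = of_real (d i)" unfolding spectral_decomp_conjugate[OF sd] using i by (simp add: mat_diag_def)
  finally have eq: "(A *\<^sub>v col U i) \<bullet>c col U i = of_real (d i)" .
  have "0 \<le> Re ((A *\<^sub>v col U i) \<bullet>c col U i)" using psd v unfolding psd_mat_def by simp
  then show ?thesis unfolding eq by simp
qed

lemma psd_spectral:
  assumes "psd_mat n A"
  shows "\<exists>U d. spectral_decomp n A U d \<and> (\<forall>i<n. 0 \<le> d i)"
proof -
  have "A \<in> carrier_mat n n" "mat_adjoint A = A" using assms by (simp_all add: psd_mat_def)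
  from spectral_theorem[OF this] obtain U d where "spectral_decomp n A U d" by (elim exE)
  then show ?thesis using psd_eigenvalue_nonneg[OF assms] by (intro exI[of _ U] exI[of _ d]) simp
qed

section \<open>Schatten norms\<close>

text \<open>Since functional calculus is independent of the diagonalization, the description in
  \<open>mat_powr\<close> can be evaluated with any convenient one.\<close>

lemma mat_powr_spectral:
  assumes sd: "spectral_decomp n A U d" and d: "\<forall>i<n. 0 \<le> d i" and A: "A \<in> carrier_mat n n"
  shows "mat_powr A r = U * mat_diag n (\<lambda>i. complex_of_real (d i powr r)) * mat_adjoint U"
proof -
  have n: "dim_row A = n" using A by simp
  show ?thesis unfolding mat_powr_def n
  proof (rule the_equality)
    show "\<exists>V e. spectral_decomp n A V e \<and> (\<forall>i<n. 0 \<le> e i) \<and>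
        U * mat_diag n (\<lambda>i. complex_of_real (d i powr r)) * mat_adjoint U
        = V * mat_diag n (\<lambda>i. complex_of_real (e i powr r)) * mat_adjoint V"
      by (intro exI[of _ U] exI[of _ d] conjI sd d refl)
  next
    fix B assume "\<exists>V e. spectral_decomp n A V e \<and> (\<forall>i<n. 0 \<le> e i) \<and>
        B = V * mat_diag n (\<lambda>i. complex_of_real (e i powr r)) * mat_adjoint V"
    then obtain V e where V: "spectral_decomp n A V e"
      and B: "B = V * mat_diag n (\<lambda>i. complex_of_real (e i powr r)) * mat_adjoint V" by (elim exE conjE)
    show "B = U * mat_diag n (\<lambda>i. complex_of_real (d i powr r)) * mat_adjoint U"
      unfolding B by (rule spectral_decomp_fun_unique[OF V sd, of "\<lambda>x. x powr r"])
  qed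
qed

lemma spectral_decomp_map:
  assumes "spectral_decomp n A U d"
  shows "spectral_decomp n (U * mat_diag n (\<lambda>i. complex_of_real (e i)) * mat_adjoint U) U e"
  using assms by (simp add: spectral_decomp_def)

lemma mat_trace_conjugate_diag:
  assumes U: "unitary_mat n U"
  shows "mat_trace (U * mat_diag n (\<lambda>i. complex_of_real (e i)) * mat_adjoint U) = of_real (\<Sum>i<n. e i)"
proof -
  let ?D = "mat_diag n (\<lambda>i. complex_of_real (e i))"
  have cU: "U \<in> carrier_mat n n" "mat_adjoint U \<in> carrier_mat n n" and UU: "mat_adjoint U * U = 1\<^sub>m n"
    using U mat_adjoint_carrier unfolding unitary_mat_def by auto
  have "mat_trace (U * ?D * mat_adjoint U) = mat_trace (mat_adjoint U * (U * ?D))"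
    by (rule mat_trace_comm[OF mult_carrier_mat[OF cU(1) mat_diag_dim] cU(2)])
  also have "mat_adjoint U * (U * ?D) = mat_adjoint U * U * ?D"
    by (rule assoc_mult_mat[OF cU(2) cU(1) mat_diag_dim, symmetric])
  also have "\<dots> = ?D" unfolding UU by (rule left_mult_one_mat[OF mat_diag_dim])
  finally show ?thesis by (simp add: mat_trace_def mat_diag_def)
qed

lemma adjoint_mult_psd:
  assumes A: "A \<in> carrier_mat n n"
  shows "psd_mat n (mat_adjoint A * A)"
proof -
  have cA: "mat_adjoint A \<in> carrier_mat n n" by (rule mat_adjoint_carrier[OF A])
  have "0 \<le> Re ((mat_adjoint A * A *\<^sub>v v) \<bullet>c v)" if v: "v \<in> carrier_vec n" for v
  proof -
    have Av: "(A *\<^sub>v v) $ b = (\<Sum>c<n. A $$ (b, c) * v $ c)" if "b < n" for b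
      by (rule mult_mat_vec_sum[OF A v that])
    have "(mat_adjoint A * A *\<^sub>v v) \<bullet>c v = (\<Sum>a<n. (mat_adjoint A * A *\<^sub>v v) $ a * cnj (v $ a))"
      using A v by (simp add: scalar_prod_def atLeast0LessThan)
    also have "\<dots> = (\<Sum>a<n. \<Sum>b<n. cnj (A $$ (b, a)) * (A *\<^sub>v v) $ b * cnj (v $ a))"
    proof (intro sum.cong refl)
      fix a assume a: "a \<in> {..<n}"
      have "(mat_adjoint A * A *\<^sub>v v) $ a = (mat_adjoint A *\<^sub>v (A *\<^sub>v v)) $ a"
        using assoc_mult_mat_vec[OF cA A v] by simp
      also have "\<dots> = (\<Sum>b<n. mat_adjoint A $$ (a, b) * (A *\<^sub>v v) $ b)"
        using a A v by (intro mult_mat_vec_sum[OF cA]) auto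
      also have "\<dots> = (\<Sum>b<n. cnj (A $$ (b, a)) * (A *\<^sub>v v) $ b)"
        using a A by (intro sum.cong) auto
      finally show "(mat_adjoint A * A *\<^sub>v v) $ a * cnj (v $ a) = (\<Sum>b<n. cnj (A $$ (b, a)) * (A *\<^sub>v v) $ b * cnj (v $ a))"
        by (simp add: sum_distrib_right)
    qed
    also have "\<dots> = (\<Sum>b<n. (A *\<^sub>v v) $ b * (\<Sum>a<n. cnj (A $$ (b, a)) * cnj (v $ a)))"
      unfolding sum_distrib_left by (subst sum.swap) (simp add: mult_ac)
    also have "\<dots> = (\<Sum>b<n. (A *\<^sub>v v) $ b * cnj ((A *\<^sub>v v) $ b))"
      by (intro sum.cong refl) (simp add: Av cnj_sum del: index_mult_mat_vec)
    also have "\<dots> = of_real (\<Sum>b<n. (norm ((A *\<^sub>v v) $ b))\<^sup>2)"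
      unfolding of_real_sum complex_norm_square ..
    finally show ?thesis by (simp add: sum_nonneg)
  qed
  moreover have "mat_adjoint (mat_adjoint A * A) = mat_adjoint A * A"
    by (simp add: adjoint_mult[OF cA A])
  ultimately show ?thesis unfolding psd_mat_def using mult_carrier_mat[OF cA A] by blast
qed

text \<open>The numbers \<open>d i\<close> are squared singular values of \<open>A\<close>, hence
  the exponent \<open>p / 2\<close>.\<close>

lemma schatten_norm_spectral:
  assumes A: "A \<in> carrier_mat n n" and sd: "spectral_decomp n (mat_adjoint A * A) U d"
    and d: "\<forall>i<n. 0 \<le> d i"
  shows "schatten_norm (ereal p) A = (\<Sum>i<n. d i powr (p / 2)) powr (1 / p)"
proof -
  have c: "mat_adjoint A * A \<in> carrier_mat n n" using mult_carrier_mat[OF mat_adjoint_carrier[OF A] A] .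
  have cU: "U \<in> carrier_mat n n" "mat_adjoint U \<in> carrier_mat n n"
    using sd mat_adjoint_carrier unfolding spectral_decomp_def by auto
  have abs: "mat_abs A = U * mat_diag n (\<lambda>i. complex_of_real (d i powr (1 / 2))) * mat_adjoint U"
    unfolding mat_abs_def by (rule mat_powr_spectral[OF sd d c])
  have cabs: "mat_abs A \<in> carrier_mat n n" unfolding abs
    by (intro mult_carrier_mat[OF _ cU(2)] mult_carrier_mat[OF cU(1)]) simp
  have "mat_powr (mat_abs A) p = U * mat_diag n (\<lambda>i. complex_of_real ((d i powr (1 / 2)) powr p)) * mat_adjoint U"
    by (rule mat_powr_spectral[OF _ _ cabs]) (simp_all add: abs spectral_decomp_map[OF sd])
  then have "mat_trace (mat_powr (mat_abs A) p) = of_real (\<Sum>i<n. (d i powr (1 / 2)) powr p)"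
    using mat_trace_conjugate_diag[OF spectral_decomp_unitary[OF sd]] by simp
  then show ?thesis unfolding schatten_norm_def by (simp add: powr_powr)
qed

lemma schatten_norm_psd:
  assumes psd: "psd_mat n A" and sd: "spectral_decomp n A U d"
  shows "schatten_norm (ereal p) A = (\<Sum>i<n. d i powr p) powr (1 / p)"
proof -
  have A: "A \<in> carrier_mat n n" and h: "mat_adjoint A = A" using psd by (auto simp: psd_mat_def)
  have d: "0 \<le> d i" if "i < n" for i using psd_eigenvalue_nonneg[OF psd sd that] .
  let ?D = "mat_diag n (\<lambda>i. complex_of_real (d i))"
  have cU: "U \<in> carrier_mat n n" "mat_adjoint U \<in> carrier_mat n n" and UU: "mat_adjoint U * U = 1\<^sub>m n"
    and AU: "A = U * ?D * mat_adjoint U"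
    using sd mat_adjoint_carrier unfolding spectral_decomp_def by auto
  have cD: "?D \<in> carrier_mat n n" by simp
  have "A * A = U * (?D * (mat_adjoint U * U) * ?D) * mat_adjoint U"
    unfolding AU using cU cD by (simp add: assoc_mult_mat[of _ n n _ n _ n] mult_carrier_mat[of _ n n _ n] del: mat_diag_diag)
  also have "?D * (mat_adjoint U * U) * ?D = mat_diag n (\<lambda>i. complex_of_real ((d i)\<^sup>2))"
    unfolding UU right_mult_one_mat[OF cD] by (simp add: power2_eq_square)
  finally have "mat_adjoint A * A = U * mat_diag n (\<lambda>i. complex_of_real ((d i)\<^sup>2)) * mat_adjoint U" unfolding h .
  then have "spectral_decomp n (mat_adjoint A * A) U (\<lambda>i. (d i)\<^sup>2)"
    using spectral_decomp_map[OF sd, of "\<lambda>i. (d i)\<^sup>2"] by simp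
  then have "schatten_norm (ereal p) A = (\<Sum>i<n. ((d i)\<^sup>2) powr (p / 2)) powr (1 / p)"
    by (rule schatten_norm_spectral[OF A]) simp
  also have "(\<Sum>i<n. ((d i)\<^sup>2) powr (p / 2)) = (\<Sum>i<n. d i powr p)"
  proof (intro sum.cong refl)
    fix i assume "i \<in> {..<n}"
    then have di: "0 \<le> d i" using d by simp
    then have "(d i)\<^sup>2 = d i powr 2" by (cases "d i = 0") (auto simp: powr_numeral)
    then show "((d i)\<^sup>2) powr (p / 2) = d i powr p" by (simp add: powr_powr)
  qed
  finally show ?thesis .
qed

text \<open>A form of the polar decomposition. In an eigenbasis \<open>Q\<close> of
  \<open>B* B\<close> the columns of \<open>B Q\<close> are orthogonal with lengths
  \<open>sqrt (d i)\<close>; a unitary \<open>G\<close> containing their normalizations gives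
  diagonal entries \<open>sqrt (d i)\<close> in \<open>G* B Q\<close>, and cyclicity of the trace
  gives \<open>W = Q G*\<close>.\<close>

lemma schatten_one_unitary:
  assumes B: "B \<in> carrier_mat n n"
  shows "\<exists>W. unitary_mat n W \<and> schatten_norm 1 B = Re (mat_trace (W * B))"
proof -
  from psd_spectral[OF adjoint_mult_psd[OF B]] obtain Q d
    where sd: "spectral_decomp n (mat_adjoint B * B) Q d" and d: "\<forall>i<n. 0 \<le> d i" by (elim exE conjE)
  have Q: "unitary_mat n Q" by (rule spectral_decomp_unitary[OF sd])
  have cQ: "Q \<in> carrier_mat n n" "mat_adjoint Q \<in> carrier_mat n n"
    using Q mat_adjoint_carrier unfolding unitary_mat_def by auto
  have cB: "mat_adjoint B \<in> carrier_mat n n" by (rule mat_adjoint_carrier[OF B])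
  define Z where "Z = B * Q"
  have Z: "Z \<in> carrier_mat n n" unfolding Z_def by (rule mult_carrier_mat[OF B cQ(1)])
  have ZZ: "mat_adjoint Z * Z = mat_diag n (\<lambda>i. complex_of_real (d i))"
    unfolding spectral_decomp_conjugate[OF sd, symmetric] Z_def adjoint_mult[OF B cQ(1)]
    using B cB cQ by (simp add: assoc_mult_mat[of _ n n _ n _ n] mult_carrier_mat[of _ n n _ n])
  have cols: "(\<Sum>a<n. cnj (Z $$ (a, i)) * Z $$ (a, j)) = (if i = j then of_real (d i) else 0)" if "i < n" "j < n" for i j
  proof -
    have "(mat_adjoint Z * Z) $$ (i, j) = (\<Sum>a<n. cnj (Z $$ (a, i)) * Z $$ (a, j))"
      unfolding index_mult_sum[OF mat_adjoint_carrier[OF Z] Z that] using that Z by (intro sum.cong) auto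
    then show ?thesis unfolding ZZ using that by (auto simp: mat_diag_def)
  qed
  \<comment> \<open>Only nonzero columns of \<open>Z\<close> can be normalized;
    \<open>unitary_completion\<close> supplies the other columns of \<open>G\<close>.\<close>
  define I where "I = {i. i < n \<and> 0 < d i}"
  define f where "f i a = of_real (1 / sqrt (d i)) * Z $$ (a, i)" for i a
  have "orthonormal_on {..<n} I f"
    unfolding orthonormal_on_def
  proof (intro ballI)
    fix i j assume ij: "i \<in> I" "j \<in> I"
    have "cip {..<n} (f i) (f j) = of_real (1 / sqrt (d i)) * of_real (1 / sqrt (d j)) * (\<Sum>a<n. cnj (Z $$ (a, i)) * Z $$ (a, j))"
      unfolding cip_def f_def sum_distrib_left by (intro sum.cong) auto
    also have "\<dots> = (if i = j then 1 else 0)"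
      using cols[of i j] ij by (auto simp: I_def simp flip: of_real_mult)
    finally show "cip {..<n} (f i) (f j) = (if i = j then 1 else 0)" .
  qed
  moreover have "I \<subseteq> {..<n}" by (auto simp: I_def)
  ultimately obtain G where G: "unitary_mat n G" and Gf: "\<forall>i\<in>I. \<forall>a<n. G $$ (a, i) = f i a"
    using unitary_completion by metis
  have cG: "G \<in> carrier_mat n n" "mat_adjoint G \<in> carrier_mat n n"
    using G mat_adjoint_carrier unfolding unitary_mat_def by auto
  have diag: "(mat_adjoint G * Z) $$ (i, i) = of_real (sqrt (d i))" if i: "i < n" for i
  proof -
    have e: "(mat_adjoint G * Z) $$ (i, i) = (\<Sum>a<n. cnj (G $$ (a, i)) * Z $$ (a, i))"
      unfolding index_mult_sum[OF cG(2) Z i i] using i cG by (intro sum.cong) auto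
    show ?thesis
    proof (cases "i \<in> I")
      case True
      then have di: "0 < d i" by (simp add: I_def)
      have "Z $$ (a, i) = of_real (sqrt (d i)) * G $$ (a, i)" if "a < n" for a
        using Gf True that di by (simp add: f_def)
      then have "(\<Sum>a<n. cnj (G $$ (a, i)) * Z $$ (a, i)) = of_real (sqrt (d i)) * (\<Sum>a<n. cnj (G $$ (a, i)) * G $$ (a, i))"
        unfolding sum_distrib_left by (intro sum.cong) auto
      then show ?thesis unfolding e using unitary_cols[OF G i i] by simp
    next
      \<comment> \<open>Column \<open>i\<close> of \<open>Z\<close> is zero, so the diagonal entry
        vanishes whichever column was supplied for \<open>G\<close>.\<close>
      case False
      then have d0: "d i = 0" using i d by (auto simp: I_def)
      have "of_real (\<Sum>a<n. (norm (Z $$ (a, i)))\<^sup>2) = (0 :: complex)"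
        using cols[OF i i] d0 by (simp add: complex_norm_square mult.commute del: of_real_power)
      then have "(\<Sum>a<n. (norm (Z $$ (a, i)))\<^sup>2) = 0" using of_real_eq_0_iff by blast
      then have "\<forall>a<n. Z $$ (a, i) = 0" by (subst (asm) sum_nonneg_eq_0_iff) auto
      then show ?thesis unfolding e using d0 by simp
    qed
  qed
  define W where "W = Q * mat_adjoint G"
  have W: "unitary_mat n W" unfolding W_def by (rule unitary_mult[OF Q unitary_adjoint[OF G]])
  have "mat_trace (W * B) = mat_trace (Q * (mat_adjoint G * B))"
    unfolding W_def using assoc_mult_mat[OF cQ(1) cG(2) B] by simp
  also have "\<dots> = mat_trace (mat_adjoint G * B * Q)"
    by (rule mat_trace_comm[OF cQ(1) mult_carrier_mat[OF cG(2) B]])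
  also have "mat_adjoint G * B * Q = mat_adjoint G * Z" unfolding Z_def by (rule assoc_mult_mat[OF cG(2) B cQ(1)])
  also have "mat_trace (mat_adjoint G * Z) = of_real (\<Sum>i<n. sqrt (d i))"
    unfolding mat_trace_def using cG Z diag by (simp del: index_mult_mat(1))
  finally have tr: "Re (mat_trace (W * B)) = (\<Sum>i<n. sqrt (d i))" by simp
  have "schatten_norm 1 B = (\<Sum>i<n. d i powr (1 / 2)) powr 1"
    using schatten_norm_spectral[OF B sd d, of 1] by (simp add: one_ereal_def)
  also have "\<dots> = \<bar>\<Sum>i<n. sqrt (d i)\<bar>" using d by (simp add: powr_half_sqrt)
  also have "\<dots> = (\<Sum>i<n. sqrt (d i))" using d by (intro abs_of_nonneg sum_nonneg) auto
  finally show ?thesis using W tr by auto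
qed

section \<open>The operator norm\<close>

lemma eucl_norm_alt: "v \<in> carrier_vec n \<Longrightarrow> eucl_norm v = sqrt (\<Sum>a<n. (norm (v $ a))\<^sup>2)"
proof -
  assume v: "v \<in> carrier_vec n"
  have "v \<bullet>c v = of_real (\<Sum>a<n. (norm (v $ a))\<^sup>2)"
    unfolding of_real_sum complex_norm_square using v by (simp add: scalar_prod_def atLeast0LessThan)
  then show ?thesis by (simp add: eucl_norm_def)
qed

text \<open>A supremum of reals dominates its set only if the set is bounded; here the
  Hilbert-Schmidt norm \<open>sqrt K\<close> is a bound.\<close>

lemma eucl_norm_le_op_norm:
  assumes A: "A \<in> carrier_mat n n" and v: "v \<in> carrier_vec n" "eucl_norm v \<le> 1"
  shows "eucl_norm (A *\<^sub>v v) \<le> op_norm A"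
proof -
  define K where "K = (\<Sum>a<n. \<Sum>b<n. (norm (A $$ (a, b)))\<^sup>2)"
  have bound: "eucl_norm (A *\<^sub>v w) \<le> sqrt K" if w: "w \<in> carrier_vec n" "eucl_norm w \<le> 1" for w
  proof -
    have w1: "(\<Sum>b<n. (norm (w $ b))\<^sup>2) \<le> 1" using w(2) unfolding eucl_norm_alt[OF w(1)] by simp
    have "(norm ((A *\<^sub>v w) $ a))\<^sup>2 \<le> (\<Sum>b<n. (norm (A $$ (a, b)))\<^sup>2)" if a: "a < n" for a
    proof -
      have "(A *\<^sub>v w) $ a = cip {..<n} (\<lambda>b. cnj (A $$ (a, b))) (\<lambda>b. w $ b)"
        unfolding mult_mat_vec_sum[OF A w(1) a] cip_def by simp
      then have "(norm ((A *\<^sub>v w) $ a))\<^sup>2 \<le> (\<Sum>b<n. (norm (A $$ (a, b)))\<^sup>2) * (\<Sum>b<n. (norm (w $ b))\<^sup>2)"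
        using cip_cauchy_schwarz[of "{..<n}" "\<lambda>b. cnj (A $$ (a, b))" "\<lambda>b. w $ b"] by simp
      also have "\<dots> \<le> (\<Sum>b<n. (norm (A $$ (a, b)))\<^sup>2) * 1" using w1 by (intro mult_left_mono sum_nonneg) auto
      finally show ?thesis by simp
    qed
    then have "(\<Sum>a<n. (norm ((A *\<^sub>v w) $ a))\<^sup>2) \<le> K" unfolding K_def by (intro sum_mono) auto
    moreover have "A *\<^sub>v w \<in> carrier_vec n" by (rule mult_mat_vec_carrier[OF A w(1)])
    ultimately show ?thesis by (simp add: eucl_norm_alt del: index_mult_mat_vec)
  qed
  have "bdd_above {eucl_norm (A *\<^sub>v w) | w. w \<in> carrier_vec (dim_col A) \<and> eucl_norm w \<le> 1}"
    using bound A by (intro bdd_aboveI[of _ "sqrt K"]) auto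
  then show ?thesis unfolding op_norm_def using A v by (intro cSup_upper) auto
qed

lemma eigenvalue_le_op_norm:
  assumes sd: "spectral_decomp n A U d" and A: "A \<in> carrier_mat n n" and i: "i < n"
  shows "d i \<le> op_norm A"
proof -
  have U: "unitary_mat n U" by (rule spectral_decomp_unitary[OF sd])
  have cU: "U \<in> carrier_mat n n" "mat_adjoint U \<in> carrier_mat n n" and UU: "U * mat_adjoint U = 1\<^sub>m n"
    using U mat_adjoint_carrier unfolding unitary_mat_def by auto
  define v where "v = col U i"
  have v: "v \<in> carrier_vec n" using cU i by (auto simp: v_def)
  have nv: "(\<Sum>a<n. (norm (v $ a))\<^sup>2) = 1" using unitary_col_norm[OF U i] cU i by (simp add: v_def)
  have "A * U = U * (mat_adjoint U * A * U)"
  proof -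
    have "U * (mat_adjoint U * A * U) = (U * mat_adjoint U) * (A * U)"
      using cU A by (simp add: assoc_mult_mat[of _ n n _ n _ n] mult_carrier_mat[of _ n n _ n])
    then show ?thesis using UU left_mult_one_mat[OF mult_carrier_mat[OF A cU(1)]] by simp
  qed
  then have AU: "A * U = U * mat_diag n (\<lambda>i. complex_of_real (d i))" unfolding spectral_decomp_conjugate[OF sd] .
  have Av: "(A *\<^sub>v v) $ a = of_real (d i) * v $ a" if a: "a < n" for a
  proof -
    have "(A *\<^sub>v v) $ a = (A * U) $$ (a, i)" using A cU i a by (simp add: v_def)
    then show ?thesis unfolding AU mat_diag_mult_right[OF cU(1)] using a i cU by (simp add: v_def)
  qed
  have "eucl_norm (A *\<^sub>v v) = sqrt (\<Sum>a<n. (norm ((A *\<^sub>v v) $ a))\<^sup>2)"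
    by (rule eucl_norm_alt[OF mult_mat_vec_carrier[OF A v]])
  also have "(\<Sum>a<n. (norm ((A *\<^sub>v v) $ a))\<^sup>2) = (\<Sum>a<n. (d i)\<^sup>2 * (norm (v $ a))\<^sup>2)"
    by (intro sum.cong refl) (simp add: Av norm_mult power_mult_distrib del: index_mult_mat_vec)
  also have "\<dots> = (d i)\<^sup>2" using nv by (simp flip: sum_distrib_left)
  finally have "\<bar>d i\<bar> = eucl_norm (A *\<^sub>v v)" by simp
  also have "\<dots> \<le> op_norm A"
    using nv by (intro eucl_norm_le_op_norm[OF A v]) (simp add: eucl_norm_alt[OF v])
  finally show ?thesis by simp
qed

section \<open>Sums of positive semidefinite matrices\<close>

lemma finsum_mat:
  assumes "finite K" and X: "\<And>k. k \<in> K \<Longrightarrow> X k \<in> carrier_mat n n"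
  shows "finsum (module_mat TYPE(complex) n n) X K = Matrix.mat n n (\<lambda>(i, j). \<Sum>k\<in>K. X k $$ (i, j))"
proof -
  interpret M: abelian_monoid "module_mat TYPE(complex) n n"
    by (rule abelian_group.axioms(1)) (rule abelian_group_mat)
  show ?thesis using assms
  proof (induction K rule: finite_induct)
    case empty
    then show ?case by (simp add: module_mat_simps) (auto intro!: eq_matI)
  next
    case (insert k K)
    have "finsum (module_mat TYPE(complex) n n) X (insert k K) = X k + finsum (module_mat TYPE(complex) n n) X K"
      using insert.hyps insert.prems by (subst M.finsum_insert) (auto simp: module_mat_simps)
    also have "finsum (module_mat TYPE(complex) n n) X K = Matrix.mat n n (\<lambda>(i, j). \<Sum>k\<in>K. X k $$ (i, j))"
      by (rule insert.IH) (simp add: insert.prems)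
    finally show ?case using insert.hyps insert.prems by (auto intro!: eq_matI)
  qed
qed

lemma psd_finsum:
  assumes "finite K" and X: "\<And>k. k \<in> K \<Longrightarrow> psd_mat n (X k)"
  shows "psd_mat n (finsum (module_mat TYPE(complex) n n) X K)"
proof -
  let ?S = "Matrix.mat n n (\<lambda>(i, j). \<Sum>k\<in>K. X k $$ (i, j))"
  have cX: "X k \<in> carrier_mat n n" if "k \<in> K" for k using X that by (simp add: psd_mat_def)
  have "mat_adjoint ?S = ?S"
  proof (rule eq_matI)
    fix i j assume "i < dim_row ?S" "j < dim_col ?S"
    then have ij: "i < n" "j < n" by auto
    have "cnj (X k $$ (j, i)) = X k $$ (i, j)" if k: "k \<in> K" for k
    proof -
      have "mat_adjoint (X k) $$ (i, j) = cnj (X k $$ (j, i))" using cX[OF k] ij by simp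
      then show ?thesis using X[OF k] by (simp add: psd_mat_def)
    qed
    then show "mat_adjoint ?S $$ (i, j) = ?S $$ (i, j)" using ij by simp
  qed auto
  moreover have "0 \<le> Re ((?S *\<^sub>v v) \<bullet>c v)" if v: "v \<in> carrier_vec n" for v
  proof -
    have *: "(A *\<^sub>v v) \<bullet>c v = (\<Sum>a<n. \<Sum>b<n. A $$ (a, b) * v $ b * cnj (v $ a))" if "A \<in> carrier_mat n n" for A
      using that v by (simp add: scalar_prod_def atLeast0LessThan sum_distrib_right)
    have "(?S *\<^sub>v v) \<bullet>c v = (\<Sum>a<n. \<Sum>b<n. \<Sum>k\<in>K. X k $$ (a, b) * v $ b * cnj (v $ a))"
      by (subst *) (simp_all add: sum_distrib_right)
    also have "\<dots> = (\<Sum>a<n. \<Sum>k\<in>K. \<Sum>b<n. X k $$ (a, b) * v $ b * cnj (v $ a))"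
      by (intro sum.cong refl sum.swap)
    also have "\<dots> = (\<Sum>k\<in>K. \<Sum>a<n. \<Sum>b<n. X k $$ (a, b) * v $ b * cnj (v $ a))" by (rule sum.swap)
    also have "\<dots> = (\<Sum>k\<in>K. (X k *\<^sub>v v) \<bullet>c v)" by (intro sum.cong refl) (simp add: * cX)
    finally have "Re ((?S *\<^sub>v v) \<bullet>c v) = (\<Sum>k\<in>K. Re ((X k *\<^sub>v v) \<bullet>c v))" by simp
    also have "0 \<le> \<dots>" using X v by (intro sum_nonneg) (auto simp: psd_mat_def)
    finally show ?thesis .
  qed
  ultimately have "psd_mat n ?S" unfolding psd_mat_def by auto
  then show ?thesis using finsum_mat[OF assms(1) cX] by simp
qed

section \<open>Reduction to coordinates\<close>

lemma diag_sandwich_index: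
  assumes P: "P \<in> carrier_mat n n" and Q: "Q \<in> carrier_mat n n" and ij: "i < n" "j < n"
  shows "(P * mat_diag n f * Q) $$ (i, j) = (\<Sum>k<n. P $$ (i, k) * f k * Q $$ (k, j))"
proof -
  have "(P * mat_diag n f * Q) $$ (i, j) = (\<Sum>k<n. (P * mat_diag n f) $$ (i, k) * Q $$ (k, j))"
    by (rule index_mult_sum[OF mult_carrier_mat[OF P mat_diag_dim] Q ij])
  then show ?thesis unfolding mat_diag_mult_right[OF P] using ij by simp
qed

lemma mat_trace_diag_mult:
  assumes "Z \<in> carrier_mat n n"
  shows "mat_trace (mat_diag n f * Z) = (\<Sum>l<n. f l * Z $$ (l, l))"
  unfolding mat_diag_mult_left[OF assms] by (simp add: mat_trace_def)

text \<open>Passage from matrices to the data of the interpolation. The index \<open>(k, i)\<close>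
  denotes the \<open>i\<close>-th eigenvector of \<open>X k\<close> and \<open>w\<close> its
  eigenvalue. The block row \<open>T = (X_1^(1/2), ..., X_m^(1/2))\<close> has \<open>T T*\<close>
  equal to the sum of the \<open>X k\<close>, and \<open>T* T\<close> is the block matrix of the
  overview, so the vectors \<open>T* \<phi>_j / sqrt (s j)\<close> are its eigenvectors \<theta>;
  \<open>J\<close> selects the \<open>j\<close> for which this quotient makes sense.\<close>

lemma product_sum_representation:
  fixes m n :: nat and R \<Psi> \<Phi> :: "complex mat" and X :: "nat \<Rightarrow> complex mat" and a s :: "nat \<Rightarrow> real"
  defines "B \<equiv> {1..m} \<times> {..<n}" and "J \<equiv> {j. j < n \<and> 0 < s j}"
  assumes m: "1 \<le> m" and R: "psd_mat n R" and X: "\<And>k. k \<in> {1..m} \<Longrightarrow> psd_mat n (X k)"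
    and sdR: "spectral_decomp n R \<Psi> a"
    and sdS: "spectral_decomp n (finsum (module_mat TYPE(complex) n n) X {1..m}) \<Phi> s"
  obtains \<theta> u w where "orthonormal_on B J \<theta>" "orthonormal_on B {..<n} u" "\<forall>b\<in>B. 0 \<le> w b"
    "\<forall>b\<in>B. (\<Sum>j\<in>J. s j * (norm (\<theta> j b))\<^sup>2) = w b"
    "\<forall>b\<in>B. (\<Sum>l<n. (norm (u l b))\<^sup>2) = 1 / real m"
    "(\<Sum>k=1..m. schatten_norm 1 (R * X k))
      \<le> (\<Sum>l<n. a l * (sqrt m * sqrt (\<Sum>j\<in>J. s j * (norm (\<Sum>b\<in>B. cnj (\<theta> j b) * of_real (sqrt (w b)) * u l b))\<^sup>2)))"
proof -
  let ?S = "finsum (module_mat TYPE(complex) n n) X {1..m}"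
  have cX: "X k \<in> carrier_mat n n" if "k \<in> {1..m}" for k using X[OF that] by (simp add: psd_mat_def)
  have cR: "R \<in> carrier_mat n n" using R by (simp add: psd_mat_def)
  have S: "psd_mat n ?S" by (rule psd_finsum) (simp_all add: X)
  have S_ix: "?S $$ (i, j) = (\<Sum>k=1..m. X k $$ (i, j))" if "i < n" "j < n" for i j
    using finsum_mat[of "{1..m}" X n] cX that by simp
  have cS: "?S \<in> carrier_mat n n" using S by (simp add: psd_mat_def)
  have s0: "0 \<le> s j" if "j < n" for j using psd_eigenvalue_nonneg[OF S sdS that] .
  have a0: "0 \<le> a l" if "l < n" for l using psd_eigenvalue_nonneg[OF R sdR that] .
  have "\<forall>k\<in>{1..m}. \<exists>Ex. spectral_decomp n (X k) (fst Ex) (snd Ex)"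
    using psd_spectral[OF X] by fastforce
  then obtain Ex where Ex: "\<forall>k\<in>{1..m}. spectral_decomp n (X k) (fst (Ex k)) (snd (Ex k))"
    using bchoice[of "{1..m}" "\<lambda>k Ex. spectral_decomp n (X k) (fst Ex) (snd Ex)"] by blast
  define E where "E k = fst (Ex k)" for k
  define x where "x k = snd (Ex k)" for k
  have sdX: "spectral_decomp n (X k) (E k) (x k)" if "k \<in> {1..m}" for k
    using Ex that by (simp add: E_def x_def)
  have x0: "0 \<le> x k i" if "k \<in> {1..m}" "i < n" for k i
    using psd_eigenvalue_nonneg[OF X[OF that(1)] sdX[OF that(1)] that(2)] .
  have "\<forall>k\<in>{1..m}. \<exists>W. unitary_mat n W \<and> schatten_norm 1 (R * X k) = Re (mat_trace (W * (R * X k)))"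
    using schatten_one_unitary mult_carrier_mat[OF cR cX] by simp
  then obtain W where W: "\<forall>k\<in>{1..m}. unitary_mat n (W k) \<and> schatten_norm 1 (R * X k) = Re (mat_trace (W k * (R * X k)))"
    using bchoice[of "{1..m}" "\<lambda>k W. unitary_mat n W \<and> schatten_norm 1 (R * X k) = Re (mat_trace (W * (R * X k)))"] by blast
  have uE: "unitary_mat n (E k)" if "k \<in> {1..m}" for k by (rule spectral_decomp_unitary[OF sdX[OF that]])
  have uW: "unitary_mat n (W k)" if "k \<in> {1..m}" for k using W that by blast
  have u\<Psi>: "unitary_mat n \<Psi>" by (rule spectral_decomp_unitary[OF sdR])
  have u\<Phi>: "unitary_mat n \<Phi>" by (rule spectral_decomp_unitary[OF sdS])
  \<comment> \<open>\<open>\<alpha> k\<close> compares the eigenbases of the sum and of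
    \<open>X k\<close>, \<open>\<Gamma>\<close> those of \<open>R\<close> and of the sum, and
    \<open>\<upsilon> k\<close> is \<open>W k\<close> written from the eigenbasis of
    \<open>R\<close> to that of \<open>X k\<close>.\<close>
  define \<alpha> where "\<alpha> k = mat_adjoint \<Phi> * E k" for k
  define \<upsilon> where "\<upsilon> k = mat_adjoint (E k) * (W k * \<Psi>)" for k
  define \<Gamma> where "\<Gamma> = mat_adjoint \<Psi> * \<Phi>"
  have u\<alpha>: "unitary_mat n (\<alpha> k)" if "k \<in> {1..m}" for k
    unfolding \<alpha>_def by (rule unitary_mult[OF unitary_adjoint[OF u\<Phi>] uE[OF that]])
  have u\<upsilon>: "unitary_mat n (\<upsilon> k)" if "k \<in> {1..m}" for k
    unfolding \<upsilon>_def by (rule unitary_mult[OF unitary_adjoint[OF uE[OF that]] unitary_mult[OF uW[OF that] u\<Psi>]])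
  have u\<Gamma>: "unitary_mat n \<Gamma>" unfolding \<Gamma>_def by (rule unitary_mult[OF unitary_adjoint[OF u\<Psi>] u\<Phi>])
  have cu: "U \<in> carrier_mat n n" if "unitary_mat n U" for U using that by (simp add: unitary_mat_def)
  note assoc = assoc_mult_mat[of _ n n _ n _ n] mult_carrier_mat[of _ n n _ n]
  have c\<Phi>: "\<Phi> \<in> carrier_mat n n" "mat_adjoint \<Phi> \<in> carrier_mat n n" using cu[OF u\<Phi>] mat_adjoint_carrier by auto
  have c\<Psi>: "\<Psi> \<in> carrier_mat n n" "mat_adjoint \<Psi> \<in> carrier_mat n n" using cu[OF u\<Psi>] mat_adjoint_carrier by auto
  have sandwich: "(\<Sum>i<n. \<alpha> k $$ (j, i) * of_real (x k i) * cnj (\<alpha> k $$ (j', i)))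
      = (\<Sum>c<n. \<Sum>d<n. mat_adjoint \<Phi> $$ (j, c) * X k $$ (c, d) * \<Phi> $$ (d, j'))"
    if k: "k \<in> {1..m}" and j: "j < n" "j' < n" for k j j'
  proof -
    let ?D = "mat_diag n (\<lambda>i. complex_of_real (x k i))"
    have cE: "E k \<in> carrier_mat n n" "mat_adjoint (E k) \<in> carrier_mat n n" using cu[OF uE[OF k]] mat_adjoint_carrier by auto
    have c\<alpha>: "\<alpha> k \<in> carrier_mat n n" by (rule cu[OF u\<alpha>[OF k]])
    have "(\<Sum>i<n. \<alpha> k $$ (j, i) * of_real (x k i) * cnj (\<alpha> k $$ (j', i))) = (\<alpha> k * ?D * mat_adjoint (\<alpha> k)) $$ (j, j')"
      unfolding diag_sandwich_index[OF c\<alpha> mat_adjoint_carrier[OF c\<alpha>] j] using c\<alpha> j by (intro sum.cong) auto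
    also have "\<alpha> k * ?D * mat_adjoint (\<alpha> k) = mat_adjoint \<Phi> * (E k * ?D * mat_adjoint (E k)) * \<Phi>"
      unfolding \<alpha>_def adjoint_mult[OF c\<Phi>(2) cE(1)] using c\<Phi> cE by (simp add: assoc)
    also have "E k * ?D * mat_adjoint (E k) = X k" using sdX[OF k] by (simp add: spectral_decomp_def)
    also have "(mat_adjoint \<Phi> * X k * \<Phi>) $$ (j, j') = (\<Sum>c<n. \<Sum>d<n. mat_adjoint \<Phi> $$ (j, c) * X k $$ (c, d) * \<Phi> $$ (d, j'))"
      by (rule conjugate_index[OF c\<Phi>(2) cX[OF k] c\<Phi>(1) j])
    finally show ?thesis .
  qed
  \<comment> \<open>In the eigenbasis \<open>\<Phi>\<close> the matrices \<open>X k\<close> add up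
    to the diagonal matrix of the \<open>s j\<close>.\<close>
  have gram: "(\<Sum>k=1..m. \<Sum>i<n. \<alpha> k $$ (j, i) * of_real (x k i) * cnj (\<alpha> k $$ (j', i))) = (if j = j' then of_real (s j) else 0)"
    if j: "j < n" "j' < n" for j j'
  proof -
    have "(\<Sum>k=1..m. \<Sum>i<n. \<alpha> k $$ (j, i) * of_real (x k i) * cnj (\<alpha> k $$ (j', i)))
        = (\<Sum>k=1..m. \<Sum>c<n. \<Sum>d<n. mat_adjoint \<Phi> $$ (j, c) * X k $$ (c, d) * \<Phi> $$ (d, j'))"
      by (rule sum.cong[OF refl]) (rule sandwich[OF _ j])
    also have "\<dots> = (\<Sum>c<n. \<Sum>k=1..m. \<Sum>d<n. mat_adjoint \<Phi> $$ (j, c) * X k $$ (c, d) * \<Phi> $$ (d, j'))" by (rule sum.swap)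
    also have "\<dots> = (\<Sum>c<n. \<Sum>d<n. \<Sum>k=1..m. mat_adjoint \<Phi> $$ (j, c) * X k $$ (c, d) * \<Phi> $$ (d, j'))"
      by (intro sum.cong refl sum.swap)
    also have "\<dots> = (\<Sum>c<n. \<Sum>d<n. mat_adjoint \<Phi> $$ (j, c) * ?S $$ (c, d) * \<Phi> $$ (d, j'))"
      by (intro sum.cong refl) (simp only: S_ix lessThan_iff sum_distrib_left sum_distrib_right)
    also have "\<dots> = (mat_adjoint \<Phi> * ?S * \<Phi>) $$ (j, j')"
      by (rule conjugate_index[OF c\<Phi>(2) cS c\<Phi>(1) j, symmetric])
    also have "\<dots> = (if j = j' then of_real (s j) else 0)"
      unfolding spectral_decomp_conjugate[OF sdS] using j by (simp add: mat_diag_def)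
    finally show ?thesis .
  qed
  \<comment> \<open>A vector in the kernel of a sum of positive operators lies in the kernel of each
    of them.\<close>
  have zero: "of_real (x k i) * \<alpha> k $$ (j, i) = 0" if j: "j < n" "j \<notin> J" and k: "k \<in> {1..m}" and i: "i < n" for j k i
  proof -
    have "s j = 0" using j s0[of j] by (auto simp: J_def)
    then have "(\<Sum>k=1..m. \<Sum>i<n. \<alpha> k $$ (j, i) * of_real (x k i) * cnj (\<alpha> k $$ (j, i))) = 0" using gram[OF j(1) j(1)] by simp
    moreover have "(\<Sum>k=1..m. \<Sum>i<n. \<alpha> k $$ (j, i) * of_real (x k i) * cnj (\<alpha> k $$ (j, i)))
        = of_real (\<Sum>k=1..m. \<Sum>i<n. x k i * (norm (\<alpha> k $$ (j, i)))\<^sup>2)"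
      unfolding of_real_sum of_real_mult complex_norm_square by (intro sum.cong refl) (simp add: mult_ac)
    ultimately have "complex_of_real (\<Sum>k=1..m. \<Sum>i<n. x k i * (norm (\<alpha> k $$ (j, i)))\<^sup>2) = 0" by (simp only:)
    then have "(\<Sum>k=1..m. \<Sum>i<n. x k i * (norm (\<alpha> k $$ (j, i)))\<^sup>2) = 0" by (simp only: of_real_eq_0_iff)
    moreover have nn: "0 \<le> (\<Sum>i<n. x k i * (norm (\<alpha> k $$ (j, i)))\<^sup>2)" if "k \<in> {1..m}" for k
      using x0[OF that] by (intro sum_nonneg) auto
    ultimately have "(\<Sum>i<n. x k i * (norm (\<alpha> k $$ (j, i)))\<^sup>2) = 0"
      using k by (subst (asm) sum_nonneg_eq_0_iff) auto
    then have "x k i * (norm (\<alpha> k $$ (j, i)))\<^sup>2 = 0"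
      using i x0[OF k] by (subst (asm) sum_nonneg_eq_0_iff) auto
    then show ?thesis by simp
  qed
  define w where "w b = x (fst b) (snd b)" for b
  define \<theta> where "\<theta> j b = of_real (sqrt (w b) / sqrt (s j)) * cnj (\<alpha> (fst b) $$ (j, snd b))" for j b
  \<comment> \<open>The factor \<open>1 / sqrt m\<close> makes the column of \<open>m\<close>
    stacked unitaries an isometry.\<close>
  define u where "u l b = of_real (1 / sqrt m) * \<upsilon> (fst b) $$ (snd b, l)" for l b
  have sumB: "(\<Sum>b\<in>B. h (fst b) (snd b)) = (\<Sum>k=1..m. \<Sum>i<n. h k i)" for h :: "nat \<Rightarrow> nat \<Rightarrow> complex"
    unfolding B_def by (simp add: sum.cartesian_product case_prod_beta)
  have w0: "0 \<le> w b" if "b \<in> B" for b using that x0 by (auto simp: B_def w_def)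
  have on\<theta>: "orthonormal_on B J \<theta>"
    unfolding orthonormal_on_def
  proof (intro ballI)
    fix j j' assume jj: "j \<in> J" "j' \<in> J"
    then have j: "j < n" "j' < n" "0 < s j" "0 < s j'" by (auto simp: J_def)
    have "cip B (\<theta> j) (\<theta> j') = (\<Sum>b\<in>B. of_real (1 / (sqrt (s j) * sqrt (s j')))
        * (\<alpha> (fst b) $$ (j, snd b) * of_real (x (fst b) (snd b)) * cnj (\<alpha> (fst b) $$ (j', snd b))))"
      unfolding cip_def
    proof (intro sum.cong refl)
      fix b assume b: "b \<in> B"
      have "sqrt (w b) * sqrt (w b) = x (fst b) (snd b)" using w0[OF b] by (simp add: w_def)
      then have "of_real (sqrt (w b)) * of_real (sqrt (w b)) = (of_real (x (fst b) (snd b)) :: complex)"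
        by (simp only: of_real_mult[symmetric])
      then show "cnj (\<theta> j b) * \<theta> j' b = of_real (1 / (sqrt (s j) * sqrt (s j')))
        * (\<alpha> (fst b) $$ (j, snd b) * of_real (x (fst b) (snd b)) * cnj (\<alpha> (fst b) $$ (j', snd b)))"
        unfolding \<theta>_def by (simp add: field_simps)
    qed
    also have "\<dots> = of_real (1 / (sqrt (s j) * sqrt (s j'))) * (if j = j' then of_real (s j) else 0)"
      unfolding sum_distrib_left[symmetric] sumB[of "\<lambda>k i. \<alpha> k $$ (j, i) * of_real (x k i) * cnj (\<alpha> k $$ (j', i))"] gram[OF j(1,2)] ..
    also have "\<dots> = (if j = j' then 1 else 0)" using j by (simp flip: of_real_mult)
    finally show "cip B (\<theta> j) (\<theta> j') = (if j = j' then 1 else 0)" .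
  qed
  have onu: "orthonormal_on B {..<n} u"
    unfolding orthonormal_on_def
  proof (intro ballI)
    fix l l' assume ll: "l \<in> {..<n}" "l' \<in> {..<n}"
    have mm: "of_real (1 / sqrt m) * of_real (1 / sqrt m) = (of_real (1 / m) :: complex)"
      unfolding of_real_mult[symmetric] using m by simp
    have "cip B (u l) (u l') = (\<Sum>b\<in>B. (of_real (1 / sqrt m) * of_real (1 / sqrt m))
        * (cnj (\<upsilon> (fst b) $$ (snd b, l)) * \<upsilon> (fst b) $$ (snd b, l')))"
      unfolding cip_def u_def by (intro sum.cong refl) simp
    also have "\<dots> = of_real (1 / m) * (\<Sum>k=1..m. \<Sum>i<n. cnj (\<upsilon> k $$ (i, l)) * \<upsilon> k $$ (i, l'))"
      unfolding mm sum_distrib_left[symmetric] sumB[of "\<lambda>k i. cnj (\<upsilon> k $$ (i, l)) * \<upsilon> k $$ (i, l')"] ..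
    also have "(\<Sum>k=1..m. \<Sum>i<n. cnj (\<upsilon> k $$ (i, l)) * \<upsilon> k $$ (i, l')) = (\<Sum>k=1..m. if l = l' then 1 else 0)"
      using ll by (intro sum.cong refl unitary_cols[OF u\<upsilon>]) auto
    also have "of_real (1 / m) * \<dots> = (if l = l' then 1 else 0)" using m by simp
    finally show "cip B (u l) (u l') = (if l = l' then 1 else 0)" .
  qed
  \<comment> \<open>The factor \<open>s j\<close> cancels the normalization of \<theta>, and the
    columns of the unitary \<open>\<alpha> k\<close> have length 1; the terms with \<open>j\<close>
    outside \<open>J\<close> vanish by \<open>zero\<close>.\<close>
  have diag: "(\<Sum>j\<in>J. s j * (norm (\<theta> j b))\<^sup>2) = w b" if b: "b \<in> B" for b
  proof -
    obtain k i where ki: "b = (k, i)" "k \<in> {1..m}" "i < n" using b by (auto simp: B_def)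
    have "(\<Sum>j\<in>J. s j * (norm (\<theta> j b))\<^sup>2) = (\<Sum>j\<in>J. w b * (norm (\<alpha> k $$ (j, i)))\<^sup>2)"
      using w0[OF b] by (intro sum.cong refl) (auto simp: \<theta>_def ki J_def norm_mult power_mult_distrib power_divide norm_divide)
    also have "\<dots> = (\<Sum>j<n. w b * (norm (\<alpha> k $$ (j, i)))\<^sup>2)"
      using zero[OF _ _ ki(2,3)] by (intro sum.mono_neutral_left) (auto simp: J_def w_def ki)
    also have "\<dots> = w b" using unitary_col_norm[OF u\<alpha>[OF ki(2)] ki(3)] by (simp flip: sum_distrib_left)
    finally show ?thesis .
  qed
  have overlap: "(\<Sum>l<n. (norm (u l b))\<^sup>2) = 1 / real m" if b: "b \<in> B" for b
  proof -
    obtain k i where ki: "b = (k, i)" "k \<in> {1..m}" "i < n" using b by (auto simp: B_def)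
    have "(\<Sum>l<n. (norm (u l b))\<^sup>2) = (\<Sum>l<n. 1 / real m * (norm (\<upsilon> k $$ (i, l)))\<^sup>2)"
      by (intro sum.cong refl) (simp add: u_def ki norm_mult norm_divide power_mult_distrib power_divide)
    also have "\<dots> = 1 / real m" unfolding sum_distrib_left[symmetric] unitary_row_norm[OF u\<upsilon>[OF ki(2)] ki(3)] by simp
    finally show ?thesis .
  qed
  \<comment> \<open>\<open>Q k\<close> is \<open>\<Phi>* X_k W_k \<Psi>\<close>, so \<open>N\<close>
    represents the operator \<open>A\<close>, the sum of the \<open>X_k W_k\<close>, from the
    eigenbasis of \<open>R\<close> to that of the sum.\<close>
  define Q where "Q k = \<alpha> k * mat_diag n (\<lambda>i. complex_of_real (x k i)) * \<upsilon> k" for k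
  define N where "N j l = (\<Sum>k=1..m. Q k $$ (j, l))" for j l
  have cQ: "Q k \<in> carrier_mat n n" if "k \<in> {1..m}" for k
    unfolding Q_def by (intro mult_carrier_mat[of _ n n _ n] cu[OF u\<alpha>[OF that]] cu[OF u\<upsilon>[OF that]] mat_diag_dim)
  \<comment> \<open>By cyclicity this is the trace of \<open>R X_k W_k\<close>, read off in the
    eigenbasis of \<open>R\<close>.\<close>
  have tr: "mat_trace (W k * (R * X k)) = (\<Sum>l<n. of_real (a l) * (\<Gamma> * Q k) $$ (l, l))" if k: "k \<in> {1..m}" for k
  proof -
    let ?D = "mat_diag n (\<lambda>i. complex_of_real (x k i))" and ?A = "mat_diag n (\<lambda>i. complex_of_real (a i))"
    have cE: "E k \<in> carrier_mat n n" "mat_adjoint (E k) \<in> carrier_mat n n" using cu[OF uE[OF k]] mat_adjoint_carrier by auto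
    have cW: "W k \<in> carrier_mat n n" by (rule cu[OF uW[OF k]])
    have cA: "?A \<in> carrier_mat n n" and cD: "?D \<in> carrier_mat n n" by simp_all
    have Rd: "R = \<Psi> * ?A * mat_adjoint \<Psi>" using sdR by (simp add: spectral_decomp_def)
    have Xd: "X k = E k * ?D * mat_adjoint (E k)" using sdX[OF k] by (simp add: spectral_decomp_def)
    have "W k * (R * X k) = (W k * \<Psi>) * (?A * (mat_adjoint \<Psi> * X k))"
      unfolding Rd using cW c\<Psi> cA cX[OF k] by (simp add: assoc)
    then have "mat_trace (W k * (R * X k)) = mat_trace (?A * (mat_adjoint \<Psi> * X k) * (W k * \<Psi>))"
      using mat_trace_comm[OF mult_carrier_mat[OF cW c\<Psi>(1)] mult_carrier_mat[OF cA mult_carrier_mat[OF c\<Psi>(2) cX[OF k]]]] by simp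
    also have "?A * (mat_adjoint \<Psi> * X k) * (W k * \<Psi>) = ?A * (\<Gamma> * Q k)"
    proof -
      have "\<Gamma> * Q k = mat_adjoint \<Psi> * ((\<Phi> * mat_adjoint \<Phi>) * (E k * ?D * mat_adjoint (E k)) * (W k * \<Psi>))"
        unfolding \<Gamma>_def Q_def \<alpha>_def \<upsilon>_def using cE c\<Phi> c\<Psi> cW cD by (simp add: assoc)
      also have "(\<Phi> * mat_adjoint \<Phi>) * (E k * ?D * mat_adjoint (E k)) = X k"
        using u\<Phi> cX[OF k] unfolding Xd[symmetric] unitary_mat_def by simp
      finally show ?thesis using c\<Psi> cW cA cX[OF k] by (simp add: assoc)
    qed
    also have "mat_trace (?A * (\<Gamma> * Q k)) = (\<Sum>l<n. of_real (a l) * (\<Gamma> * Q k) $$ (l, l))"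
      by (rule mat_trace_diag_mult[OF mult_carrier_mat[OF cu[OF u\<Gamma>] cQ[OF k]]])
    finally show ?thesis .
  qed
  have N_eq: "N j l = of_real (sqrt m * sqrt (s j)) * (\<Sum>b\<in>B. cnj (\<theta> j b) * of_real (sqrt (w b)) * u l b)"
    if j: "j \<in> J" and l: "l < n" for j l
  proof -
    have jn: "j < n" "0 < s j" using j by (auto simp: J_def)
    have "N j l = (\<Sum>k=1..m. \<Sum>i<n. \<alpha> k $$ (j, i) * of_real (x k i) * \<upsilon> k $$ (i, l))"
      unfolding N_def Q_def using cu[OF u\<alpha>] cu[OF u\<upsilon>] jn(1) l
      by (intro sum.cong refl diag_sandwich_index) auto
    also have "\<dots> = (\<Sum>b\<in>B. \<alpha> (fst b) $$ (j, snd b) * of_real (x (fst b) (snd b)) * \<upsilon> (fst b) $$ (snd b, l))"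
      by (rule sumB[symmetric, of "\<lambda>k i. \<alpha> k $$ (j, i) * of_real (x k i) * \<upsilon> k $$ (i, l)"])
    also have "\<dots> = of_real (sqrt m * sqrt (s j)) * (\<Sum>b\<in>B. cnj (\<theta> j b) * of_real (sqrt (w b)) * u l b)"
      unfolding sum_distrib_left
    proof (intro sum.cong refl)
      fix b assume b: "b \<in> B"
      have "sqrt m * sqrt (s j) * (sqrt (w b) / sqrt (s j)) * sqrt (w b) * (1 / sqrt m) = x (fst b) (snd b)"
        using w0[OF b] jn m by (simp add: w_def)
      then have "of_real (sqrt m * sqrt (s j)) * of_real (sqrt (w b) / sqrt (s j)) * of_real (sqrt (w b)) * of_real (1 / sqrt m) = (of_real (x (fst b) (snd b)) :: complex)"
        by (simp only: of_real_mult[symmetric])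
      note this[symmetric]
      then show "\<alpha> (fst b) $$ (j, snd b) * of_real (x (fst b) (snd b)) * \<upsilon> (fst b) $$ (snd b, l)
        = of_real (sqrt m * sqrt (s j)) * (cnj (\<theta> j b) * of_real (sqrt (w b)) * u l b)"
        unfolding \<theta>_def u_def complex_cnj_mult complex_cnj_complex_of_real complex_cnj_cnj by (simp only:) (simp only: mult_ac)
    qed
    finally show ?thesis .
  qed
  have N_0: "N j l = 0" if "j < n" "j \<notin> J" "l < n" for j l
  proof -
    have "Q k $$ (j, l) = 0" if k: "k \<in> {1..m}" for k
    proof -
      have "Q k $$ (j, l) = (\<Sum>i<n. \<alpha> k $$ (j, i) * of_real (x k i) * \<upsilon> k $$ (i, l))"
        unfolding Q_def using cu[OF u\<alpha>[OF k]] cu[OF u\<upsilon>[OF k]] \<open>j < n\<close> \<open>l < n\<close> by (rule diag_sandwich_index)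
      also have "\<dots> = 0"
      proof (intro sum.neutral ballI)
        fix i assume "i \<in> {..<n}"
        then show "\<alpha> k $$ (j, i) * of_real (x k i) * \<upsilon> k $$ (i, l) = 0"
          using zero[OF \<open>j < n\<close> \<open>j \<notin> J\<close> k, of i] by (simp add: mult.commute)
      qed
      finally show ?thesis .
    qed
    then show ?thesis unfolding N_def by simp
  qed
  \<comment> \<open>The length of column \<open>l\<close> of \<open>N\<close>, that is, of
    \<open>A\<close> applied to the \<open>l\<close>-th eigenvector of \<open>R\<close>.\<close>
  have col: "sqrt (\<Sum>j<n. (norm (N j l))\<^sup>2) = sqrt m * sqrt (\<Sum>j\<in>J. s j * (norm (\<Sum>b\<in>B. cnj (\<theta> j b) * of_real (sqrt (w b)) * u l b))\<^sup>2)"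
    if l: "l < n" for l
  proof -
    have "(\<Sum>j<n. (norm (N j l))\<^sup>2) = (\<Sum>j\<in>J. (norm (N j l))\<^sup>2)"
      using N_0 l by (intro sum.mono_neutral_right) (auto simp: J_def)
    also have "\<dots> = (\<Sum>j\<in>J. m * (s j * (norm (\<Sum>b\<in>B. cnj (\<theta> j b) * of_real (sqrt (w b)) * u l b))\<^sup>2))"
    proof (intro sum.cong refl)
      fix j assume j: "j \<in> J"
      then have "0 < s j" by (simp add: J_def)
      then show "(norm (N j l))\<^sup>2 = m * (s j * (norm (\<Sum>b\<in>B. cnj (\<theta> j b) * of_real (sqrt (w b)) * u l b))\<^sup>2)"
        unfolding N_eq[OF j l] norm_mult[of "of_real _"] norm_of_real by (simp add: power_mult_distrib)
    qed
    finally show ?thesis by (simp add: real_sqrt_mult flip: sum_distrib_left)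
  qed
  have "(\<Sum>k=1..m. schatten_norm 1 (R * X k)) = Re (\<Sum>k=1..m. \<Sum>l<n. of_real (a l) * (\<Gamma> * Q k) $$ (l, l))"
    using W tr by simp
  also have "(\<Sum>k=1..m. \<Sum>l<n. of_real (a l) * (\<Gamma> * Q k) $$ (l, l)) = (\<Sum>l<n. of_real (a l) * (\<Sum>j<n. \<Gamma> $$ (l, j) * N j l))"
  proof -
    have "(\<Sum>k=1..m. \<Sum>l<n. of_real (a l) * (\<Gamma> * Q k) $$ (l, l)) = (\<Sum>l<n. \<Sum>k=1..m. of_real (a l) * (\<Gamma> * Q k) $$ (l, l))" by (rule sum.swap)
    also have "\<dots> = (\<Sum>l<n. \<Sum>k=1..m. of_real (a l) * (\<Sum>j<n. \<Gamma> $$ (l, j) * Q k $$ (j, l)))"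
      using index_mult_sum[OF cu[OF u\<Gamma>] cQ] by (intro sum.cong refl) simp
    also have "\<dots> = (\<Sum>l<n. of_real (a l) * (\<Sum>j<n. \<Gamma> $$ (l, j) * N j l))"
    proof (intro sum.cong refl)
      fix l
      have "(\<Sum>k=1..m. of_real (a l) * (\<Sum>j<n. \<Gamma> $$ (l, j) * Q k $$ (j, l)))
          = of_real (a l) * (\<Sum>k=1..m. \<Sum>j<n. \<Gamma> $$ (l, j) * Q k $$ (j, l))" by (rule sum_distrib_left[symmetric])
      also have "(\<Sum>k=1..m. \<Sum>j<n. \<Gamma> $$ (l, j) * Q k $$ (j, l)) = (\<Sum>j<n. \<Gamma> $$ (l, j) * N j l)"
        unfolding N_def sum_distrib_left by (rule sum.swap)
      finally show "(\<Sum>k=1..m. of_real (a l) * (\<Sum>j<n. \<Gamma> $$ (l, j) * Q k $$ (j, l))) = of_real (a l) * (\<Sum>j<n. \<Gamma> $$ (l, j) * N j l)" .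
    qed
    finally show ?thesis .
  qed
  also have "Re \<dots> = (\<Sum>l<n. a l * Re (\<Sum>j<n. \<Gamma> $$ (l, j) * N j l))"
  proof -
    have "Re (of_real c * z) = c * Re z" for c z by simp
    then show ?thesis by (subst Re_sum) (simp only:)
  qed
  also have "\<dots> \<le> (\<Sum>l<n. a l * (sqrt m * sqrt (\<Sum>j\<in>J. s j * (norm (\<Sum>b\<in>B. cnj (\<theta> j b) * of_real (sqrt (w b)) * u l b))\<^sup>2)))"
  proof (intro sum_mono mult_left_mono)
    fix l assume "l \<in> {..<n}"
    then have l: "l < n" by simp
    \<comment> \<open>Row \<open>l\<close> of the unitary \<open>\<Gamma>\<close> has length 1, so
      Cauchy-Schwarz bounds the \<open>l\<close>-th diagonal entry of \<open>A\<close> in the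
      eigenbasis of \<open>R\<close> by the length of column \<open>l\<close> of
      \<open>N\<close>.\<close>
    have "(norm (cip {..<n} (\<lambda>j. cnj (\<Gamma> $$ (l, j))) (\<lambda>j. N j l)))\<^sup>2 \<le> 1 * (\<Sum>j<n. (norm (N j l))\<^sup>2)"
      using cip_cauchy_schwarz[of "{..<n}" "\<lambda>j. cnj (\<Gamma> $$ (l, j))" "\<lambda>j. N j l"] unitary_row_norm[OF u\<Gamma> l] by simp
    then have "norm (cip {..<n} (\<lambda>j. cnj (\<Gamma> $$ (l, j))) (\<lambda>j. N j l)) \<le> sqrt (\<Sum>j<n. (norm (N j l))\<^sup>2)"
      using real_le_rsqrt by simp
    moreover have "cip {..<n} (\<lambda>j. cnj (\<Gamma> $$ (l, j))) (\<lambda>j. N j l) = (\<Sum>j<n. \<Gamma> $$ (l, j) * N j l)" by (simp add: cip_def)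
    ultimately have "norm (\<Sum>j<n. \<Gamma> $$ (l, j) * N j l) \<le> sqrt (\<Sum>j<n. (norm (N j l))\<^sup>2)" by (simp only:)
    then show "Re (\<Sum>j<n. \<Gamma> $$ (l, j) * N j l) \<le> sqrt m * sqrt (\<Sum>j\<in>J. s j * (norm (\<Sum>b\<in>B. cnj (\<theta> j b) * of_real (sqrt (w b)) * u l b))\<^sup>2)"
      unfolding col[OF l, symmetric] by (rule order_trans[OF complex_Re_le_cmod])
    show "0 \<le> a l" by (rule a0[OF l])
  qed
  finally show thesis using on\<theta> onu w0 diag overlap by (intro that[of \<theta> u w]) auto
qed

section \<open>The two bounds\<close>

text \<open>Existence is the intermediate value theorem. Uniqueness follows from
  \<open>x powr (p - 1) = 2 + (m - 1) / x\<close>, whose left side strictly increases while the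
  right side does not.\<close>

lemma x_root_ex1:
  fixes p :: real and m :: nat
  assumes p: "2 \<le> p" and m: "1 \<le> m"
  shows "\<exists>!x. 1 < x \<and> x powr p = 2 * x + real m - 1"
proof (rule ex_ex1I)
  define g where "g x = x powr p - 2 * x - real m + 1" for x :: real
  have "g 1 < 0" using m by (simp add: g_def)
  \<comment> \<open>The endpoint \<open>m + 2\<close> works since its square
    \<open>m\<^sup>2 + 4 * m + 4\<close> exceeds \<open>2 * (m + 2) + m - 1\<close>.\<close>
  moreover have "0 \<le> g (real m + 2)"
  proof -
    have "(real m + 2) powr 2 \<le> (real m + 2) powr p" using p m by (intro powr_mono) auto
    moreover have "(real m + 2) powr 2 = (real m + 2)\<^sup>2" by (simp add: powr_numeral)
    moreover have "(real m + 2)\<^sup>2 = real m * real m + 4 * real m + 4" by (simp add: power2_eq_square algebra_simps)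
    ultimately have "real m * real m + 4 * real m + 4 \<le> (real m + 2) powr p" by (simp only:)
    moreover have "0 \<le> Q - 2 * (M + 2) - M + 1" if "K + 4 * M + 4 \<le> Q" "0 \<le> M" "0 \<le> K" for K M Q :: real
      using that by (simp add: algebra_simps)
    ultimately show ?thesis unfolding g_def using of_nat_0_le_iff[of m] by (metis zero_le_square)
  qed
  moreover have "continuous_on {1..real m + 2} g"
    unfolding g_def by (intro continuous_intros) auto
  ultimately obtain x where x: "1 \<le> x" "g x = 0"
    using IVT'[of g 1 0 "real m + 2"] by auto
  moreover have "x \<noteq> 1" using x \<open>g 1 < 0\<close> by auto
  ultimately show "\<exists>x. 1 < x \<and> x powr p = 2 * x + real m - 1" by (intro exI[of _ x]) (auto simp: g_def)
next
  have less: False if ab: "1 < a" "a < b" and ea: "a powr p = 2 * a + real m - 1" and eb: "b powr p = 2 * b + real m - 1" for a b :: real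
  proof -
    have pw: "c powr p = c * c powr (p - 1)" if "1 < c" for c :: real
      using that by (simp add: powr_diff)
    have "a powr (p - 1) < b powr (p - 1)" using ab p by (intro powr_less_mono2) auto
    then have "a * b * a powr (p - 1) < a * b * b powr (p - 1)" using ab by (intro mult_strict_left_mono) auto
    \<comment> \<open>Cross-multiplied form of monotonicity; inserting the equation for
      \<open>a\<close> and \<open>b\<close> cancels \<open>2 * a * b\<close>.\<close>
    then have "b * a powr p < a * b powr p" using pw[of a] pw[of b] ab by (simp add: mult_ac)
    then have "b * (real m - 1) < a * (real m - 1)" unfolding ea eb by (simp add: algebra_simps)
    moreover have "a * (real m - 1) \<le> b * (real m - 1)" using ab m by (intro mult_right_mono) auto
    ultimately show False by simp
  qed
  fix a b :: real
  assume "1 < a \<and> a powr p = 2 * a + real m - 1" "1 < b \<and> b powr p = 2 * b + real m - 1"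
  then show "a = b" using less[of a b] less[of b a] by (cases a b rule: linorder_cases) auto
qed

lemma x_root:
  assumes "2 \<le> p" "1 \<le> m"
  shows "1 < x_root p m" "x_root p m powr p = 2 * x_root p m + real m - 1"
  using theI'[OF x_root_ex1[OF assms]] unfolding x_root_def by auto

section \<open>The upper bounds\<close>

lemma upper_bound_finite:
  fixes R :: "complex mat" and X :: "nat \<Rightarrow> complex mat" and p :: real
  assumes m: "1 \<le> m" and p: "2 \<le> p"
    and R: "psd_mat n R" and X: "\<And>k. k \<in> {1..m} \<Longrightarrow> psd_mat n (X k)"
  shows "(\<Sum>k=1..m. schatten_norm 1 (R * X k))
    \<le> C_const (ereal p) m * schatten_norm (ereal (p / (p - 1))) R
      * schatten_norm (ereal p) (finsum (module_mat TYPE(complex) n n) X {1..m})"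
proof -
  let ?S = "finsum (module_mat TYPE(complex) n n) X {1..m}"
  have S: "psd_mat n ?S" by (rule psd_finsum) (simp_all add: X)
  obtain \<Psi> a where sdR: "spectral_decomp n R \<Psi> a" using psd_spectral[OF R] by (elim exE conjE)
  obtain \<Phi> s where sdS: "spectral_decomp n ?S \<Phi> s" using psd_spectral[OF S] by (elim exE conjE)
  have a0: "0 \<le> a l" if "l < n" for l using psd_eigenvalue_nonneg[OF R sdR that] .
  have s0: "0 \<le> s j" if "j < n" for j using psd_eigenvalue_nonneg[OF S sdS that] .
  define B where "B = {1..m} \<times> {..<n}"
  define J where "J = {j. j < n \<and> 0 < s j}"
  define x where "x = x_root p m"
  obtain \<theta> u w where *: "orthonormal_on B J \<theta>" "orthonormal_on B {..<n} u" "\<forall>b\<in>B. 0 \<le> w b"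
    "\<forall>b\<in>B. (\<Sum>j\<in>J. s j * (norm (\<theta> j b))\<^sup>2) = w b"
    "\<forall>b\<in>B. (\<Sum>l<n. (norm (u l b))\<^sup>2) = 1 / real m"
    "(\<Sum>k=1..m. schatten_norm 1 (R * X k))
      \<le> (\<Sum>l<n. a l * (sqrt m * sqrt (\<Sum>j\<in>J. s j * (norm (\<Sum>b\<in>B. cnj (\<theta> j b) * of_real (sqrt (w b)) * u l b))\<^sup>2)))"
    by (rule product_sum_representation[OF m R X sdR sdS, folded B_def J_def])
  have "(\<Sum>l<n. a l * (sqrt m * sqrt (\<Sum>j\<in>J. s j * (norm (\<Sum>b\<in>B. cnj (\<theta> j b) * of_real (sqrt (w b)) * u l b))\<^sup>2)))
    \<le> sqrt (x * (x + real m - 1)) / (x powr p + real m - 1) powr (1 / p)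
       * (\<Sum>l<n. a l powr (p / (p - 1))) powr (1 - 1 / p) * (\<Sum>j\<in>J. s j powr p) powr (1 / p)"
  proof (rule weighted_schatten_bound[OF _ _ _ *(1,2)])
    have "(\<Sum>b\<in>B. w b powr p * (\<Sum>l<n. (norm (u l b))\<^sup>2)) = (\<Sum>b\<in>B. w b powr p * (1 / real m))"
      using *(5) by (intro sum.cong refl) simp
    then show "(\<Sum>b\<in>B. w b powr p * (\<Sum>l<n. (norm (u l b))\<^sup>2)) = (\<Sum>b\<in>B. w b powr p) / real m"
      by (simp flip: sum_divide_distrib)
    show "1 < x" "x powr p = 2 * x + real m - 1" using x_root[OF p m] by (simp_all add: x_def)
  qed (use * m p a0 in \<open>auto simp: B_def J_def\<close>)
  \<comment> \<open>Restoring the zero eigenvalues changes nothing, as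
    \<open>0 powr p = 0\<close>.\<close>
  also have "(\<Sum>j\<in>J. s j powr p) = (\<Sum>j<n. s j powr p)"
    using s0 by (intro sum.mono_neutral_left) (force simp: J_def)+
  \<comment> \<open>With \<open>q = p / (p - 1)\<close> the outer exponent \<open>1 - 1 / p\<close>
    is \<open>1 / q\<close>.\<close>
  also have "(\<Sum>l<n. a l powr (p / (p - 1))) powr (1 - 1 / p) = schatten_norm (ereal (p / (p - 1))) R"
    unfolding schatten_norm_psd[OF R sdR] using p by (simp add: field_simps)
  also have "(\<Sum>j<n. s j powr p) powr (1 / p) = schatten_norm (ereal p) ?S"
    unfolding schatten_norm_psd[OF S sdS] ..
  also have "sqrt (x * (x + real m - 1)) / (x powr p + real m - 1) powr (1 / p) = C_const (ereal p) m"
    by (simp add: C_const_def x_def Let_def)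
  finally show ?thesis using *(6) by linarith
qed

lemma op_norm_nonneg: "A \<in> carrier_mat n n \<Longrightarrow> 0 \<le> op_norm A"
proof -
  assume A: "A \<in> carrier_mat n n"
  have "0 \<le> eucl_norm (A *\<^sub>v 0\<^sub>v n)"
    unfolding eucl_norm_alt[OF mult_mat_vec_carrier[OF A zero_carrier_vec]] by (simp add: sum_nonneg)
  also have "\<dots> \<le> op_norm A"
    by (rule eucl_norm_le_op_norm[OF A zero_carrier_vec]) (simp add: eucl_norm_alt[OF zero_carrier_vec])
  finally show ?thesis .
qed

text \<open>No interpolation is involved: the \<open>s j\<close> and the \<open>w b\<close> are at
  most the operator norm \<open>M\<close> of the sum, and Bessel bounds each column length by
  \<open>sqrt m * M\<close>.\<close>

lemma upper_bound_infinite: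
  fixes R :: "complex mat" and X :: "nat \<Rightarrow> complex mat"
  assumes m: "1 \<le> m" and R: "psd_mat n R" and X: "\<And>k. k \<in> {1..m} \<Longrightarrow> psd_mat n (X k)"
  shows "(\<Sum>k=1..m. schatten_norm 1 (R * X k))
    \<le> sqrt m * schatten_norm 1 R * op_norm (finsum (module_mat TYPE(complex) n n) X {1..m})"
proof -
  let ?S = "finsum (module_mat TYPE(complex) n n) X {1..m}"
  have S: "psd_mat n ?S" by (rule psd_finsum) (simp_all add: X)
  have cS: "?S \<in> carrier_mat n n" using S by (simp add: psd_mat_def)
  obtain \<Psi> a where sdR: "spectral_decomp n R \<Psi> a" using psd_spectral[OF R] by (elim exE conjE)
  obtain \<Phi> s where sdS: "spectral_decomp n ?S \<Phi> s" using psd_spectral[OF S] by (elim exE conjE)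
  have a0: "0 \<le> a l" if "l < n" for l using psd_eigenvalue_nonneg[OF R sdR that] .
  define B where "B = {1..m} \<times> {..<n}"
  define J where "J = {j. j < n \<and> 0 < s j}"
  define M where "M = op_norm ?S"
  have M0: "0 \<le> M" unfolding M_def by (rule op_norm_nonneg[OF cS])
  have sM: "s j \<le> M" if "j \<in> J" for j using eigenvalue_le_op_norm[OF sdS cS] that by (simp add: J_def M_def)
  obtain \<theta> u w where *: "orthonormal_on B J \<theta>" "orthonormal_on B {..<n} u" "\<forall>b\<in>B. 0 \<le> w b"
    "\<forall>b\<in>B. (\<Sum>j\<in>J. s j * (norm (\<theta> j b))\<^sup>2) = w b"
    "\<forall>b\<in>B. (\<Sum>l<n. (norm (u l b))\<^sup>2) = 1 / real m"
    "(\<Sum>k=1..m. schatten_norm 1 (R * X k))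
      \<le> (\<Sum>l<n. a l * (sqrt m * sqrt (\<Sum>j\<in>J. s j * (norm (\<Sum>b\<in>B. cnj (\<theta> j b) * of_real (sqrt (w b)) * u l b))\<^sup>2)))"
    by (rule product_sum_representation[OF m R X sdR sdS, folded B_def J_def])
  have fin: "finite J" "finite B" by (auto simp: J_def B_def)
  \<comment> \<open>\<open>w b\<close> is a diagonal entry of an operator with eigenvalues at most
    \<open>M\<close>; Bessel is applied to the basis vector at \<open>b\<close>.\<close>
  have wM: "w b \<le> M" if b: "b \<in> B" for b
  proof -
    have c: "cip B (\<theta> j) (\<lambda>b'. if b = b' then 1 else 0) = cnj (\<theta> j b)" for j
      using b fin(2) by (simp add: cip_def if_distrib[of "\<lambda>x. _ * x"] cong: if_cong)
    have d: "(\<Sum>b'\<in>B. (norm (if b = b' then 1 else 0 :: complex))\<^sup>2) = 1"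
      using b fin(2) by (simp add: if_distrib[of norm] if_distrib[of "\<lambda>x. x\<^sup>2"] cong: if_cong)
    have "w b = (\<Sum>j\<in>J. s j * (norm (\<theta> j b))\<^sup>2)" using *(4) b by simp
    also have "\<dots> \<le> (\<Sum>j\<in>J. M * (norm (\<theta> j b))\<^sup>2)" using sM by (intro sum_mono mult_right_mono) auto
    also have "\<dots> = M * (\<Sum>j\<in>J. (norm (cip B (\<theta> j) (\<lambda>b'. if b = b' then 1 else 0)))\<^sup>2)"
      unfolding c by (simp add: sum_distrib_left)
    also have "\<dots> \<le> M * 1" using bessel[OF fin(1) *(1), of "\<lambda>b'. if b = b' then 1 else 0"] M0 unfolding d
      by (intro mult_left_mono) auto
    finally show ?thesis by simp
  qed
  have N: "sqrt (\<Sum>j\<in>J. s j * (norm (\<Sum>b\<in>B. cnj (\<theta> j b) * of_real (sqrt (w b)) * u l b))\<^sup>2) \<le> M" if l: "l < n" for l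
  proof (rule real_le_lsqrt)
    have u1: "(\<Sum>b\<in>B. (norm (u l b))\<^sup>2) = 1"
    proof -
      have "cip B (u l) (u l) = 1" using *(2) l by (simp add: orthonormal_on_def)
      then show ?thesis unfolding cip_self using of_real_eq_1_iff by blast
    qed
    have "(\<Sum>j\<in>J. s j * (norm (\<Sum>b\<in>B. cnj (\<theta> j b) * of_real (sqrt (w b)) * u l b))\<^sup>2)
        \<le> (\<Sum>j\<in>J. M * (norm (cip B (\<theta> j) (\<lambda>b. of_real (sqrt (w b)) * u l b)))\<^sup>2)"
      using sM by (intro sum_mono mult_mono) (auto simp: cip_def mult.assoc M0)
    also have "\<dots> = M * (\<Sum>j\<in>J. (norm (cip B (\<theta> j) (\<lambda>b. of_real (sqrt (w b)) * u l b)))\<^sup>2)"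
      by (rule sum_distrib_left[symmetric])
    also have "\<dots> \<le> M * (\<Sum>b\<in>B. (norm (of_real (sqrt (w b)) * u l b))\<^sup>2)"
      by (intro mult_left_mono bessel[OF fin(1) *(1)] M0)
    also have "\<dots> \<le> M * (\<Sum>b\<in>B. M * (norm (u l b))\<^sup>2)"
      using *(3) wM M0 by (intro mult_left_mono sum_mono) (auto simp: norm_mult power_mult_distrib intro!: mult_right_mono)
    also have "\<dots> = M\<^sup>2" unfolding sum_distrib_left[symmetric] u1 by (simp add: power2_eq_square)
    finally show "(\<Sum>j\<in>J. s j * (norm (\<Sum>b\<in>B. cnj (\<theta> j b) * of_real (sqrt (w b)) * u l b))\<^sup>2) \<le> M\<^sup>2" .
  qed (use M0 in auto)
  have "(\<Sum>l<n. a l * (sqrt m * sqrt (\<Sum>j\<in>J. s j * (norm (\<Sum>b\<in>B. cnj (\<theta> j b) * of_real (sqrt (w b)) * u l b))\<^sup>2)))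
    \<le> (\<Sum>l<n. a l * (sqrt m * M))"
    using a0 N by (intro sum_mono mult_left_mono) auto
  also have "\<dots> = sqrt m * (\<Sum>l<n. a l) * M" by (simp add: sum_distrib_left sum_distrib_right mult_ac)
  also have "(\<Sum>l<n. a l) = schatten_norm 1 R"
  proof -
    have "schatten_norm 1 R = (\<Sum>l<n. a l powr 1) powr 1" using schatten_norm_psd[OF R sdR, of 1] by (simp add: one_ereal_def)
    also have "(\<Sum>l<n. a l powr 1) = (\<Sum>l<n. a l)" using a0 by (intro sum.cong refl) simp
    also have "\<dots> powr 1 = (\<Sum>l<n. a l)" using a0 by (intro powr_one sum_nonneg) simp
    finally show ?thesis by simp
  qed
  finally show ?thesis using *(6) by (simp add: M_def)
qed

section \<open>The extremal matrices\<close>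

lemma spectral_decomp_rank_one_update:
  fixes v :: "nat \<Rightarrow> complex"
  assumes n: "0 < n" and v: "(\<Sum>i<n. (norm (v i))\<^sup>2) = 1"
  shows "\<exists>U. spectral_decomp n (Matrix.mat n n (\<lambda>(i, j). (if i = j then of_real \<alpha> else 0) + of_real \<gamma> * (v i * cnj (v j))))
    U (\<lambda>i. if i = 0 then \<alpha> + \<gamma> else \<alpha>)"
proof -
  let ?A = "Matrix.mat n n (\<lambda>(i, j). (if i = j then of_real \<alpha> else 0) + of_real \<gamma> * (v i * cnj (v j)))"
  let ?d = "\<lambda>i::nat. if i = 0 then \<alpha> + \<gamma> else \<alpha>"
  have "cip {..<n} v v = 1" unfolding cip_self v by simp
  then have "orthonormal_on {..<n} {0} (\<lambda>_. v)" by (simp add: orthonormal_on_def)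
  \<comment> \<open>Placing \<open>v\<close> in column 0 makes index 0 the one with the shifted
    eigenvalue.\<close>
  then obtain U where U: "unitary_mat n U" and Uv: "\<forall>a<n. U $$ (a, 0) = v a"
    using unitary_completion[of "{0}" n "\<lambda>_. v"] n by auto
  have cU: "U \<in> carrier_mat n n" "mat_adjoint U \<in> carrier_mat n n"
    using U mat_adjoint_carrier unfolding unitary_mat_def by auto
  have "?A = U * mat_diag n (\<lambda>i. complex_of_real (?d i)) * mat_adjoint U"
  proof (rule eq_matI)
    fix i j assume "i < dim_row (U * mat_diag n (\<lambda>i. complex_of_real (?d i)) * mat_adjoint U)"
      "j < dim_col (U * mat_diag n (\<lambda>i. complex_of_real (?d i)) * mat_adjoint U)"
    then have ij: "i < n" "j < n" using cU by auto
    have "(U * mat_diag n (\<lambda>i. complex_of_real (?d i)) * mat_adjoint U) $$ (i, j)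
        = (\<Sum>k<n. of_real \<alpha> * (U $$ (i, k) * cnj (U $$ (j, k))) + (if k = 0 then of_real \<gamma> * (U $$ (i, 0) * cnj (U $$ (j, 0))) else 0))"
      unfolding diag_sandwich_index[OF cU ij] using cU ij by (intro sum.cong refl) (auto simp: algebra_simps)
    also have "\<dots> = (if i = j then of_real \<alpha> else 0) + of_real \<gamma> * (v i * cnj (v j))"
      unfolding sum.distrib sum_distrib_left[symmetric] unitary_rows[OF U ij] using n Uv ij by simp
    finally show "?A $$ (i, j) = (U * mat_diag n (\<lambda>i. complex_of_real (?d i)) * mat_adjoint U) $$ (i, j)"
      using ij by simp
  qed (use cU in auto)
  then have "spectral_decomp n ?A U ?d"
    using U unfolding spectral_decomp_def unitary_mat_def by blast
  then show ?thesis by blast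
qed

text \<open>The matrix factors as \<open>A* A\<close> with \<open>A\<close> supported in row 0,
  which exists because \<open>0 < n\<close>.\<close>

lemma psd_rank_one:
  assumes n: "0 < n"
  shows "psd_mat n (Matrix.mat n n (\<lambda>(i, j). f i * cnj (f j)))"
proof -
  define A where "A = Matrix.mat n n (\<lambda>(k, i). if k = 0 then cnj (f i) else 0)"
  have A: "A \<in> carrier_mat n n" by (simp add: A_def)
  have "mat_adjoint A * A = Matrix.mat n n (\<lambda>(i, j). f i * cnj (f j))"
  proof (rule eq_matI)
    fix i j assume "i < dim_row (Matrix.mat n n (\<lambda>(i, j). f i * cnj (f j)))" "j < dim_col (Matrix.mat n n (\<lambda>(i, j). f i * cnj (f j)))"
    then have ij: "i < n" "j < n" by auto
    have "(mat_adjoint A * A) $$ (i, j) = (\<Sum>k<n. if k = 0 then f i * cnj (f j) else 0)"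
      unfolding index_mult_sum[OF mat_adjoint_carrier[OF A] A ij] using ij A by (intro sum.cong refl) (auto simp: A_def)
    then show "(mat_adjoint A * A) $$ (i, j) = Matrix.mat n n (\<lambda>(i, j). f i * cnj (f j)) $$ (i, j)" using n ij by simp
  qed (use A in auto)
  then show ?thesis using adjoint_mult_psd[OF A] by simp
qed

text \<open>With \<open>v\<close> the normalized all-ones vector, \<open>R = v v*\<close> and
  \<open>S = 1 + (x - 1) v v*\<close>, the choice is \<open>X_k = f_k f_k*\<close> for
  \<open>f_k = S^(1/2) e_k\<close>. These sum to \<open>S\<close>, and by symmetry all
  \<open>R X_k\<close> have the same trace norm, the overlap of \<open>v\<close> with
  \<open>f_k\<close> times the length of \<open>f_k\<close>.\<close>

lemma extremal_family:
  fixes m :: nat and x :: real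
  assumes m: "1 \<le> m" and x: "1 \<le> x"
  obtains R X U V where "psd_mat m R" "\<forall>k\<in>{1..m}. psd_mat m (X k)"
    "spectral_decomp m R U (\<lambda>i. if i = 0 then 1 else 0)"
    "spectral_decomp m (finsum (module_mat TYPE(complex) m m) X {1..m}) V (\<lambda>i. if i = 0 then x else 1)"
    "(\<Sum>k=1..m. schatten_norm 1 (R * X k)) = sqrt (x * (x + real m - 1))"
proof -
  \<comment> \<open>Since \<open>S^(1/2) = 1 + (sqrt x - 1) v v*\<close>, each entry of
    \<open>S^(1/2) e_k - e_k\<close> is \<open>t\<close>. In \<open>f\<close>, the family index
    \<open>k\<close> starts at 1 and the coordinate \<open>i\<close> at 0.\<close>
  define t where "t = (sqrt x - 1) / real m"
  define f where "f k i = (if i + 1 = k then 1 else 0) + t" for k i :: nat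
  define R where "R = Matrix.mat m m (\<lambda>(i, j). complex_of_real (1 / real m))"
  define X where "X k = Matrix.mat m m (\<lambda>(i, j). complex_of_real (f k i) * cnj (complex_of_real (f k j)))" for k
  have m0: "0 < m" using m by simp
  have mt: "real m * t = sqrt x - 1" using m by (simp add: t_def)
  have mtt: "2 * t + real m * t\<^sup>2 = (x - 1) / real m"
  proof -
    have "real m * (2 * t + real m * t\<^sup>2) = 2 * (real m * t) + (real m * t)\<^sup>2" by (simp add: power2_eq_square algebra_simps)
    also have "\<dots> = x - 1" unfolding mt using x by (simp add: power2_eq_square algebra_simps)
    finally show ?thesis using m by (simp add: field_simps)
  qed
  define v where "v i = complex_of_real (1 / sqrt (real m))" for i :: nat
  have v: "(\<Sum>i<m. (norm (v i))\<^sup>2) = 1" using m by (simp add: v_def norm_divide power_divide)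
  have vv: "v i * cnj (v j) = of_real (1 / real m)" for i j
    unfolding v_def using m by (simp flip: of_real_mult of_real_divide)
  have cX: "X k \<in> carrier_mat m m" for k by (simp add: X_def)
  have psdX: "psd_mat m (X k)" for k unfolding X_def by (rule psd_rank_one[OF m0])
  have psdR: "psd_mat m R"
    using psd_rank_one[OF m0, of v] unfolding vv R_def by simp
  obtain U where U: "spectral_decomp m R U (\<lambda>i. if i = 0 then 1 else 0)"
  proof -
    have "R = Matrix.mat m m (\<lambda>(i, j). (if i = j then of_real 0 else 0) + of_real 1 * (v i * cnj (v j)))"
      unfolding R_def vv by (rule eq_matI) auto
    moreover obtain U where "spectral_decomp m (Matrix.mat m m (\<lambda>(i, j). (if i = j then of_real 0 else 0) + of_real 1 * (v i * cnj (v j))))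
        U (\<lambda>i. if i = 0 then 0 + 1 else 0)"
      using spectral_decomp_rank_one_update[OF m0 v, of 0 1] by (elim exE)
    ultimately have "spectral_decomp m R U (\<lambda>i. if i = 0 then 1 else 0)" by (simp only: add_0_left)
    then show ?thesis by (rule that)
  qed
  have Sij: "(\<Sum>k=1..m. f k i * f k j) = (if i = j then 1 else 0) + (x - 1) / real m" if ij: "i < m" "j < m" for i j
  proof -
    have "(\<Sum>k=1..m. f k i * f k j) = (\<Sum>k=1..m. (if k = i + 1 then (if i = j then 1 else 0) else 0)
        + t * (if k = i + 1 then 1 else 0) + t * (if k = j + 1 then 1 else 0) + t\<^sup>2)"
      by (intro sum.cong refl) (auto simp: f_def power2_eq_square algebra_simps)
    also have "\<dots> = (if i = j then 1 else 0) + (2 * t + real m * t\<^sup>2)"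
      using ij by (simp add: sum.distrib flip: sum_distrib_left)
    finally show ?thesis unfolding mtt .
  qed
  have fsum: "(\<Sum>i<m. f k i) = sqrt x" if k: "k \<in> {1..m}" for k
  proof -
    have k1: "k - 1 < m" using k by auto
    have "(\<Sum>i<m. f k i) = (\<Sum>i<m. (if i = k - 1 then 1 else 0) + t)"
      using k by (intro sum.cong refl) (auto simp: f_def)
    also have "\<dots> = 1 + real m * t" using k1 by (simp add: sum.distrib)
    finally show ?thesis unfolding mt by simp
  qed
  have fsq: "(\<Sum>i<m. (f k i)\<^sup>2) = (x + real m - 1) / real m" if k: "k \<in> {1..m}" for k
  proof -
    have k1: "k - 1 < m" using k by auto
    have "(\<Sum>i<m. (f k i)\<^sup>2) = (\<Sum>i<m. (1 + 2 * t) * (if i = k - 1 then 1 else 0) + t\<^sup>2)"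
      using k by (intro sum.cong refl) (auto simp: f_def power2_eq_square algebra_simps)
    also have "\<dots> = 1 + (2 * t + real m * t\<^sup>2)" using k1 by (simp add: sum.distrib flip: sum_distrib_left)
    finally show ?thesis unfolding mtt using m by (simp add: field_simps)
  qed
  let ?S = "finsum (module_mat TYPE(complex) m m) X {1..m}"
  obtain V where V: "spectral_decomp m ?S V (\<lambda>i. if i = 0 then x else 1)"
  proof -
    have "?S = Matrix.mat m m (\<lambda>(i, j). (if i = j then of_real 1 else 0) + of_real (x - 1) * (v i * cnj (v j)))"
      unfolding finsum_mat[OF finite_atLeastAtMost cX] vv
    proof (rule eq_matI)
      fix i j assume "i < dim_row (Matrix.mat m m (\<lambda>(i, j). (if i = j then of_real 1 else 0) + of_real (x - 1) * of_real (1 / real m) :: complex))"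
        "j < dim_col (Matrix.mat m m (\<lambda>(i, j). (if i = j then of_real 1 else 0) + of_real (x - 1) * of_real (1 / real m) :: complex))"
      then have ij: "i < m" "j < m" by auto
      have "(\<Sum>k=1..m. X k $$ (i, j)) = of_real (\<Sum>k=1..m. f k i * f k j)"
        unfolding of_real_sum using ij by (intro sum.cong refl) (simp add: X_def)
      then show "Matrix.mat m m (\<lambda>(i, j). \<Sum>k=1..m. X k $$ (i, j)) $$ (i, j)
        = Matrix.mat m m (\<lambda>(i, j). (if i = j then of_real 1 else 0) + of_real (x - 1) * of_real (1 / real m)) $$ (i, j)"
        unfolding Sij[OF ij] using ij by simp
    qed auto
    moreover obtain V where "spectral_decomp m (Matrix.mat m m (\<lambda>(i, j). (if i = j then of_real 1 else 0) + of_real (x - 1) * (v i * cnj (v j))))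
        V (\<lambda>i. if i = 0 then 1 + (x - 1) else 1)"
      using spectral_decomp_rank_one_update[OF m0 v, of 1 "x - 1"] by (elim exE)
    moreover have "1 + (x - 1) = x" by simp
    ultimately have "spectral_decomp m ?S V (\<lambda>i. if i = 0 then x else 1)" by (simp only:)
    then show ?thesis by (rule that)
  qed
  have norm1: "schatten_norm 1 (R * X k) = sqrt (x * (x + real m - 1)) / real m" if k: "k \<in> {1..m}" for k
  proof -
    define Z where "Z = R * X k"
    \<comment> \<open>\<open>c\<close> is the squared length of \<open>f k\<close>. As
      \<open>R * X k\<close> has rank one, \<open>Z* Z\<close> is a multiple of the projection onto
      the normalized vector \<open>g\<close>.\<close>
    define c where "c = (x + real m - 1) / real m"
    have c0: "0 < c" using x m by (simp add: c_def)
    have R: "R \<in> carrier_mat m m" by (simp add: R_def)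
    have Z: "Z \<in> carrier_mat m m" unfolding Z_def by (rule mult_carrier_mat[OF R cX])
    have Zij: "Z $$ (i, j) = of_real (sqrt x / real m * f k j)" if ij: "i < m" "j < m" for i j
    proof -
      have "Z $$ (i, j) = (\<Sum>l<m. of_real (1 / real m * f k l * f k j))"
        unfolding Z_def index_mult_sum[OF R cX ij] using ij by (intro sum.cong refl) (simp add: R_def X_def)
      also have "\<dots> = of_real (1 / real m * (\<Sum>l<m. f k l) * f k j)"
        unfolding sum_distrib_left sum_distrib_right of_real_sum ..
      finally show ?thesis unfolding fsum[OF k] by simp
    qed
    define g where "g i = complex_of_real (f k i / sqrt c)" for i
    have g: "(\<Sum>i<m. (norm (g i))\<^sup>2) = 1"
    proof -
      have "(\<Sum>i<m. (norm (g i))\<^sup>2) = (\<Sum>i<m. (f k i)\<^sup>2) / c"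
        unfolding sum_divide_distrib g_def norm_of_real using c0 by (simp add: power_divide)
      moreover have "(\<Sum>i<m. (f k i)\<^sup>2) = c" unfolding c_def by (rule fsq[OF k])
      ultimately show ?thesis using c0 by simp
    qed
    have "mat_adjoint Z * Z = Matrix.mat m m (\<lambda>(i, j). (if i = j then of_real 0 else 0) + of_real (x * c / real m) * (g i * cnj (g j)))"
    proof (rule eq_matI)
      fix i j assume "i < dim_row (Matrix.mat m m (\<lambda>(i, j). (if i = j then of_real 0 else 0) + of_real (x * c / real m) * (g i * cnj (g j))))"
        "j < dim_col (Matrix.mat m m (\<lambda>(i, j). (if i = j then of_real 0 else 0) + of_real (x * c / real m) * (g i * cnj (g j))))"
      then have ij: "i < m" "j < m" by auto
      have "(mat_adjoint Z * Z) $$ (i, j) = (\<Sum>l<m. of_real (sqrt x / real m * f k i * (sqrt x / real m * f k j)))"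
        unfolding index_mult_sum[OF mat_adjoint_carrier[OF Z] Z ij] using ij Z by (intro sum.cong refl) (simp add: Zij)
      also have "\<dots> = of_real (real m * (sqrt x / real m * f k i * (sqrt x / real m * f k j)))" by simp
      also have "real m * (sqrt x / real m * f k i * (sqrt x / real m * f k j)) = (sqrt x * sqrt x) / real m * (f k i * f k j)"
        using m by (simp add: field_simps)
      also have "\<dots> = x * c / real m * (f k i / sqrt c * (f k j / sqrt c))" using x c0 by (simp add: field_simps)
      also have "of_real (x * c / real m * (f k i / sqrt c * (f k j / sqrt c))) = of_real (x * c / real m) * (g i * cnj (g j))"
        unfolding g_def complex_cnj_complex_of_real of_real_mult ..
      finally show "(mat_adjoint Z * Z) $$ (i, j)
        = Matrix.mat m m (\<lambda>(i, j). (if i = j then of_real 0 else 0) + of_real (x * c / real m) * (g i * cnj (g j))) $$ (i, j)"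
        using ij by simp
    qed (use Z in auto)
    moreover obtain G where "spectral_decomp m (Matrix.mat m m (\<lambda>(i, j). (if i = j then of_real 0 else 0) + of_real (x * c / real m) * (g i * cnj (g j))))
        G (\<lambda>i. if i = 0 then 0 + x * c / real m else 0)"
      using spectral_decomp_rank_one_update[OF m0 g, of 0 "x * c / real m"] by (elim exE)
    ultimately have G: "spectral_decomp m (mat_adjoint Z * Z) G (\<lambda>i. if i = 0 then x * c / real m else 0)"
      by (simp only: add_0_left)
    have nn: "0 \<le> x * c / real m" using x c0 by simp
    have "schatten_norm 1 Z = (\<Sum>i<m. (if i = 0 then x * c / real m else 0) powr (1 / 2)) powr 1"
      using schatten_norm_spectral[OF Z G, of 1] nn by (simp add: one_ereal_def)
    also have "(\<Sum>i<m. (if i = 0 then x * c / real m else 0) powr (1 / 2)) = (\<Sum>i<m. if i = 0 then sqrt (x * c / real m) else 0)"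
      using nn by (intro sum.cong refl) (auto simp: powr_half_sqrt)
    also have "\<dots> = sqrt (x * c / real m)" using m0 by simp
    also have "\<dots> powr 1 = sqrt (x * c / real m)" using nn by simp
    also have "x * c / real m = x * (x + real m - 1) / (real m)\<^sup>2" by (simp add: c_def power2_eq_square)
    also have "sqrt \<dots> = sqrt (x * (x + real m - 1)) / real m" by (simp add: real_sqrt_divide)
    finally show ?thesis by (simp add: Z_def)
  qed
  have "(\<Sum>k=1..m. schatten_norm 1 (R * X k)) = sqrt (x * (x + real m - 1))"
    using m by (simp add: norm1)
  then show thesis using psdR psdX U V by (intro that[of R X U V]) auto
qed

lemma op_norm_one:
  assumes "0 < n"
  shows "op_norm (1\<^sub>m n) = 1"
proof -
  have one: "unit_vec n 0 \<in> carrier_vec n" "eucl_norm (unit_vec n 0) = 1"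
    using assms by (simp_all add: eucl_norm_alt[of _ n] if_distrib[of norm] if_distrib[of "\<lambda>x. x\<^sup>2"] cong: if_cong)
  show ?thesis unfolding op_norm_def
  proof (rule cSup_eq_maximum)
    show "1 \<in> {eucl_norm (1\<^sub>m n *\<^sub>v v) |v. v \<in> carrier_vec (dim_col (1\<^sub>m n)) \<and> eucl_norm v \<le> 1}"
      using one by (intro CollectI exI[of _ "unit_vec n 0"]) simp
  qed auto
qed

theorem corollary4p2:
  fixes m :: nat and p q :: ereal
  assumes m: "1 \<le> m"
    and p: "2 \<le> p"
    and q: "q = (if p = \<infinity> then 1 else p / (p - 1))"
  shows "(p \<noteq> \<infinity> \<longrightarrow> (\<exists>!x::real. 1 < x \<and> x powr real_of_ereal p = 2 * x + real m - 1)) \<and>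
    (\<forall>(n::nat) (R::complex mat) (X::nat \<Rightarrow> complex mat).
       psd_mat n R \<longrightarrow> (\<forall>k\<in>{1..m}. psd_mat n (X k)) \<longrightarrow>
       (\<Sum>k=1..m. schatten_norm 1 (R * X k))
         \<le> C_const p m * schatten_norm q R
             * schatten_norm p (finsum (module_mat TYPE(complex) n n) X {1..m})) \<and>
    (\<forall>C::real.
       (\<forall>(n::nat) (R::complex mat) (X::nat \<Rightarrow> complex mat).
          psd_mat n R \<longrightarrow> (\<forall>k\<in>{1..m}. psd_mat n (X k)) \<longrightarrow>
          (\<Sum>k=1..m. schatten_norm 1 (R * X k))
            \<le> C * schatten_norm q R
                * schatten_norm p (finsum (module_mat TYPE(complex) n n) X {1..m}))
       \<longrightarrow> C_const p m \<le> C)"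
proof (cases "p = \<infinity>")
  case True
  then have q1: "q = 1" using q by simp
  have C: "C_const p m = sqrt (real m)" using True by (simp add: C_const_def)
  have sp: "schatten_norm p A = op_norm A" for A using True by (simp add: schatten_norm_def)
  show ?thesis
  proof (intro conjI allI impI)
    fix n R and X :: "nat \<Rightarrow> complex mat"
    assume "psd_mat n R" "\<forall>k\<in>{1..m}. psd_mat n (X k)"
    then show "(\<Sum>k=1..m. schatten_norm 1 (R * X k))
       \<le> C_const p m * schatten_norm q R * schatten_norm p (finsum (module_mat TYPE(complex) n n) X {1..m})"
      unfolding q1 C sp using upper_bound_infinite[OF m] by blast
  next
    fix C
    assume bound: "\<forall>n R X. psd_mat n R \<longrightarrow> (\<forall>k\<in>{1..m}. psd_mat n (X k)) \<longrightarrow>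
          (\<Sum>k=1..m. schatten_norm 1 (R * X k))
            \<le> C * schatten_norm q R * schatten_norm p (finsum (module_mat TYPE(complex) n n) X {1..m})"
    \<comment> \<open>For \<open>x = 1\<close> the \<open>X k\<close> are the coordinate
      projections, whose sum is the identity; the trace norms then add up to \<open>sqrt m\<close>
      while \<open>R\<close> has trace norm 1.\<close>
    obtain R X U V where ex: "psd_mat m R" "\<forall>k\<in>{1..m}. psd_mat m (X k)"
      "spectral_decomp m R U (\<lambda>i. if i = 0 then 1 else 0)"
      "spectral_decomp m (finsum (module_mat TYPE(complex) m m) X {1..m}) V (\<lambda>i. if i = 0 then 1 else 1)"
      "(\<Sum>k=1..m. schatten_norm 1 (R * X k)) = sqrt (1 * (1 + real m - 1))"
      by (rule extremal_family[OF m order_refl])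
    have V: "unitary_mat m V" by (rule spectral_decomp_unitary[OF ex(4)])
    have "finsum (module_mat TYPE(complex) m m) X {1..m} = V * mat_diag m (\<lambda>i. complex_of_real (if i = 0 then 1 else 1)) * mat_adjoint V"
      using ex(4) by (simp add: spectral_decomp_def)
    also have "\<dots> = V * mat_adjoint V" using V right_mult_one_mat[of V m m] by (simp add: unitary_mat_def)
    also have "\<dots> = 1\<^sub>m m" using V by (simp add: unitary_mat_def)
    finally have S: "finsum (module_mat TYPE(complex) m m) X {1..m} = 1\<^sub>m m" .
    have R: "schatten_norm q R = 1"
      using schatten_norm_psd[OF ex(1,3), of 1] m
      by (simp add: q1 one_ereal_def if_distrib[of "\<lambda>x. x powr _"] cong: if_cong)
    have "op_norm (1\<^sub>m m) = 1" using op_norm_one m by simp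
    then show "C_const p m \<le> C" using bound[rule_format, OF ex(1), of X] ex(2,5) unfolding S R C sp by simp
  qed (use True in simp)
next
  case False
  with p obtain r where r: "p = ereal r" by (cases p) auto
  have r2: "2 \<le> r" using p unfolding r by (simp add: numeral_eq_ereal)
  have qr: "q = ereal (r / (r - 1))" using q False r2 unfolding r by (simp add: one_ereal_def)
  define x where "x = x_root r m"
  have x: "1 < x" "x powr r = 2 * x + real m - 1" using x_root[OF r2 m] by (simp_all add: x_def)
  have C: "C_const p m = sqrt (x * (x + real m - 1)) / (x powr r + real m - 1) powr (1 / r)"
    unfolding r by (simp add: C_const_def x_def Let_def)
  show ?thesis
  proof (intro conjI allI impI)
    show "\<exists>!x::real. 1 < x \<and> x powr real_of_ereal p = 2 * x + real m - 1"
      unfolding r using x_root_ex1[OF r2 m] by simp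
  next
    fix n R and X :: "nat \<Rightarrow> complex mat"
    assume "psd_mat n R" "\<forall>k\<in>{1..m}. psd_mat n (X k)"
    then show "(\<Sum>k=1..m. schatten_norm 1 (R * X k))
       \<le> C_const p m * schatten_norm q R * schatten_norm p (finsum (module_mat TYPE(complex) n n) X {1..m})"
      unfolding qr unfolding r using upper_bound_finite[OF m r2] by blast
  next
    fix C
    assume bound: "\<forall>n R X. psd_mat n R \<longrightarrow> (\<forall>k\<in>{1..m}. psd_mat n (X k)) \<longrightarrow>
          (\<Sum>k=1..m. schatten_norm 1 (R * X k))
            \<le> C * schatten_norm q R * schatten_norm p (finsum (module_mat TYPE(complex) n n) X {1..m})"
    \<comment> \<open>In dimension \<open>m\<close>, with \<open>x\<close> the root,
      \<open>R\<close> has norm 1 and the sum has eigenvalues \<open>x, 1, ..., 1\<close>; the ratio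
      of the two sides is then \<open>C_const p m\<close>.\<close>
    obtain R X U V where ex: "psd_mat m R" "\<forall>k\<in>{1..m}. psd_mat m (X k)"
      "spectral_decomp m R U (\<lambda>i. if i = 0 then 1 else 0)"
      "spectral_decomp m (finsum (module_mat TYPE(complex) m m) X {1..m}) V (\<lambda>i. if i = 0 then x else 1)"
      "(\<Sum>k=1..m. schatten_norm 1 (R * X k)) = sqrt (x * (x + real m - 1))"
      by (rule extremal_family[OF m less_imp_le[OF x(1)]])
    have S: "psd_mat m (finsum (module_mat TYPE(complex) m m) X {1..m})"
      using ex(2) by (intro psd_finsum) auto
    have R: "schatten_norm q R = 1"
      using schatten_norm_psd[OF ex(1,3), of "r / (r - 1)"] m
      by (simp add: qr if_distrib[of "\<lambda>x. x powr _"] cong: if_cong)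
    have "(\<Sum>i<m. (if i = 0 then x else 1) powr r) = (\<Sum>i<m. 1 + (if i = 0 then x powr r - 1 else 0))"
      by (intro sum.cong refl) auto
    also have "\<dots> = x powr r + real m - 1" using m by (simp add: sum.distrib)
    finally have "schatten_norm p (finsum (module_mat TYPE(complex) m m) X {1..m}) = (x powr r + real m - 1) powr (1 / r)"
      using schatten_norm_psd[OF S ex(4), of r] unfolding r by simp
    then have "sqrt (x * (x + real m - 1)) \<le> C * (x powr r + real m - 1) powr (1 / r)"
      using bound[rule_format, OF ex(1), of X] ex(2,5) unfolding R by simp
    moreover have "0 < (x powr r + real m - 1) powr (1 / r)" unfolding x(2) using x(1) m by simp
    ultimately show "C_const p m \<le> C" unfolding C by (simp add: pos_divide_le_eq)
  qed
qed

end
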